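(* Let $G$ be a profinite group. Then the following are equivalent. (i) $\mathcal{S}(G)$ is not perfect. (ii) $G$ has an isolated open subgroup. (iii) Every open subgroup of $G$ is isolated. (iv) $\Phi(G)$ is an open normal subgroup of $G$. (v) $G$ is (topologically) finitely generated, virtually pronilpotent, and only finitely many primes divide the order of $G$.
   Context: For a profinite group $G$, $\mathcal{S}(G)$ is the set of closed subgroups of $G$ with the profinite topology obtained from $\mathcal{S}(G)=\varprojlim\mathcal{S}(G_\lambda)$, where $G=\varprojlim G_\lambda$ with $G_\lambda$ finite and each finite set $\mathcal{S}(G_\lambda)$ is discrete; equivalently, the sets $B(H,N)=\{K \text{ a closed subgroup of } G\mid KN=HN\}$, with $N$ ranging over the open normal subgroups of $G$, form a base of open neighbourhoods of $H\in\mathcal{S}(G)$. The space $\mathcal{S}(G)$ is perfect if it has no isolated point. A closed subgroup $H$ of $G$ is an isolated subgroup of $G$ if $H$ is an isolated point of $\mathcal{S}(G)$. $\Phi(G)$, the Frattini subgroup, is the intersection of the maximal (proper) open subgroups of $G$ (equal to $G$ if there are none). The order of $G$ is the supernatural number given by the least common multiple of the indices $|G:N|$, $N$ open normal. Pronilpotent means an inverse limit of finite nilpotent groups; virtually pronilpotent means having an open pronilpotent subgroup. *)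

theory Defs
  imports "HOL-Analysis.Analysis" "HOL-Algebra.Product_Groups" "HOL-Library.Extended_Nat"
    "HOL-Computational_Algebra.Primes"
begin

section \<open>Finite nilpotent groups\<close>

primrec lower_central :: "('a, 'c) monoid_scheme \<Rightarrow> nat \<Rightarrow> 'a set" where
  "lower_central G 0 = carrier G"
| "lower_central G (Suc n) = generate G
     (\<Union>x\<in>lower_central G n. \<Union>y\<in>carrier G. {x \<otimes>\<^bsub>G\<^esub> y \<otimes>\<^bsub>G\<^esub> inv\<^bsub>G\<^esub> x \<otimes>\<^bsub>G\<^esub> inv\<^bsub>G\<^esub> y})"

definition nilpotent_group :: "('a, 'c) monoid_scheme \<Rightarrow> bool" where
  "nilpotent_group G \<longleftrightarrow> group G \<and> (\<exists>n. lower_central G n = {\<one>\<^bsub>G\<^esub>})"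

section \<open>Inverse limits of finite groups\<close>

text \<open>
  A pair \<open>(i, j) \<in> r\<close> means \<open>i \<le> j\<close> in the directed index set, and \<open>f i j\<close> is then the
  transition homomorphism from the group at \<open>j\<close> to the group at \<open>i\<close>.
\<close>

definition inverse_system ::
  "'i set \<Rightarrow> 'i rel \<Rightarrow> ('i \<Rightarrow> 'b monoid) \<Rightarrow> ('i \<Rightarrow> 'i \<Rightarrow> 'b \<Rightarrow> 'b) \<Rightarrow> bool" where
  "inverse_system I r A f \<longleftrightarrow>
     I \<noteq> {} \<and> partial_order_on I r \<and>
     (\<forall>i\<in>I. \<forall>j\<in>I. \<exists>k\<in>I. (i, k) \<in> r \<and> (j, k) \<in> r) \<and>
     (\<forall>i\<in>I. group (A i)) \<and>
     (\<forall>(i, j)\<in>r. f i j \<in> hom (A j) (A i)) \<and>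
     (\<forall>i\<in>I. \<forall>x\<in>carrier (A i). f i i x = x) \<and>
     (\<forall>(i, j)\<in>r. \<forall>(j', k)\<in>r. j = j' \<longrightarrow> (\<forall>x\<in>carrier (A k). f i j (f j k x) = f i k x))"

definition inverse_limit ::
  "'i set \<Rightarrow> 'i rel \<Rightarrow> ('i \<Rightarrow> 'b monoid) \<Rightarrow> ('i \<Rightarrow> 'i \<Rightarrow> 'b \<Rightarrow> 'b) \<Rightarrow> ('i \<Rightarrow> 'b) monoid" where
  "inverse_limit I r A f = (product_group I A)
     \<lparr>carrier := {x \<in> carrier (product_group I A). \<forall>(i, j)\<in>r. f i j (x j) = x i}\<rparr>"

definition inverse_limit_topology ::
  "'i set \<Rightarrow> 'i rel \<Rightarrow> ('i \<Rightarrow> 'b monoid) \<Rightarrow> ('i \<Rightarrow> 'i \<Rightarrow> 'b \<Rightarrow> 'b) \<Rightarrow> ('i \<Rightarrow> 'b) topology" where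
  "inverse_limit_topology I r A f = subtopology
     (product_topology (\<lambda>i. discrete_topology (carrier (A i))) I)
     (carrier (inverse_limit I r A f))"

text \<open>
  \<open>is_inverse_limit_of_finite P G T\<close>: the group \<open>G\<close> with the topology \<open>T\<close> is topologically
  isomorphic to an inverse limit of finite groups satisfying \<open>P\<close>.  A definition cannot quantify
  over types, so the system is indexed by sets of elements of \<open>G\<close> and its groups consist
  of such sets.  For \<open>P\<close> inherited by subgroups, quotients and isomorphic copies (such as
  \<open>True\<close> and nilpotency) this is no restriction: the quotients \<open>G Mod N\<close>, indexed by the open
  normal subgroups \<open>N\<close> for which \<open>G Mod N\<close> satisfies \<open>P\<close>, form a system of this kind.
\<close>

definition is_inverse_limit_of_finite ::
  "('a set monoid \<Rightarrow> bool) \<Rightarrow> ('a, 'c) monoid_scheme \<Rightarrow> 'a topology \<Rightarrow> bool" where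
  "is_inverse_limit_of_finite P G T \<longleftrightarrow>
     group G \<and> topspace T = carrier G \<and>
     (\<exists>(I :: 'a set set) r (A :: 'a set \<Rightarrow> 'a set monoid) f.
        inverse_system I r A f \<and>
        (\<forall>i\<in>I. finite (carrier (A i)) \<and> P (A i)) \<and>
        (\<exists>\<phi>. \<phi> \<in> iso G (inverse_limit I r A f) \<and>
             homeomorphic_map T (inverse_limit_topology I r A f) \<phi>))"

definition profinite_group :: "('a, 'c) monoid_scheme \<Rightarrow> 'a topology \<Rightarrow> bool" where
  "profinite_group G T \<longleftrightarrow> is_inverse_limit_of_finite (\<lambda>_. True) G T"

definition pronilpotent_group :: "('a, 'c) monoid_scheme \<Rightarrow> 'a topology \<Rightarrow> bool" where
  "pronilpotent_group G T \<longleftrightarrow> is_inverse_limit_of_finite nilpotent_group G T"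

section \<open>Open and closed subgroups\<close>

definition open_subgroup :: "'a set \<Rightarrow> ('a, 'c) monoid_scheme \<Rightarrow> 'a topology \<Rightarrow> bool" where
  "open_subgroup H G T \<longleftrightarrow> subgroup H G \<and> openin T H"

definition closed_subgroup :: "'a set \<Rightarrow> ('a, 'c) monoid_scheme \<Rightarrow> 'a topology \<Rightarrow> bool" where
  "closed_subgroup H G T \<longleftrightarrow> subgroup H G \<and> closedin T H"

definition open_normal_subgroup :: "'a set \<Rightarrow> ('a, 'c) monoid_scheme \<Rightarrow> 'a topology \<Rightarrow> bool" where
  "open_normal_subgroup N G T \<longleftrightarrow> N \<lhd> G \<and> openin T N"

definition virtually_pronilpotent :: "('a, 'c) monoid_scheme \<Rightarrow> 'a topology \<Rightarrow> bool" where
  "virtually_pronilpotent G T \<longleftrightarrow>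
     (\<exists>H. open_subgroup H G T \<and> pronilpotent_group (G\<lparr>carrier := H\<rparr>) (subtopology T H))"

definition topologically_finitely_generated ::
  "('a, 'c) monoid_scheme \<Rightarrow> 'a topology \<Rightarrow> bool" where
  "topologically_finitely_generated G T \<longleftrightarrow>
     (\<exists>S. finite S \<and> S \<subseteq> carrier G \<and> T closure_of (generate G S) = carrier G)"

definition maximal_open_subgroup ::
  "'a set \<Rightarrow> ('a, 'c) monoid_scheme \<Rightarrow> 'a topology \<Rightarrow> bool" where
  "maximal_open_subgroup M G T \<longleftrightarrow>
     open_subgroup M G T \<and> M \<noteq> carrier G \<and>
     (\<forall>K. open_subgroup K G T \<and> M \<subseteq> K \<longrightarrow> K = M \<or> K = carrier G)"

definition frattini :: "('a, 'c) monoid_scheme \<Rightarrow> 'a topology \<Rightarrow> 'a set" where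
  "frattini G T = carrier G \<inter> \<Inter>{M. maximal_open_subgroup M G T}"

text \<open>
  A supernatural number is represented by its exponents at the primes, and a least common
  multiple of natural numbers by the suprema of theirs.  The values of \<open>profinite_order G T\<close>
  at non-primes are irrelevant.
\<close>

definition profinite_order :: "('a, 'c) monoid_scheme \<Rightarrow> 'a topology \<Rightarrow> nat \<Rightarrow> enat" where
  "profinite_order G T p =
     (SUP N\<in>{N. open_normal_subgroup N G T}. enat (multiplicity p (card (rcosets\<^bsub>G\<^esub> N))))"

definition prime_divides_order :: "nat \<Rightarrow> ('a, 'c) monoid_scheme \<Rightarrow> 'a topology \<Rightarrow> bool" where
  "prime_divides_order p G T \<longleftrightarrow> Factorial_Ring.prime p \<and> profinite_order G T p > 0"

section \<open>The space of closed subgroups\<close>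

definition subgroup_nbhd ::
  "('a, 'c) monoid_scheme \<Rightarrow> 'a topology \<Rightarrow> 'a set \<Rightarrow> 'a set \<Rightarrow> 'a set set" where
  "subgroup_nbhd G T H N = {K. closed_subgroup K G T \<and> K <#>\<^bsub>G\<^esub> N = H <#>\<^bsub>G\<^esub> N}"

definition subgroup_space :: "('a, 'c) monoid_scheme \<Rightarrow> 'a topology \<Rightarrow> 'a set topology" where
  "subgroup_space G T = topology_generated_by
     {subgroup_nbhd G T H N | H N. closed_subgroup H G T \<and> open_normal_subgroup N G T}"

definition isolated_point :: "'b topology \<Rightarrow> 'b \<Rightarrow> bool" where
  "isolated_point Y x \<longleftrightarrow> x \<in> topspace Y \<and> openin Y {x}"

definition perfect_space :: "'b topology \<Rightarrow> bool" where
  "perfect_space Y \<longleftrightarrow> (\<nexists>x. isolated_point Y x)"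

definition isolated_subgroup :: "'a set \<Rightarrow> ('a, 'c) monoid_scheme \<Rightarrow> 'a topology \<Rightarrow> bool" where
  "isolated_subgroup H G T \<longleftrightarrow> closed_subgroup H G T \<and> isolated_point (subgroup_space G T) H"

end

theory Submission
  imports Defs "HOL-Algebra.Sylow" "HOL-Algebra.Zassenhaus" "HOL-Algebra.Multiplicative_Group"
    "HOL-Number_Theory.Cong"
begin

text \<open>
  The condition that everything turns on is that a normal subgroup \<open>N\<close> of \<open>H\<close> has no proper
  supplement: \<open>K N = H\<close> forces \<open>K = H\<close>. A subgroup is isolated exactly if it is the only closed
  subgroup \<open>K\<close> with \<open>K N = H N\<close> for some open normal \<open>N\<close>. Since \<open>H N\<close> is itself such a \<open>K\<close>,
  isolated subgroups are open, and for open \<open>H\<close> the subgroup \<open>N\<close> can be shrunk into \<open>H\<close>, so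
  that isolation says that some open normal \<open>N \<le> H\<close> has no proper supplement in \<open>H\<close>.
  For \<open>H = G\<close> this means that \<open>N\<close> lies in the Frattini subgroup, because every proper closed
  subgroup is contained in a maximal open one (\<open>isolated_carrier_iff_frattini_open\<close>).

  Suppose that \<open>N\<close> has no proper supplement in the open subgroup \<open>H\<close>. Coset representatives
  of \<open>N\<close> topologically generate \<open>G\<close>. In a quotient of \<open>H\<close> by an open normal \<open>L \<le> N\<close> the image of \<open>N\<close>
  still has no proper supplement; by the Frattini argument its Sylow subgroups are then normal, so it is
  nilpotent and \<open>N\<close> is pronilpotent. If a prime \<open>p\<close> divided the order of the image of \<open>N\<close> but
  not its index, a Sylow \<open>p\<close>-subgroup \<open>P\<close> of it would be normal with index prime to \<open>p\<close>, and
  modulo the derived subgroup of \<open>P\<close> the abelian case of the Schur--Zassenhaus theorem would give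
  a complement, hence a proper supplement. So every prime dividing the order of \<open>G\<close> divides
  \<open>|G : N|\<close>. The finite group theory ends with \<open>lower_central_trivial_of_nonsupplemented\<close> and
  \<open>prime_dvd_index_of_nonsupplemented\<close>.

  Conversely, let \<open>G\<close> be finitely generated and virtually pronilpotent with only finitely many
  primes dividing its order, and let \<open>H\<close> be open. Take an open normal pronilpotent \<open>U \<le> H\<close>.
  A maximal open subgroup of \<open>U\<close> is normal in \<open>U\<close> of prime index, so its index in \<open>G\<close> takes
  only finitely many values; a finitely generated group has only finitely many open subgroups of
  each index; so \<open>\<Phi>(U)\<close> is a finite intersection of open subgroups and is open. It is normal in \<open>G\<close>.
  If \<open>K \<Phi>(U) = H\<close>, the modular law gives \<open>(K \<inter> U) \<Phi>(U) = U\<close>, so \<open>U \<le> K\<close> and \<open>K = H\<close>. Hence \<open>H\<close>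
  is isolated.
\<close>

section \<open>Products, cosets and indices\<close>

lemma mem_set_mult: "x \<in> A <#>\<^bsub>G\<^esub> B \<longleftrightarrow> (\<exists>a\<in>A. \<exists>b\<in>B. x = a \<otimes>\<^bsub>G\<^esub> b)"
  by (auto simp: set_mult_def)

lemma mem_r_coset: "y \<in> A #>\<^bsub>G\<^esub> x \<longleftrightarrow> (\<exists>a\<in>A. y = a \<otimes>\<^bsub>G\<^esub> x)"
  by (auto simp: r_coset_def)

context group
begin

lemma subgroup_set_mult_normal:
  assumes "subgroup K G" "N \<lhd> G"
  shows "subgroup (K <#> N) G"
  by (metis assms commut_normal mult_norm_subgroup)

lemma set_mult_superset1:
  assumes "K \<subseteq> carrier G" "subgroup N G"
  shows "K \<subseteq> K <#> N"
  using assms subgroup.one_closed by (force simp: mem_set_mult)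

lemma set_mult_superset2:
  assumes "subgroup K G" "N \<subseteq> carrier G"
  shows "N \<subseteq> K <#> N"
  using assms subgroup.one_closed by (force simp: mem_set_mult)

lemma set_mult_subgroup_subset:
  assumes "subgroup H G" "K \<subseteq> H" "N \<subseteq> H"
  shows "K <#> N \<subseteq> H"
  unfolding set_mult_def using assms subgroup.m_closed[OF assms(1)] by blast

text \<open>
  Dedekind's modular law.
\<close>

lemma set_mult_Int_modular:
  assumes "subgroup H G" "K \<subseteq> carrier G" "N \<subseteq> H"
  shows "(K \<inter> H) <#> N = (K <#> N) \<inter> H"
proof
  show "(K \<inter> H) <#> N \<subseteq> (K <#> N) \<inter> H"
    unfolding set_mult_def using assms subgroup.m_closed[OF assms(1)] by blast
  show "(K <#> N) \<inter> H \<subseteq> (K \<inter> H) <#> N"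
  proof
    fix x assume "x \<in> (K <#> N) \<inter> H"
    then obtain k n where x: "x \<in> H" "k \<in> K" "n \<in> N" "x = k \<otimes> n"
      by (auto simp: mem_set_mult)
    have c: "x \<in> carrier G" "k \<in> carrier G" "n \<in> carrier G"
      using x assms subgroup.subset by blast+
    have "k = x \<otimes> inv n"
      using x(4) c by (simp add: m_assoc)
    moreover have "x \<otimes> inv n \<in> H"
      using x(1,3) assms(1,3) by (auto intro: subgroup.m_closed subgroup.m_inv_closed)
    ultimately have "k \<in> H" by (rule ssubst)
    with x show "x \<in> (K \<inter> H) <#> N"
      by (auto simp: mem_set_mult)
  qed
qed

lemma set_mult_subgroup_absorb:
  assumes "subgroup K G" "subgroup N G" "N \<subseteq> K"
  shows "K <#> N = K"
  using assms set_mult_superset1[of K N] set_mult_subgroup_subset[of K K N] subgroup.subset by blast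

lemma subgroup_restrict_iff:
  assumes "subgroup H G"
  shows "subgroup K (G\<lparr>carrier := H\<rparr>) \<longleftrightarrow> subgroup K G \<and> K \<subseteq> H"
  using assms incl_subgroup[OF assms] subgroup_incl[of K H] subgroup.subset[of K "G\<lparr>carrier := H\<rparr>"] by auto

lemma r_coset_eq_iff:
  assumes "subgroup L G" "x \<in> carrier G" "y \<in> carrier G"
  shows "L #> x = L #> y \<longleftrightarrow> x \<otimes> inv y \<in> L"
proof -
  have "L #> x = L #> y \<longleftrightarrow> x \<in> L #> y"
    using assms rcos_self[of x L] repr_independence[of x L y] by auto
  then show ?thesis
    using subgroup.rcos_module[OF assms(1) group_axioms assms(3,2)] by simp
qed

lemma rcosets_restrict:
  "rcosets\<^bsub>G\<lparr>carrier := H\<rparr>\<^esub> L = (\<lambda>x. L #> x) ` H"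
  by (auto simp: RCOSETS_def)

lemma some_rcoset_representative:
  assumes N: "subgroup N G" and X: "X \<in> rcosets N"
  shows "(SOME x. x \<in> X) \<in> carrier G" "N #> (SOME x. x \<in> X) = X"
proof -
  obtain x where x: "x \<in> carrier G" "X = N #> x" using X by (auto simp: RCOSETS_def)
  then have "x \<in> X" using rcos_self N by blast
  then have "(SOME x. x \<in> X) \<in> X" by (rule someI)
  moreover have "X \<subseteq> carrier G"
    using r_coset_subset_G[OF subgroup.subset[OF N] x(1)] x by simp
  ultimately show "(SOME x. x \<in> X) \<in> carrier G" "N #> (SOME x. x \<in> X) = X"
    using repr_independence[OF _ x(1) N, of "SOME x. x \<in> X"] x by auto
qed

text \<open>
  Multiplicativity of the index. A coset of \<open>L\<close> is a coset of \<open>L\<close> in \<open>N\<close> moved by the chosen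
  representative of a coset of \<open>N\<close>. The resulting bijection gives the equation for infinite indices
  too, whose value is \<open>0\<close>.
\<close>

lemma card_rcosets_tower:
  assumes L: "subgroup L G" and N: "subgroup N G" and LN: "L \<subseteq> N"
  shows "card (rcosets L) = card (rcosets\<^bsub>G\<lparr>carrier := N\<rparr>\<^esub> L) * card (rcosets N)"
proof -
  define t where "t Y = (SOME y. y \<in> Y)" for Y :: "'a set"
  have t: "t Y \<in> carrier G \<and> N #> t Y = Y" if "Y \<in> rcosets N" for Y
    unfolding t_def using some_rcoset_representative[OF N that] by simp
  let ?F = "\<lambda>(X, Y). X #> t Y"
  have sub: "N \<subseteq> carrier G" "L \<subseteq> carrier G" using N L subgroup.subset by auto
  have "bij_betw ?F ((rcosets\<^bsub>G\<lparr>carrier := N\<rparr>\<^esub> L) \<times> (rcosets N)) (rcosets L)"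
  proof (rule bij_betwI')
    fix P Q
    assume P: "P \<in> (rcosets\<^bsub>G\<lparr>carrier := N\<rparr>\<^esub> L) \<times> (rcosets N)"
      and Q: "Q \<in> (rcosets\<^bsub>G\<lparr>carrier := N\<rparr>\<^esub> L) \<times> (rcosets N)"
    obtain x Y where x: "P = (L #> x, Y)" "x \<in> N" "Y \<in> rcosets N"
      using P by (auto simp: rcosets_restrict)
    obtain x' Y' where x': "Q = (L #> x', Y')" "x' \<in> N" "Y' \<in> rcosets N"
      using Q by (auto simp: rcosets_restrict)
    have c: "x \<in> carrier G" "x' \<in> carrier G" "t Y \<in> carrier G" "t Y' \<in> carrier G"
      using x x' t sub by auto
    have F: "?F P = L #> (x \<otimes> t Y)" "?F Q = L #> (x' \<otimes> t Y')"
      using x x' c sub by (auto simp: coset_mult_assoc)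
    show "(?F P = ?F Q) = (P = Q)"
    proof
      assume eq: "?F P = ?F Q"
      have xy: "x \<otimes> t Y \<in> carrier G" "x' \<otimes> t Y' \<in> carrier G" using c by auto
      have NxY: "N #> (x \<otimes> t Y) = Y" "N #> (x' \<otimes> t Y') = Y'"
        using coset_join2[OF c(1) N x(2)] coset_join2[OF c(2) N x'(2)] t[OF x(3)] t[OF x'(3)]
          coset_mult_assoc[OF sub(1) c(1,3)] coset_mult_assoc[OF sub(1) c(2,4)] by auto
      have "L #> (x \<otimes> t Y) = L #> (x' \<otimes> t Y')" using eq F by simp
      then have "(x \<otimes> t Y) \<otimes> inv (x' \<otimes> t Y') \<in> L" using r_coset_eq_iff[OF L xy] by simp
      then have "N #> (x \<otimes> t Y) = N #> (x' \<otimes> t Y')" using r_coset_eq_iff[OF N xy] LN by blast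
      then have "Y = Y'" unfolding NxY .
      moreover have "L #> x = L #> x'"
      proof -
        have "(L #> x) #> t Y #> inv (t Y) = (L #> x') #> t Y #> inv (t Y)"
          using eq x x' \<open>Y = Y'\<close> by simp
        then show ?thesis
          using c sub by (simp add: coset_mult_assoc m_assoc)
      qed
      ultimately show "P = Q" using x x' by simp
    qed auto
    show "?F P \<in> rcosets L" unfolding F using c sub by (auto intro!: rcosetsI)
  next
    fix X assume "X \<in> rcosets L"
    then obtain x where x: "x \<in> carrier G" "X = L #> x" by (auto simp: RCOSETS_def)
    define Y where "Y = N #> x"
    have Y: "Y \<in> rcosets N" unfolding Y_def using x sub by (auto intro!: rcosetsI)
    note tY = t[OF Y]
    have "x \<in> N #> t Y" using tY x N rcos_self Y_def by auto
    then obtain n where n: "n \<in> N" "x = n \<otimes> t Y" by (auto simp: mem_r_coset)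
    have "n \<in> carrier G" using n sub by auto
    then have "X = (L #> n) #> t Y" using x n tY sub by (simp add: coset_mult_assoc)
    with n Y show "\<exists>P\<in>(rcosets\<^bsub>G\<lparr>carrier := N\<rparr>\<^esub> L) \<times> (rcosets N). X = ?F P"
      by (intro bexI[of _ "(L #> n, Y)"]) (auto simp: rcosets_restrict)
  qed
  then have "card ((rcosets\<^bsub>G\<lparr>carrier := N\<rparr>\<^esub> L) \<times> (rcosets N)) = card (rcosets L)"
    by (rule bij_betw_same_card)
  then show ?thesis by (simp add: card_cartesian_product)
qed

section \<open>The lower central series\<close>

lemma lower_central_subgroup: "subgroup (lower_central G n) G"
proof (induction n)
  case 0
  show ?case by (simp add: subgroup_self)
next
  case (Suc n)
  then have "lower_central G n \<subseteq> carrier G" by (rule subgroup.subset)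
  then show ?case
    by (auto intro!: generate_is_subgroup)
qed

lemma lower_central_commutator:
  assumes "x \<in> lower_central G n" "y \<in> carrier G"
  shows "x \<otimes> y \<otimes> inv x \<otimes> inv y \<in> lower_central G (Suc n)"
  using assms by (auto intro!: generate.incl)

lemma lower_central_Suc_subset:
  assumes "subgroup S G"
    and "\<And>x y. x \<in> lower_central G n \<Longrightarrow> y \<in> carrier G \<Longrightarrow> x \<otimes> y \<otimes> inv x \<otimes> inv y \<in> S"
  shows "lower_central G (Suc n) \<subseteq> S"
  unfolding lower_central.simps using assms by (intro generate_subgroup_incl) auto

end

lemma (in group_hom) lower_central_image:
  "h ` lower_central G n \<subseteq> lower_central H n"
proof (induction n)
  case 0
  show ?case by auto
next
  case (Suc n)
  have sub: "lower_central G n \<subseteq> carrier G" using G.lower_central_subgroup by (rule subgroup.subset)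
  have "h ` lower_central G (Suc n) = generate H (h ` (\<Union>x\<in>lower_central G n. \<Union>y\<in>carrier G. {x \<otimes>\<^bsub>G\<^esub> y \<otimes>\<^bsub>G\<^esub> inv\<^bsub>G\<^esub> x \<otimes>\<^bsub>G\<^esub> inv\<^bsub>G\<^esub> y}))"
    using sub by (subst generate_img) auto
  also have "\<dots> \<subseteq> lower_central H (Suc n)"
  proof (rule H.generate_subgroup_incl[OF _ H.lower_central_subgroup], clarsimp simp del: lower_central.simps)
    fix x y assume xy: "x \<in> lower_central G n" "y \<in> carrier G"
    then have "x \<in> carrier G" using sub by auto
    with xy have "h (x \<otimes>\<^bsub>G\<^esub> y \<otimes>\<^bsub>G\<^esub> inv\<^bsub>G\<^esub> x \<otimes>\<^bsub>G\<^esub> inv\<^bsub>G\<^esub> y) = h x \<otimes>\<^bsub>H\<^esub> h y \<otimes>\<^bsub>H\<^esub> inv\<^bsub>H\<^esub> h x \<otimes>\<^bsub>H\<^esub> inv\<^bsub>H\<^esub> h y"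
      by simp
    also have "\<dots> \<in> lower_central H (Suc n)"
      using Suc xy by (intro H.lower_central_commutator) auto
    finally show "h (x \<otimes>\<^bsub>G\<^esub> y \<otimes>\<^bsub>G\<^esub> inv\<^bsub>G\<^esub> x \<otimes>\<^bsub>G\<^esub> inv\<^bsub>G\<^esub> y) \<in> lower_central H (Suc n)" .
  qed
  finally show ?case .
qed

lemma (in group_hom) lower_central_image_surj:
  assumes "h ` carrier G = carrier H"
  shows "lower_central H n \<subseteq> h ` lower_central G n"
proof (induction n)
  case 0
  show ?case using assms by auto
next
  case (Suc n)
  show ?case
  proof (rule H.lower_central_Suc_subset)
    show "subgroup (h ` lower_central G (Suc n)) H"
      using G.lower_central_subgroup by (rule subgroup_img_is_subgroup)
    fix x y assume "x \<in> lower_central H n" "y \<in> carrier H"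
    then obtain a b where ab: "x = h a" "y = h b" "a \<in> lower_central G n" "b \<in> carrier G"
      using Suc assms by blast
    have "a \<in> carrier G" using ab G.lower_central_subgroup subgroup.subset by blast
    then have "x \<otimes>\<^bsub>H\<^esub> y \<otimes>\<^bsub>H\<^esub> inv\<^bsub>H\<^esub> x \<otimes>\<^bsub>H\<^esub> inv\<^bsub>H\<^esub> y = h (a \<otimes>\<^bsub>G\<^esub> b \<otimes>\<^bsub>G\<^esub> inv\<^bsub>G\<^esub> a \<otimes>\<^bsub>G\<^esub> inv\<^bsub>G\<^esub> b)"
      using ab by simp
    then show "x \<otimes>\<^bsub>H\<^esub> y \<otimes>\<^bsub>H\<^esub> inv\<^bsub>H\<^esub> x \<otimes>\<^bsub>H\<^esub> inv\<^bsub>H\<^esub> y \<in> h ` lower_central G (Suc n)"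
      using G.lower_central_commutator ab by blast
  qed
qed

lemma (in group) lower_central_restrict_mono:
  assumes "subgroup H G" "subgroup U G" "H \<subseteq> U"
  shows "lower_central (G\<lparr>carrier := H\<rparr>) n \<subseteq> lower_central (G\<lparr>carrier := U\<rparr>) n"
proof -
  interpret group_hom "G\<lparr>carrier := H\<rparr>" "G\<lparr>carrier := U\<rparr>" id
    using assms by (auto simp: group_hom_def group_hom_axioms_def hom_def subgroup_imp_group)
  show ?thesis using lower_central_image[of n] by simp
qed

section \<open>Finite groups: p-groups and normal Sylow subgroups\<close>

lemma group_actionI:
  assumes "group G"
    and closed: "\<And>g x. g \<in> carrier G \<Longrightarrow> x \<in> E \<Longrightarrow> f g x \<in> E"
    and one: "\<And>x. x \<in> E \<Longrightarrow> f \<one>\<^bsub>G\<^esub> x = x"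
    and mult: "\<And>g h x. g \<in> carrier G \<Longrightarrow> h \<in> carrier G \<Longrightarrow> x \<in> E \<Longrightarrow> f (g \<otimes>\<^bsub>G\<^esub> h) x = f g (f h x)"
  shows "group_action G E (\<lambda>g. restrict (f g) E)"
proof -
  interpret group G by fact
  have bij: "bij_betw (f g) E E" if g: "g \<in> carrier G" for g
  proof (rule bij_betw_byWitness[where f' = "f (inv\<^bsub>G\<^esub> g)"])
    show "\<forall>x\<in>E. f (inv\<^bsub>G\<^esub> g) (f g x) = x" "\<forall>x\<in>E. f g (f (inv\<^bsub>G\<^esub> g) x) = x"
      using g one mult[symmetric] by auto
    show "f g ` E \<subseteq> E" "f (inv\<^bsub>G\<^esub> g) ` E \<subseteq> E" using g closed by auto
  qed
  have Bij: "restrict (f g) E \<in> Bij E" if g: "g \<in> carrier G" for g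
    using bij[OF g] by (auto simp: Bij_def cong: bij_betw_cong)
  have "(\<lambda>g. restrict (f g) E) \<in> hom G (BijGroup E)"
    using Bij closed by (auto simp: hom_def BijGroup_def compose_def mult intro!: restrict_ext)
  then show ?thesis
    by (simp add: group_action_def group_hom_def group_hom_axioms_def group_BijGroup group_axioms)
qed

text \<open>
  Orbits of a \<open>p\<close>-group have \<open>p\<close>-power size, so the points that are not fixed fall into orbits
  of size divisible by \<open>p\<close>.
\<close>

lemma (in group_action) p_group_dvd_card_moved:
  assumes p: "Factorial_Ring.prime p" and ord: "order G = p ^ n" and fin: "finite E"
  shows "p dvd card (E - {x \<in> E. \<forall>g\<in>carrier G. \<phi> g x = x})"
proof -
  define F where "F = {x \<in> E. \<forall>g\<in>carrier G. \<phi> g x = x}"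
  let ?f = "\<lambda>x. if x \<in> F then 0 else (1::nat)"
  interpret gh: group_hom G "BijGroup E" \<phi> by (rule group_hom)
  have orbF: "orbit G \<phi> x = {x}" if x: "x \<in> F" for x
    using x gh.one_closed unfolding F_def orbit_def by force
  have "card (E - F) = (\<Sum>x\<in>E - F. 1)" by simp
  also have "\<dots> = (\<Sum>x\<in>E. ?f x)" using fin
    by (intro sum.mono_neutral_cong_left) auto
  also have "\<dots> = (\<Sum>orb\<in>orbits G E \<phi>. \<Sum>x\<in>orb. ?f x)" using fin by (rule disjoint_sum[symmetric])
  also have "p dvd \<dots>"
  proof (rule dvd_sum)
    fix R assume R: "R \<in> orbits G E \<phi>"
    then obtain x where x: "x \<in> E" "R = orbit G \<phi> x" by (auto simp: orbits_def)
    show "p dvd (\<Sum>x\<in>R. ?f x)"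
    proof (cases "x \<in> F")
      case True
      then show ?thesis using x orbF by simp
    next
      case False
      have xR: "x \<in> R" using x orbit_refl by simp
      have RF: "R \<inter> F = {}"
      proof (rule ccontr)
        assume "R \<inter> F \<noteq> {}"
        then obtain y where y: "y \<in> R" "y \<in> F" by auto
        then have yE: "y \<in> E" by (auto simp: F_def)
        have "x \<in> orbit G \<phi> y" using orbit_sym[OF x(1) yE] y x by simp
        then show False using orbF[OF y(2)] y False by simp
      qed
      have "card R * card (stabilizer G \<phi> x) = p ^ n"
        using orbit_stabilizer_theorem[OF x(1)] x ord by simp
      then have "card R dvd p ^ n" by (metis dvd_triv_left)
      then obtain i where i: "card R = p ^ i" using p divides_primepow_nat by blast
      have "i \<noteq> 0"
      proof
        assume "i = 0"
        then have "R = {x}" using i xR card_1_singletonE[of R] by auto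
        then have "\<forall>g\<in>carrier G. \<phi> g x = x" using x by (auto simp: orbit_def)
        then show False using False x by (simp add: F_def)
      qed
      have "(\<Sum>x\<in>R. ?f x) = (\<Sum>x\<in>R. 1)" using RF by (intro sum.cong) auto
      then show ?thesis using i \<open>i \<noteq> 0\<close> by simp
    qed
  qed
  finally show ?thesis unfolding F_def .
qed

context group
begin

lemma inv_mult_cancel [simp]:
  "x \<in> carrier G \<Longrightarrow> y \<in> carrier G \<Longrightarrow> inv x \<otimes> (x \<otimes> y) = y"
  "x \<in> carrier G \<Longrightarrow> y \<in> carrier G \<Longrightarrow> x \<otimes> (inv x \<otimes> y) = y"
  by (simp_all add: m_assoc[symmetric])

lemma conjugation_group_hom:
  assumes "h \<in> carrier G"
  shows "group_hom G G (\<lambda>y. h \<otimes> y \<otimes> inv h)"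
  using assms by (auto simp: group_hom_def group_hom_axioms_def hom_def is_group m_assoc)

lemma card_subgroup_dvd:
  assumes "subgroup P G" "subgroup S G" "P \<subseteq> S" "finite (carrier G)"
  shows "card P dvd card S"
proof -
  have "card (rcosets\<^bsub>G\<lparr>carrier := S\<rparr>\<^esub> P) * card P = order (G\<lparr>carrier := S\<rparr>)"
    using assms by (intro group.lagrange subgroup_imp_group subgroup_incl)
  then have "card P * card (rcosets\<^bsub>G\<lparr>carrier := S\<rparr>\<^esub> P) = card S"
    by (simp add: order_def mult.commute)
  then show ?thesis by (metis dvd_triv_left)
qed

text \<open>
  Sylow's conjugacy theorem in the form needed for the Frattini argument. \<open>Q\<close> acts on the cosets
  of \<open>P\<close>, whose number is prime to \<open>p\<close>, and a fixed coset \<open>P x\<close> means \<open>x Q x\<^sup>-\<^sup>1 \<le> P\<close>.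
\<close>

lemma p_subgroup_conj_into_subgroup:
  assumes fin: "finite (carrier G)" and p: "Factorial_Ring.prime p"
    and P: "subgroup P G" and idx: "\<not> p dvd card (rcosets P)"
    and Q: "subgroup Q G" and cardQ: "card Q = p ^ n"
  shows "\<exists>x\<in>carrier G. \<forall>q\<in>Q. x \<otimes> q \<otimes> inv x \<in> P"
proof -
  let ?E = "rcosets P"
  \<comment> \<open>the inverse turns right translation into a left action\<close>
  let ?f = "\<lambda>q X. X #> inv q"
  have subs: "P \<subseteq> carrier G" "Q \<subseteq> carrier G" using P Q subgroup.subset by auto
  interpret Q: group "G\<lparr>carrier := Q\<rparr>" using Q by (rule subgroup_imp_group)
  interpret act: group_action "G\<lparr>carrier := Q\<rparr>" ?E "\<lambda>q. restrict (?f q) ?E"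
  proof (rule group_actionI)
    fix q X assume q: "q \<in> carrier (G\<lparr>carrier := Q\<rparr>)" and X: "X \<in> ?E"
    then obtain x where x: "x \<in> carrier G" "X = P #> x" by (auto simp: RCOSETS_def)
    have "q \<in> carrier G" using q subs by auto
    then have "X #> inv q = P #> (x \<otimes> inv q)" using x subs by (simp add: coset_mult_assoc)
    then show "X #> inv q \<in> ?E"
      using x \<open>q \<in> carrier G\<close> subs by (simp add: rcosetsI)
  next
    fix X assume "X \<in> ?E"
    then have "X \<subseteq> carrier G" using P rcosets_part_G by blast
    then show "X #> inv \<one>\<^bsub>G\<lparr>carrier := Q\<rparr>\<^esub> = X" by simp
  next
    fix g h X assume gh: "g \<in> carrier (G\<lparr>carrier := Q\<rparr>)" "h \<in> carrier (G\<lparr>carrier := Q\<rparr>)" and "X \<in> ?E"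
    then have "X \<subseteq> carrier G" using P rcosets_part_G by blast
    then show "X #> inv (g \<otimes>\<^bsub>G\<lparr>carrier := Q\<rparr>\<^esub> h) = X #> inv h #> inv g"
      using gh subs by (auto simp: coset_mult_assoc inv_mult_group subset_iff)
  qed (rule Q.is_group)
  define F where "F = {X \<in> ?E. \<forall>q\<in>carrier (G\<lparr>carrier := Q\<rparr>). restrict (?f q) ?E X = X}"
  have finE: "finite ?E" using fin by (simp add: RCOSETS_def)
  have "p dvd card (?E - F)"
    unfolding F_def using act.p_group_dvd_card_moved[OF p _ finE] cardQ by (simp add: order_def)
  then have "F \<noteq> {}" using idx by auto
  then obtain X where X: "X \<in> F" by auto
  then obtain x where x: "x \<in> carrier G" "X = P #> x" by (auto simp: F_def RCOSETS_def)
  have "x \<otimes> q \<otimes> inv x \<in> P" if q: "q \<in> Q" for q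
  proof -
    have iq: "inv q \<in> Q" using subgroup.m_inv_closed[OF Q q] .
    have qc: "q \<in> carrier G" using q subs by auto
    have "\<forall>q\<in>Q. P #> x #> inv q = P #> x"
      using X x by (auto simp: F_def)
    then have "P #> x #> inv (inv q) = P #> x" using iq by blast
    then have "P #> (x \<otimes> q) = P #> x" using x qc subs by (simp add: coset_mult_assoc)
    then show ?thesis using r_coset_eq_iff[OF P] x qc by simp
  qed
  then show ?thesis using x by auto
qed

text \<open>
  The centre of a nontrivial \<open>p\<close>-group \<open>G/Y\<close> is nontrivial, expressed by commutators in \<open>G\<close>: the
  fixed points of the conjugation action on \<open>G/Y\<close> are divisible by \<open>p\<close> in number, and \<open>Y\<close> is one
  of them.
\<close>

lemma p_group_central_mod_normal:
  assumes p: "Factorial_Ring.prime p" and ord: "order G = p ^ n" and Y: "Y \<lhd> G" and ne: "Y \<noteq> carrier G"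
  shows "\<exists>x\<in>carrier G - Y. \<forall>g\<in>carrier G. g \<otimes> x \<otimes> inv g \<otimes> inv x \<in> Y"
proof -
  interpret Y: normal Y G by fact
  interpret M: group "G Mod Y" by (rule Y.factorgroup_is_group)
  have fin: "finite (carrier G)"
    using ord p by (metis order_gt_0_iff_finite prime_gt_0_nat zero_less_power)
  let ?E = "rcosets Y"
  let ?f = "\<lambda>g X. (Y #> g) <#> X <#> (Y #> inv g)"
  have f: "?f g (Y #> x) = Y #> (g \<otimes> x \<otimes> inv g)" if "g \<in> carrier G" "x \<in> carrier G" for g x
    using that by (simp add: Y.rcos_sum)
  interpret act: group_action G ?E "\<lambda>g. restrict (?f g) ?E"
  proof (rule group_actionI)
    fix g X assume "g \<in> carrier G" "X \<in> ?E"
    then show "?f g X \<in> ?E"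
      using f by (auto simp: RCOSETS_def)
  next
    fix X assume "X \<in> ?E"
    then obtain x where "x \<in> carrier G" "X = Y #> x" by (auto simp: RCOSETS_def)
    then show "?f \<one> X = X" using f[OF one_closed, of x] by simp
  next
    fix g h X assume "g \<in> carrier G" "h \<in> carrier G" "X \<in> ?E"
    then obtain x where x: "g \<in> carrier G" "h \<in> carrier G" "x \<in> carrier G" "X = Y #> x"
      by (auto simp: RCOSETS_def)
    then have "?f (g \<otimes> h) X = Y #> (g \<otimes> (h \<otimes> x \<otimes> inv h) \<otimes> inv g)"
      using f[of "g \<otimes> h" x] by (simp add: inv_mult_group m_assoc)
    then show "?f (g \<otimes> h) X = ?f g (?f h X)"
      using x f[of h x] f[of g "h \<otimes> x \<otimes> inv h"] by simp
  qed (rule is_group)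
  define F where "F = {X \<in> ?E. \<forall>g\<in>carrier G. restrict (?f g) ?E X = X}"
  have finE: "finite ?E" using fin by (simp add: RCOSETS_def)
  have d1: "p dvd card (?E - F)"
    unfolding F_def using act.p_group_dvd_card_moved[OF p ord finE] .
  have lag: "card ?E * card Y = p ^ n" using lagrange Y.subgroup_axioms ord by simp
  have "card ?E \<noteq> 1"
  proof
    assume "card ?E = 1"
    then have "card Y = card (carrier G)" using lag ord by (simp add: order_def)
    then show False using ne fin Y.subset card_subset_eq by blast
  qed
  moreover have "card ?E dvd p ^ n" using lag by (metis dvd_triv_left)
  ultimately have d2: "p dvd card ?E"
    using p by (metis divides_primepow_nat dvd_power_same gr0I power_0 dvd_power)
  have FE: "F \<subseteq> ?E" by (auto simp: F_def)
  have YF: "Y \<in> F"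
  proof -
    have YE: "Y \<in> ?E" using Y.subgroup_in_rcosets is_group by blast
    moreover have "?f g Y = Y" if g: "g \<in> carrier G" for g
      using f[of g \<one>] g Y.subset by simp
    ultimately show ?thesis by (simp add: F_def)
  qed
  have "card ?E = card (?E - F) + card F"
    using FE finE by (metis card_Diff_subset card_mono finite_subset le_add_diff_inverse2)
  then have "p dvd card F" using d1 d2 by (simp add: dvd_add_right_iff)
  have "F \<noteq> {Y}"
  proof
    assume "F = {Y}"
    then show False using \<open>p dvd card F\<close> p by (simp add: prime_nat_iff)
  qed
  then obtain X where X: "X \<in> F" "X \<noteq> Y" using YF by blast
  then obtain x where x: "x \<in> carrier G" "X = Y #> x" by (auto simp: F_def RCOSETS_def)
  have "x \<notin> Y" using X x Y.rcos_const is_group by blast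
  moreover have "g \<otimes> x \<otimes> inv g \<otimes> inv x \<in> Y" if g: "g \<in> carrier G" for g
  proof -
    have "X \<in> ?E" "restrict (?f g) ?E X = X" using X g by (auto simp: F_def)
    then have "?f g X = X" by simp
    then have "Y #> (g \<otimes> x \<otimes> inv g) = Y #> x" using f g x by simp
    then show ?thesis using r_coset_eq_iff[OF Y.subgroup_axioms] g x by simp
  qed
  ultimately show ?thesis using x by auto
qed

lemma subgroup_eq_carrier_if_contains_sylows:
  assumes fin: "finite (carrier G)" and S: "subgroup S G"
    and P: "\<And>p. Factorial_Ring.prime p \<Longrightarrow> \<exists>P\<subseteq>S. subgroup P G \<and> card P = p ^ multiplicity p (order G)"
  shows "S = carrier G"
proof -
  have o: "order G \<noteq> 0" using order_gt_0_iff_finite fin by simp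
  have cS: "card S \<noteq> 0"
    using S fin subgroup.one_closed subgroup.subset by (metis card_0_eq empty_iff finite_subset)
  have "order G dvd card S"
  proof (rule multiplicity_le_imp_dvd[OF o])
    fix p :: nat assume p: "Factorial_Ring.prime p"
    obtain P where "P \<subseteq> S" "subgroup P G" "card P = p ^ multiplicity p (order G)" using P[OF p] by blast
    then have "p ^ multiplicity p (order G) dvd card S" using card_subgroup_dvd[OF _ S _ fin] by metis
    then show "multiplicity p (order G) \<le> multiplicity p (card S)"
      using cS p by (intro multiplicity_geI) (auto simp: prime_nat_iff)
  qed
  then have "card (carrier G) \<le> card S" using cS by (simp add: order_def dvd_imp_le)
  then show ?thesis using fin S subgroup.subset by (metis card_seteq)
qed

text \<open>
  A normal subgroup \<open>Z\<close> is good if it is reached by the upper central series, in the sense that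
  a fixed number of steps takes the lower central series from inside \<open>Z\<close> to the trivial group.
  If a maximal good \<open>Z\<close> were proper, some Sylow subgroup \<open>P\<close> would not lie in \<open>Z\<close>, and \<open>P Z / Z\<close>
  would contain a nontrivial central element \<open>x\<close>. This \<open>x\<close> commutes with the other Sylow subgroups
  and so is central modulo \<open>Z\<close>; then the preimage of the centre of \<open>G/Z\<close> is a larger good
  subgroup. Staying inside \<open>G\<close> avoids an induction over quotients, whose types would change.
\<close>

lemma lower_central_trivial_if_sylows_normal:
  assumes fin: "finite (carrier G)"
    and syl: "\<And>p. Factorial_Ring.prime p \<Longrightarrow> \<exists>P. P \<lhd> G \<and> card P = p ^ multiplicity p (order G)"
  shows "\<exists>n. lower_central G n = {\<one>}"
proof -
  obtain P where P: "\<And>p. Factorial_Ring.prime p \<Longrightarrow> P p \<lhd> G"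
      "\<And>p. Factorial_Ring.prime p \<Longrightarrow> card (P p) = p ^ multiplicity p (order G)"
    using syl by metis
  note Psub = normal_imp_subgroup[OF P(1)]
  have Pc: "x \<in> carrier G" if "Factorial_Ring.prime p" "x \<in> P p" for x p
    using that Psub subgroup.subset by blast
  have commute: "x \<otimes> y \<otimes> inv x \<otimes> inv y = \<one>"
    if pq: "Factorial_Ring.prime p" "Factorial_Ring.prime q" "p \<noteq> q" and x: "x \<in> P p" and y: "y \<in> P q" for p q x y
  proof -
    have xy: "x \<in> carrier G" "y \<in> carrier G" using Pc pq x y by auto
    have I: "subgroup (P p \<inter> P q) G" using Psub pq subgroups_Inter_pair by blast
    have "card (P p \<inter> P q) dvd card (P p)" "card (P p \<inter> P q) dvd card (P q)"
      using I Psub pq fin by (auto intro!: card_subgroup_dvd)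
    moreover have "coprime (card (P p)) (card (P q))"
      using P(2) pq by (simp add: primes_coprime)
    ultimately have "card (P p \<inter> P q) = 1"
      by (metis coprime_common_divisor_nat One_nat_def)
    then obtain z where "P p \<inter> P q = {z}" by (rule card_1_singletonE)
    then have "P p \<inter> P q = {\<one>}" using subgroup.one_closed[OF I] by auto
    moreover have "x \<otimes> (y \<otimes> inv x \<otimes> inv y) \<in> P p"
      by (intro subgroup.m_closed[OF Psub[OF pq(1)]] normal.inv_op_closed2[OF P(1)[OF pq(1)]]
          subgroup.m_inv_closed[OF Psub[OF pq(1)]] x xy)
    moreover have "(x \<otimes> y \<otimes> inv x) \<otimes> inv y \<in> P q"
      by (intro subgroup.m_closed[OF Psub[OF pq(2)]] normal.inv_op_closed2[OF P(1)[OF pq(2)]]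
          subgroup.m_inv_closed[OF Psub[OF pq(2)]] y xy)
    ultimately show ?thesis using xy by (auto simp: m_assoc)
  qed
  define good where
    "good Z \<longleftrightarrow> Z \<lhd> G \<and> (\<exists>n. \<forall>k. lower_central G k \<subseteq> Z \<longrightarrow> lower_central G (k + n) = {\<one>})" for Z
  have good_one: "good {\<one>}"
    unfolding good_def using one_is_normal lower_central_subgroup subgroup.one_closed
    by (intro conjI exI[of _ 0]) auto
  have good_carrier: "Z \<subseteq> carrier G" if "good Z" for Z
    using that subgroup.subset[OF normal_imp_subgroup] unfolding good_def by blast
  have "finite {Z. good Z}"
    by (rule finite_subset[of _ "Pow (carrier G)"]) (use fin good_carrier in auto)
  then obtain Z where Z: "good Z" "\<And>Z'. good Z' \<Longrightarrow> Z \<subseteq> Z' \<Longrightarrow> Z' = Z"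
    using finite_has_maximal[of "{Z. good Z}"] good_one by blast
  interpret Z: normal Z G using Z(1) by (simp add: good_def)
  have "Z = carrier G"
  proof (rule ccontr)
    assume ne: "Z \<noteq> carrier G"
    have "\<exists>p. Factorial_Ring.prime p \<and> \<not> P p \<subseteq> Z"
    proof (rule ccontr)
      assume "\<not> ?thesis"
      then have "Z = carrier G"
        using P(2) Psub by (intro subgroup_eq_carrier_if_contains_sylows fin Z.subgroup_axioms) blast
      with ne show False by simp
    qed
    then obtain p where p: "Factorial_Ring.prime p" and PZ: "\<not> P p \<subseteq> Z" by auto
    interpret Pp: group "G\<lparr>carrier := P p\<rparr>" using Psub[OF p] by (rule subgroup_imp_group)
    have "P p \<inter> Z \<lhd> G\<lparr>carrier := P p\<rparr>"
      using normal_Int_subgroup[OF Psub[OF p] Z.normal_axioms] by (simp add: Int_commute)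
    moreover have "order (G\<lparr>carrier := P p\<rparr>) = p ^ multiplicity p (order G)"
      using P(2)[OF p] by (simp add: order_def)
    ultimately have "\<exists>x\<in>P p - P p \<inter> Z. \<forall>g\<in>P p. g \<otimes> x \<otimes> inv g \<otimes> inv x \<in> P p \<inter> Z"
      using Pp.p_group_central_mod_normal[OF p] PZ m_inv_consistent[OF Psub[OF p]] by fastforce
    then obtain x where x: "x \<in> P p" "x \<notin> Z"
      and xP: "\<And>g. g \<in> P p \<Longrightarrow> g \<otimes> x \<otimes> inv g \<otimes> inv x \<in> Z"
      by blast
    have xc: "x \<in> carrier G" using x p Pc by auto
    \<comment> \<open>the centralizer of \<open>x\<close> modulo \<open>Z\<close> contains every Sylow subgroup\<close>
    define C where "C = {g \<in> carrier G. g \<otimes> x \<otimes> inv g \<otimes> inv x \<in> Z}"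
    have "subgroup C G"
    proof (rule subgroupI)
      show "C \<subseteq> carrier G" by (auto simp: C_def)
      show "C \<noteq> {}" using xc by (auto simp: C_def intro!: exI[of _ \<one>])
      show "inv g \<in> C" if g: "g \<in> C" for g
      proof -
        have gc: "g \<in> carrier G" and "g \<otimes> x \<otimes> inv g \<otimes> inv x \<in> Z" using g by (auto simp: C_def)
        then have "inv g \<otimes> inv (g \<otimes> x \<otimes> inv g \<otimes> inv x) \<otimes> g \<in> Z"
          by (intro Z.inv_op_closed1 Z.m_inv_closed)
        also have "inv g \<otimes> inv (g \<otimes> x \<otimes> inv g \<otimes> inv x) \<otimes> g = inv g \<otimes> x \<otimes> inv (inv g) \<otimes> inv x"
          using gc xc by (simp add: m_assoc inv_mult_group)
        finally show ?thesis using gc by (simp add: C_def)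
      qed
      show "g \<otimes> h \<in> C" if g: "g \<in> C" and h: "h \<in> C" for g h
      proof -
        have gc: "g \<in> carrier G" "h \<in> carrier G" and "g \<otimes> x \<otimes> inv g \<otimes> inv x \<in> Z" "h \<otimes> x \<otimes> inv h \<otimes> inv x \<in> Z"
          using g h by (auto simp: C_def)
        then have "(g \<otimes> (h \<otimes> x \<otimes> inv h \<otimes> inv x) \<otimes> inv g) \<otimes> (g \<otimes> x \<otimes> inv g \<otimes> inv x) \<in> Z"
          by (simp add: Z.inv_op_closed2 Z.m_closed)
        also have "(g \<otimes> (h \<otimes> x \<otimes> inv h \<otimes> inv x) \<otimes> inv g) \<otimes> (g \<otimes> x \<otimes> inv g \<otimes> inv x)
            = (g \<otimes> h) \<otimes> x \<otimes> inv (g \<otimes> h) \<otimes> inv x"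
          using gc xc by (simp add: m_assoc inv_mult_group)
        finally show ?thesis using gc by (simp add: C_def)
      qed
    qed
    moreover have "P q \<subseteq> C" if q: "Factorial_Ring.prime q" for q
    proof
      fix g assume g: "g \<in> P q"
      show "g \<in> C"
        using xP commute[OF q p _ g x(1)] g Pc[OF q g] by (cases "q = p") (auto simp: C_def)
    qed
    ultimately have "C = carrier G"
      using P(2) Psub by (intro subgroup_eq_carrier_if_contains_sylows fin) blast+
    then have xcentral: "g \<otimes> x \<otimes> inv g \<otimes> inv x \<in> Z" if "g \<in> carrier G" for g
      using that by (auto simp: C_def)
    \<comment> \<open>the preimage of the centre of the quotient by \<open>Z\<close>\<close>
    define Z' where "Z' = {y \<in> carrier G. \<forall>g\<in>carrier G. y \<otimes> g \<otimes> inv y \<otimes> inv g \<in> Z}"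
    have Z'D: "y \<in> carrier G" "\<And>g. g \<in> carrier G \<Longrightarrow> y \<otimes> g \<otimes> inv y \<otimes> inv g \<in> Z" if "y \<in> Z'" for y
      using that by (auto simp: Z'_def)
    have sub: "subgroup Z' G"
    proof (rule subgroupI)
      show "Z' \<subseteq> carrier G" by (auto simp: Z'_def)
      show "Z' \<noteq> {}" by (auto simp: Z'_def m_assoc intro!: exI[of _ \<one>])
      show "inv y \<in> Z'" if y: "y \<in> Z'" for y
      proof -
        have "inv y \<otimes> g \<otimes> inv (inv y) \<otimes> inv g \<in> Z" if g: "g \<in> carrier G" for g
        proof -
          have "inv y \<otimes> inv (y \<otimes> g \<otimes> inv y \<otimes> inv g) \<otimes> y \<in> Z"
            using Z'D[OF y] g by (intro Z.inv_op_closed1 Z.m_inv_closed)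
          also have "inv y \<otimes> inv (y \<otimes> g \<otimes> inv y \<otimes> inv g) \<otimes> y = inv y \<otimes> g \<otimes> inv (inv y) \<otimes> inv g"
            using Z'D(1)[OF y] g by (simp add: m_assoc inv_mult_group)
          finally show ?thesis .
        qed
        then show ?thesis using Z'D(1)[OF y] by (simp add: Z'_def)
      qed
      show "x \<otimes> y \<in> Z'" if x: "x \<in> Z'" and y: "y \<in> Z'" for x y
      proof -
        have "(x \<otimes> y) \<otimes> g \<otimes> inv (x \<otimes> y) \<otimes> inv g \<in> Z" if g: "g \<in> carrier G" for g
        proof -
          have "(x \<otimes> (y \<otimes> g \<otimes> inv y \<otimes> inv g) \<otimes> inv x) \<otimes> (x \<otimes> g \<otimes> inv x \<otimes> inv g) \<in> Z"
            using Z'D[OF y] Z'D[OF x] g by (simp add: Z.inv_op_closed2 Z.m_closed)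
          also have "(x \<otimes> (y \<otimes> g \<otimes> inv y \<otimes> inv g) \<otimes> inv x) \<otimes> (x \<otimes> g \<otimes> inv x \<otimes> inv g)
              = (x \<otimes> y) \<otimes> g \<otimes> inv (x \<otimes> y) \<otimes> inv g"
            using Z'D(1)[OF y] Z'D(1)[OF x] g by (simp add: m_assoc inv_mult_group)
          finally show ?thesis .
        qed
        then show ?thesis using Z'D(1)[OF x] Z'D(1)[OF y] by (simp add: Z'_def)
      qed
    qed
    have "Z' \<lhd> G"
    proof (rule normal_invI[OF sub])
      fix h y assume h: "h \<in> carrier G" and y: "y \<in> Z'"
      have "(h \<otimes> y \<otimes> inv h) \<otimes> g \<otimes> inv (h \<otimes> y \<otimes> inv h) \<otimes> inv g \<in> Z" if g: "g \<in> carrier G" for g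
      proof -
        have "h \<otimes> (y \<otimes> (inv h \<otimes> g \<otimes> h) \<otimes> inv y \<otimes> inv (inv h \<otimes> g \<otimes> h)) \<otimes> inv h \<in> Z"
          using Z'D[OF y] g h by (intro Z.inv_op_closed2) auto
        also have "h \<otimes> (y \<otimes> (inv h \<otimes> g \<otimes> h) \<otimes> inv y \<otimes> inv (inv h \<otimes> g \<otimes> h)) \<otimes> inv h
            = (h \<otimes> y \<otimes> inv h) \<otimes> g \<otimes> inv (h \<otimes> y \<otimes> inv h) \<otimes> inv g"
          using Z'D(1)[OF y] h g by (simp add: m_assoc inv_mult_group)
        finally show ?thesis .
      qed
      then show "h \<otimes> y \<otimes> inv h \<in> Z'" using h Z'D(1)[OF y] by (simp add: Z'_def)
    qed
    moreover have "\<exists>n. \<forall>k. lower_central G k \<subseteq> Z' \<longrightarrow> lower_central G (k + n) = {\<one>}"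
    proof -
      obtain n where n: "\<And>k. lower_central G k \<subseteq> Z \<Longrightarrow> lower_central G (k + n) = {\<one>}"
        using Z(1) by (auto simp: good_def)
      have "lower_central G (k + Suc n) = {\<one>}" if k: "lower_central G k \<subseteq> Z'" for k
      proof -
        have "lower_central G (Suc k) \<subseteq> Z"
          using k by (intro lower_central_Suc_subset Z.subgroup_axioms) (auto dest: Z'D)
        from n[OF this] show ?thesis by simp
      qed
      then show ?thesis by blast
    qed
    ultimately have "good Z'" by (simp add: good_def)
    moreover have "Z \<subseteq> Z'"
    proof
      fix y assume y: "y \<in> Z"
      have yc: "y \<in> carrier G" using y Z.subset by auto
      have "y \<otimes> (g \<otimes> inv y \<otimes> inv g) \<in> Z" if "g \<in> carrier G" for g
        using that y by (intro Z.m_closed Z.inv_op_closed2 Z.m_inv_closed)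
      then show "y \<in> Z'" using yc by (simp add: Z'_def m_assoc)
    qed
    moreover have "x \<in> Z'"
    proof -
      have "x \<otimes> g \<otimes> inv x \<otimes> inv g \<in> Z" if g: "g \<in> carrier G" for g
      proof -
        have "inv (g \<otimes> x \<otimes> inv g \<otimes> inv x) \<in> Z" using xcentral[OF g] by (rule Z.m_inv_closed)
        then show ?thesis using g xc by (simp add: m_assoc inv_mult_group)
      qed
      then show ?thesis using xc by (simp add: Z'_def)
    qed
    ultimately show False using Z(2) x(2) by blast
  qed
  then obtain n where "\<And>k. lower_central G k \<subseteq> carrier G \<Longrightarrow> lower_central G (k + n) = {\<one>}"
    using Z(1) by (auto simp: good_def)
  from this[of 0] show ?thesis by auto
qed

section \<open>Finite groups: normal subgroups without proper supplements\<close>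

text \<open>
  The Frattini argument: for a Sylow subgroup \<open>P\<close> of \<open>N\<close> and any \<open>h\<close>, the conjugate of \<open>P\<close> by \<open>h\<close>
  is again a Sylow subgroup of \<open>N\<close>, hence conjugate to \<open>P\<close> by an element of \<open>N\<close>. So the normalizer
  of \<open>P\<close> supplements \<open>N\<close> and therefore is everything.
\<close>

lemma sylow_normal_of_nonsupplemented:
  assumes fin: "finite (carrier G)" and N: "N \<lhd> G"
    and supp: "\<And>K. subgroup K G \<Longrightarrow> K <#> N = carrier G \<Longrightarrow> K = carrier G"
    and p: "Factorial_Ring.prime p"
  shows "\<exists>P. P \<lhd> G \<and> P \<subseteq> N \<and> card P = p ^ multiplicity p (card N)"
proof -
  interpret N: normal N G by fact
  interpret NG: group "G\<lparr>carrier := N\<rparr>" using N.subgroup_axioms by (rule subgroup_imp_group)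
  have finN: "finite N" using fin N.subset finite_subset by blast
  have "card N \<noteq> 0" using finN N.one_closed by (metis card_0_eq empty_iff)
  then obtain m where m: "card N = p ^ multiplicity p (card N) * m" "\<not> p dvd m"
    using p by (metis multiplicity_decompose' not_prime_unit)
  obtain P where P: "subgroup P (G\<lparr>carrier := N\<rparr>)" "card P = p ^ multiplicity p (card N)"
    using sylow_thm[OF p NG.is_group, of "multiplicity p (card N)" m] m finN by (auto simp: order_def)
  have PG: "subgroup P G" and PN: "P \<subseteq> N"
    using P subgroup_restrict_iff[OF N.subgroup_axioms] by auto
  have Pc: "P \<subseteq> carrier G" using PG by (rule subgroup.subset)
  have finP: "finite P" using Pc fin finite_subset by blast
  have "card (rcosets\<^bsub>G\<lparr>carrier := N\<rparr>\<^esub> P) * card P = card N"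
    using NG.lagrange[OF P(1)] by (simp add: order_def)
  then have idx: "\<not> p dvd card (rcosets\<^bsub>G\<lparr>carrier := N\<rparr>\<^esub> P)"
    using m P(2) \<open>card N \<noteq> 0\<close> by (metis mult.commute mult_cancel_right mult_eq_0_iff)
  \<comment> \<open>\<open>K\<close> is the normalizer of \<open>P\<close>; one inclusion suffices in its definition because \<open>P\<close> is finite\<close>
  define K where "K = {g \<in> carrier G. \<forall>y\<in>P. g \<otimes> y \<otimes> inv g \<in> P}"
  have K: "subgroup K G"
  proof (rule subgroupI)
    show "K \<subseteq> carrier G" by (auto simp: K_def)
    show "K \<noteq> {}" using Pc by (auto simp: K_def intro!: exI[of _ \<one>])
    show "inv g \<in> K" if g: "g \<in> K" for g
    proof -
      have gc: "g \<in> carrier G" using g by (simp add: K_def)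
      have "inj_on (\<lambda>y. g \<otimes> y \<otimes> inv g) P"
        using gc Pc by (auto intro!: inj_onI simp: subset_iff)
      moreover have "(\<lambda>y. g \<otimes> y \<otimes> inv g) ` P \<subseteq> P" using g by (auto simp: K_def)
      ultimately have surj: "(\<lambda>y. g \<otimes> y \<otimes> inv g) ` P = P" using finP by (simp add: endo_inj_surj)
      have "inv g \<otimes> y \<otimes> inv (inv g) \<in> P" if y: "y \<in> P" for y
      proof -
        obtain z where z: "z \<in> P" "y = g \<otimes> z \<otimes> inv g" using surj y by blast
        have "z \<in> carrier G" using z Pc by auto
        then have "inv g \<otimes> y \<otimes> inv (inv g) = z" using z(2) gc by (simp add: m_assoc)
        then show ?thesis using z by simp
      qed
      then show ?thesis using gc by (simp add: K_def)
    qed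
    show "g \<otimes> h \<in> K" if g: "g \<in> K" and h: "h \<in> K" for g h
    proof -
      have c: "g \<in> carrier G" "h \<in> carrier G" using g h by (auto simp: K_def)
      have "g \<otimes> h \<otimes> y \<otimes> inv (g \<otimes> h) \<in> P" if y: "y \<in> P" for y
      proof -
        have "g \<otimes> (h \<otimes> y \<otimes> inv h) \<otimes> inv g \<in> P" using g h y by (simp add: K_def)
        moreover have "y \<in> carrier G" using y Pc by auto
        ultimately show ?thesis using c by (simp add: m_assoc inv_mult_group)
      qed
      then show ?thesis using c by (simp add: K_def)
    qed
  qed
  have "carrier G \<subseteq> K <#> N"
  proof
    fix h assume h: "h \<in> carrier G"
    define Q where "Q = (\<lambda>y. h \<otimes> y \<otimes> inv h) ` P"
    have QG: "subgroup Q G"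
      unfolding Q_def using group_hom.subgroup_img_is_subgroup[OF conjugation_group_hom[OF h] PG] .
    have QN: "Q \<subseteq> N" unfolding Q_def using N.inv_op_closed2 h PN by auto
    have Q: "subgroup Q (G\<lparr>carrier := N\<rparr>)"
      using QG QN subgroup_restrict_iff[OF N.subgroup_axioms] by simp
    have "inj_on (\<lambda>y. h \<otimes> y \<otimes> inv h) P"
      using h Pc by (auto intro!: inj_onI simp: subset_iff)
    then have "card Q = p ^ multiplicity p (card N)" using P(2) by (simp add: Q_def card_image)
    then have "\<exists>x\<in>N. \<forall>q\<in>Q. x \<otimes> q \<otimes> inv x \<in> P"
      using NG.p_subgroup_conj_into_subgroup[OF _ p P(1) idx Q] finN m_inv_consistent[OF N.subgroup_axioms]
      by auto
    then obtain x where x: "x \<in> N" "\<And>q. q \<in> Q \<Longrightarrow> x \<otimes> q \<otimes> inv x \<in> P"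
      by blast
    have xc: "x \<in> carrier G" using x N.subset by auto
    have "x \<otimes> h \<otimes> y \<otimes> inv (x \<otimes> h) \<in> P" if y: "y \<in> P" for y
    proof -
      have "x \<otimes> (h \<otimes> y \<otimes> inv h) \<otimes> inv x \<in> P" using x(2) y by (auto simp: Q_def)
      moreover have "y \<in> carrier G" using y Pc by auto
      ultimately show ?thesis using h xc by (simp add: m_assoc inv_mult_group)
    qed
    then have "x \<otimes> h \<in> K" using h xc by (simp add: K_def)
    moreover have "inv x \<in> N" "h = inv x \<otimes> (x \<otimes> h)" using x xc h by auto
    ultimately have "h \<in> N <#> K" by (auto simp only: mem_set_mult)
    then show "h \<in> K <#> N" using commut_normal[OF K N] by simp
  qed
  moreover have "K <#> N \<subseteq> carrier G" using set_mult_closed[OF subgroup.subset[OF K] N.subset] by blast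
  ultimately have "K = carrier G" using supp[OF K] by blast
  then have "P \<lhd> G" by (intro normal_invI PG) (auto simp: K_def)
  then show ?thesis using PN P(2) by blast
qed

lemma lower_central_trivial_of_nonsupplemented:
  assumes fin: "finite (carrier G)" and N: "N \<lhd> G"
    and supp: "\<And>K. subgroup K G \<Longrightarrow> K <#> N = carrier G \<Longrightarrow> K = carrier G"
  shows "\<exists>n. lower_central (G\<lparr>carrier := N\<rparr>) n = {\<one>}"
proof -
  interpret N: normal N G by fact
  interpret NG: group "G\<lparr>carrier := N\<rparr>" using N.subgroup_axioms by (rule subgroup_imp_group)
  have "\<exists>n. lower_central (G\<lparr>carrier := N\<rparr>) n = {\<one>\<^bsub>G\<lparr>carrier := N\<rparr>\<^esub>}"
  proof (rule NG.lower_central_trivial_if_sylows_normal)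
    show "finite (carrier (G\<lparr>carrier := N\<rparr>))" using fin N.subset finite_subset by auto
    fix p :: nat assume p: "Factorial_Ring.prime p"
    obtain P where "P \<lhd> G" "P \<subseteq> N" "card P = p ^ multiplicity p (card N)"
      using sylow_normal_of_nonsupplemented[OF fin N supp p] by blast
    then show "\<exists>P. P \<lhd> G\<lparr>carrier := N\<rparr> \<and> card P = p ^ multiplicity p (order (G\<lparr>carrier := N\<rparr>))"
      using normal_restrict_supergroup[OF N.subgroup_axioms] by (auto simp: order_def)
  qed
  then show ?thesis by simp
qed

lemma finprod_conj:
  assumes A: "A \<lhd> G" "comm_group (G\<lparr>carrier := A\<rparr>)" and g: "g \<in> carrier G"
    and f: "f \<in> S \<rightarrow> A"
  shows "finprod (G\<lparr>carrier := A\<rparr>) (\<lambda>d. g \<otimes> f d \<otimes> inv g) S = g \<otimes> finprod (G\<lparr>carrier := A\<rparr>) f S \<otimes> inv g"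
proof -
  interpret A: normal A G by fact
  interpret C: comm_group "G\<lparr>carrier := A\<rparr>" by fact
  show ?thesis using f
  proof (induction S rule: infinite_finite_induct)
    case (infinite S)
    then show ?case using g C.finprod_infinite[of S] by (simp add: r_inv)
  next
    case empty
    then show ?case using g by simp
  next
    case (insert x F)
    have fx: "f x \<in> A" "f \<in> F \<rightarrow> A" using insert.prems by auto
    have P: "finprod (G\<lparr>carrier := A\<rparr>) f F \<in> A" using C.finprod_closed[of f F] fx by simp
    have cF: "(\<lambda>d. g \<otimes> f d \<otimes> inv g) \<in> F \<rightarrow> A" using fx g A.inv_op_closed2 by auto
    have "finprod (G\<lparr>carrier := A\<rparr>) (\<lambda>d. g \<otimes> f d \<otimes> inv g) (insert x F)
      = (g \<otimes> f x \<otimes> inv g) \<otimes> finprod (G\<lparr>carrier := A\<rparr>) (\<lambda>d. g \<otimes> f d \<otimes> inv g) F"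
      using insert.hyps cF fx g A.inv_op_closed2 by (subst C.finprod_insert) auto
    also have "\<dots> = (g \<otimes> f x \<otimes> inv g) \<otimes> (g \<otimes> finprod (G\<lparr>carrier := A\<rparr>) f F \<otimes> inv g)"
      using insert.IH fx by simp
    also have "\<dots> = g \<otimes> (f x \<otimes> finprod (G\<lparr>carrier := A\<rparr>) f F) \<otimes> inv g"
      using g fx P A.subset by (simp add: m_assoc subset_iff)
    also have "f x \<otimes> finprod (G\<lparr>carrier := A\<rparr>) f F = finprod (G\<lparr>carrier := A\<rparr>) f (insert x F)"
      using insert.hyps fx by (subst C.finprod_insert) auto
    finally show ?case .
  qed
qed

text \<open>
  The Schur--Zassenhaus theorem for an abelian normal subgroup \<open>A\<close>. Let \<open>t\<close> be a transversal of
  \<open>A\<close> and let \<open>D g\<close> be the product in \<open>A\<close>, over all cosets \<open>d\<close>, of \<open>g t(d) t(g d)\<^sup>-\<^sup>1\<close>. Then \<open>D\<close> is a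
  crossed homomorphism, \<open>D (g h) = g (D h) g\<^sup>-\<^sup>1 (D g)\<close>, and \<open>D a = a\<^sup>m\<close> for \<open>a \<in> A\<close>, where \<open>m = |G : A|\<close>.
  As \<open>m\<close> is prime to \<open>|A|\<close>, the power map is bijective on \<open>A\<close>, so the kernel of \<open>D\<close> meets \<open>A\<close>
  trivially and meets every coset of \<open>A\<close>.
\<close>

lemma abelian_normal_complement:
  assumes fin: "finite (carrier G)" and A: "A \<lhd> G" and comm: "comm_group (G\<lparr>carrier := A\<rparr>)"
    and cop: "coprime (card A) (card (rcosets A))"
  shows "\<exists>K. subgroup K G \<and> K <#> A = carrier G \<and> K \<inter> A = {\<one>}"
proof -
  interpret A: normal A G by fact
  interpret C: comm_group "G\<lparr>carrier := A\<rparr>" by fact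
  interpret F: group "G Mod A" by (rule A.factorgroup_is_group)
  interpret \<pi>: group_hom G "G Mod A" "\<lambda>x. A #> x"
    using A.r_coset_hom_Mod by (auto simp: group_hom_def group_hom_axioms_def is_group F.is_group)
  define F where "F = carrier (G Mod A)"
  define m where "m = card F"
  have Ac: "\<And>a. a \<in> A \<Longrightarrow> a \<in> carrier G" using A.subset by auto
  define t where "t c = (SOME x. x \<in> c)" for c :: "'a set"
  have t: "t c \<in> carrier G" "A #> t c = c" if "c \<in> F" for c
    unfolding t_def using some_rcoset_representative[OF A.subgroup_axioms] that
    by (auto simp: F_def FactGroup_def)
  define act where "act g d = (A #> g) <#> d" for g d
  have act: "act g d \<in> F" if "g \<in> carrier G" "d \<in> F" for g d
    using that F.m_closed[of "A #> g" d] by (auto simp: act_def F_def carrier_FactGroup)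
  have act_mult: "act (g \<otimes> h) d = act g (act h d)" if "g \<in> carrier G" "h \<in> carrier G" "d \<in> F" for g h d
  proof -
    have c: "A #> g \<in> carrier (G Mod A)" "A #> h \<in> carrier (G Mod A)" "d \<in> carrier (G Mod A)"
      using that by (auto simp: F_def carrier_FactGroup)
    show ?thesis
      using F.m_assoc[OF c] unfolding act_def mult_FactGroup A.rcos_sum[OF that(1,2)] .
  qed
  have act_inj: "inj_on (act h) F" if "h \<in> carrier G" for h
    using F.inj_on_cmult[OF \<pi>.hom_closed[OF that]] by (simp add: act_def[abs_def] F_def)
  have act_img: "act h ` F = F" if "h \<in> carrier G" for h
    using that act act_inj fin by (intro endo_inj_surj) (auto simp: F_def carrier_FactGroup)
  define u where "u g d = g \<otimes> t d \<otimes> inv (t (act g d))" for g d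
  have u: "u g d \<in> A" if g: "g \<in> carrier G" and d: "d \<in> F" for g d
  proof -
    have "A #> (g \<otimes> t d) = (A #> g) <#> d" using t[OF d] g A.rcos_sum[of g "t d"] by simp
    also have "\<dots> = A #> t (act g d)" using t(2)[OF act[OF g d]] by (simp add: act_def)
    finally show ?thesis
      unfolding u_def using r_coset_eq_iff[OF A.subgroup_axioms, of "g \<otimes> t d" "t (act g d)"]
        t[OF d] t[OF act[OF g d]] g by simp
  qed
  define D where "D g = finprod (G\<lparr>carrier := A\<rparr>) (u g) F" for g
  have D: "D g \<in> A" if "g \<in> carrier G" for g
    unfolding D_def using C.finprod_closed[of "u g" F] u that by auto
  have D_mult: "D (g \<otimes> h) = (g \<otimes> D h \<otimes> inv g) \<otimes> D g" if g: "g \<in> carrier G" and h: "h \<in> carrier G" for g h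
  proof -
    have "u (g \<otimes> h) d = (g \<otimes> u h d \<otimes> inv g) \<otimes> u g (act h d)" if d: "d \<in> F" for d
      unfolding u_def using g h d t(1)[OF d] t(1)[OF act[OF h d]] t(1)[OF act[OF g act[OF h d]]]
      by (simp add: act_mult m_assoc inv_mult_group)
    then have "D (g \<otimes> h) = finprod (G\<lparr>carrier := A\<rparr>) (\<lambda>d. (g \<otimes> u h d \<otimes> inv g) \<otimes>\<^bsub>G\<lparr>carrier := A\<rparr>\<^esub> u g (act h d)) F"
      unfolding D_def using u g h act A.inv_op_closed2 by (intro C.finprod_cong') auto
    also have "\<dots> = finprod (G\<lparr>carrier := A\<rparr>) (\<lambda>d. g \<otimes> u h d \<otimes> inv g) F
         \<otimes>\<^bsub>G\<lparr>carrier := A\<rparr>\<^esub> finprod (G\<lparr>carrier := A\<rparr>) (\<lambda>d. u g (act h d)) F"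
      using u g h act A.inv_op_closed2 by (intro C.finprod_multf) auto
    also have "finprod (G\<lparr>carrier := A\<rparr>) (\<lambda>d. g \<otimes> u h d \<otimes> inv g) F = g \<otimes> D h \<otimes> inv g"
      unfolding D_def using u h by (intro finprod_conj A comm g) auto
    also have "finprod (G\<lparr>carrier := A\<rparr>) (\<lambda>d. u g (act h d)) F = finprod (G\<lparr>carrier := A\<rparr>) (u g) (act h ` F)"
      using u g act_img[OF h] act_inj[OF h] by (intro C.finprod_reindex[symmetric]) auto
    also have "\<dots> = D g" using act_img[OF h] by (simp add: D_def)
    finally show ?thesis by simp
  qed
  have D_A: "D a = a [^] m" if a: "a \<in> A" for a
  proof -
    have "u a d = a" if d: "d \<in> F" for d
    proof -
      have "act a d = d"
        using a Ac d F.l_one[of d] A.rcos_const[OF is_group a] by (simp add: act_def F_def)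
      then show ?thesis using t[OF d] a Ac by (simp add: u_def m_assoc)
    qed
    then have "D a = finprod (G\<lparr>carrier := A\<rparr>) (\<lambda>d. a) F"
      unfolding D_def using a by (intro C.finprod_cong') auto
    then show ?thesis
      using C.finprod_const[of a F] a nat_pow_consistent by (simp add: m_def)
  qed
  have m_eq: "m = card (rcosets A)" by (simp add: m_def F_def FactGroup_def)
  have powA: "a [^] card A = \<one>" if "a \<in> A" for a
    using C.pow_order_eq_1[of a] that nat_pow_consistent by (simp add: order_def)
  have pow_mod: "c [^] n = c [^] (n mod card A)" if c: "c \<in> A" for c and n :: nat
  proof -
    have "c [^] n = c [^] (card A * (n div card A) + n mod card A)" by simp
    also have "\<dots> = (c [^] card A) [^] (n div card A) \<otimes> c [^] (n mod card A)"
      using c Ac by (simp only: nat_pow_mult nat_pow_pow nat_pow_closed)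
    finally show ?thesis using powA[OF c] c Ac by simp
  qed
  define K where "K = {h \<in> carrier G. D h = \<one>}"
  have D_one: "D \<one> = \<one>" using D_A[OF A.one_closed] by simp
  have K: "subgroup K G"
  proof (rule subgroupI)
    show "K \<subseteq> carrier G" by (auto simp: K_def)
    show "K \<noteq> {}" using D_one by (auto simp: K_def)
    show "inv h \<in> K" if "h \<in> K" for h
    proof -
      have h: "h \<in> carrier G" "D h = \<one>" using that by (auto simp: K_def)
      have "D (inv h \<otimes> h) = D (inv h)" using D_mult[of "inv h" h] h D[of "inv h"] Ac by simp
      then show ?thesis using h D_one by (simp add: K_def)
    qed
    show "g \<otimes> h \<in> K" if "g \<in> K" "h \<in> K" for g h
      using that D_mult[of g h] by (simp add: K_def)
  qed
  have "carrier G \<subseteq> K <#> A"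
  proof
    fix h assume h: "h \<in> carrier G"
    obtain v where v: "[m * v = 1] (mod card A)"
      using cop m_eq cong_solve_coprime_nat[of m "card A"] by (auto simp: coprime_commute)
    \<comment> \<open>the element \<open>b\<close> of \<open>A\<close> for which \<open>h b\<close> is in the kernel must satisfy \<open>h b\<^sup>m h\<^sup>-\<^sup>1 = (D h)\<^sup>-\<^sup>1\<close>\<close>
    define c where "c = inv h \<otimes> inv (D h) \<otimes> h"
    have c: "c \<in> A" unfolding c_def using D[OF h] h by (intro A.inv_op_closed1) auto
    define b where "b = c [^] v"
    have b: "b \<in> A" unfolding b_def using c subgroup_int_pow_closed[OF A.subgroup_axioms c, of "int v"] by (simp add: int_pow_int)
    have "b [^] m = c [^] (m * v)" using c Ac by (simp add: b_def nat_pow_pow mult.commute)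
    also have "\<dots> = c [^] (m * v mod card A)" using pow_mod[OF c] .
    also have "\<dots> = c [^] (1 mod card A)" using v by (simp add: cong_def)
    also have "\<dots> = c" using pow_mod[OF c, of 1] c Ac by simp
    finally have bm: "b [^] m = c" .
    have "D (h \<otimes> b) = (h \<otimes> c \<otimes> inv h) \<otimes> D h"
      using D_mult[OF h Ac[OF b]] D_A[OF b] bm by simp
    also have "\<dots> = \<one>" using h D[OF h] Ac by (simp add: c_def m_assoc)
    finally have "h \<otimes> b \<in> K" using h b Ac by (simp add: K_def)
    moreover have "h = (h \<otimes> b) \<otimes> inv b" using h b Ac by (simp add: m_assoc)
    ultimately show "h \<in> K <#> A" using b by (auto simp only: mem_set_mult A.m_inv_closed)
  qed
  then have "K <#> A = carrier G" using set_mult_closed[OF subgroup.subset[OF K] A.subset] by blast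
  moreover have "K \<inter> A = {\<one>}"
  proof -
    have "a = \<one>" if a: "a \<in> A" "a \<in> K" for a
    proof -
      have "a [^] m = \<one>" using a D_A by (simp add: K_def)
      then have "ord a dvd m" using a Ac pow_eq_id by blast
      moreover have "ord a dvd card A" using powA[OF a(1)] a Ac pow_eq_id by blast
      ultimately have "ord a = 1" using cop m_eq by (metis coprime_common_divisor_nat One_nat_def)
      then show ?thesis using a Ac ord_eq_1 by simp
    qed
    then show ?thesis using A.one_closed subgroup.one_closed[OF K] by blast
  qed
  ultimately show ?thesis using K by blast
qed

text \<open>
  A supplement of \<open>N/Q\<close> in \<open>G/Q\<close> pulls back to a supplement of \<open>N\<close> containing \<open>Q\<close>. Only supplements
  containing \<open>Q\<close> enter the hypothesis because, for open \<open>Q\<close> in a profinite group, all of these are open.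
\<close>

lemma nonsupplemented_quotient:
  assumes Q: "Q \<lhd> G" and N: "subgroup N G" and QN: "Q \<subseteq> N"
    and supp: "\<And>K. subgroup K G \<Longrightarrow> Q \<subseteq> K \<Longrightarrow> K <#> N = carrier G \<Longrightarrow> K = carrier G"
    and K: "subgroup K (G Mod Q)"
    and KN: "K <#>\<^bsub>G Mod Q\<^esub> (rcosets\<^bsub>G\<lparr>carrier := N\<rparr>\<^esub> Q) = carrier (G Mod Q)"
  shows "K = carrier (G Mod Q)"
proof -
  interpret Q: normal Q G by fact
  define U where "U = {x \<in> carrier G. Q #> x \<in> K}"
  have U: "subgroup U G" unfolding U_def
    using Q.factgroup_subgroup_union_char[OF K] Q.factgroup_subgroup_union_subgroup[OF K] by simp
  have QU: "Q \<subseteq> U"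
  proof
    fix q assume "q \<in> Q"
    then show "q \<in> U" unfolding U_def
      using Q.subset Q.rcos_const[OF is_group] subgroup.one_closed[OF K] by auto
  qed
  have Nc: "N \<subseteq> carrier G" using N by (rule subgroup.subset)
  have "carrier G \<subseteq> U <#> N"
  proof
    fix x assume x: "x \<in> carrier G"
    then have "Q #> x \<in> K <#>\<^bsub>G Mod Q\<^esub> (rcosets\<^bsub>G\<lparr>carrier := N\<rparr>\<^esub> Q)"
      using KN by (auto simp: carrier_FactGroup)
    then obtain k n where kn: "k \<in> K" "n \<in> N" "Q #> x = k <#> (Q #> n)"
      by (auto simp: mem_set_mult rcosets_restrict)
    then obtain y where y: "y \<in> carrier G" "k = Q #> y"
      using subgroup.subset[OF K] by (auto simp: carrier_FactGroup)
    have nc: "n \<in> carrier G" using kn Nc by auto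
    have "Q #> x = Q #> (y \<otimes> n)" using kn y nc Q.rcos_sum[of y n] by simp
    then have "Q #> x #> inv n = Q #> (y \<otimes> n) #> inv n" by simp
    then have "Q #> (x \<otimes> inv n) = Q #> y"
      using x y nc Q.subset by (simp add: coset_mult_assoc m_assoc)
    then have "x \<otimes> inv n \<in> U" using kn y x nc by (simp add: U_def)
    moreover have "x = (x \<otimes> inv n) \<otimes> n" using x nc by (simp add: m_assoc)
    ultimately show "x \<in> U <#> N" using kn by (auto simp only: mem_set_mult)
  qed
  then have "U <#> N = carrier G" using set_mult_closed[OF subgroup.subset[OF U] Nc] by blast
  then have "U = carrier G" using supp U QU by blast
  then have "carrier (G Mod Q) \<subseteq> K" by (auto simp: U_def carrier_FactGroup)
  then show ?thesis using subgroup.subset[OF K] by blast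
qed

lemma card_rcosets_restrict:
  assumes "subgroup Q G" "subgroup P G" "Q \<subseteq> P"
  shows "card (rcosets\<^bsub>G\<lparr>carrier := P\<rparr>\<^esub> Q) * card Q = card P"
  using group.lagrange[OF subgroup_imp_group[OF assms(2)] subgroup_incl[OF assms]]
  by (simp add: order_def)

text \<open>
  If \<open>P\<close> were perfect, its lower central series would be constant.
\<close>

lemma derived_neq_of_lower_central:
  assumes P: "subgroup P G" and n: "lower_central (G\<lparr>carrier := P\<rparr>) n = {\<one>}" and ne: "P \<noteq> {\<one>}"
  shows "derived G P \<noteq> P"
proof
  assume d: "derived G P = P"
  have "lower_central (G\<lparr>carrier := P\<rparr>) k = P" for k
  proof (induction k)
    case (Suc k)
    have "lower_central (G\<lparr>carrier := P\<rparr>) (Suc k) = derived (G\<lparr>carrier := P\<rparr>) P"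
      using Suc by (simp add: derived_def)
    then show ?case using derived_consistent[OF _ P, of P] d by simp
  qed simp
  then show False using n ne by blast
qed

text \<open>
  Otherwise a Sylow \<open>p\<close>-subgroup \<open>P\<close> of \<open>N\<close> is normal in \<open>G\<close> with index prime to \<open>p\<close>. It is nilpotent,
  so its derived subgroup \<open>Q\<close> is proper, and \<open>P/Q\<close> is abelian and has a complement in \<open>G/Q\<close>. That
  complement supplements \<open>N/Q\<close>, so it is all of \<open>G/Q\<close>, contradicting \<open>P \<noteq> Q\<close>.
\<close>

lemma prime_dvd_index_of_nonsupplemented:
  assumes fin: "finite (carrier G)" and N: "N \<lhd> G"
    and supp: "\<And>K. subgroup K G \<Longrightarrow> K <#> N = carrier G \<Longrightarrow> K = carrier G"
    and p: "Factorial_Ring.prime p" and pN: "p dvd card N"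
  shows "p dvd card (rcosets N)"
proof (rule ccontr)
  assume ndvd: "\<not> p dvd card (rcosets N)"
  interpret N: normal N G by fact
  have finN: "finite N" using fin N.subset finite_subset by blast
  have N0: "card N \<noteq> 0" using finN N.one_closed by (metis card_0_eq empty_iff)
  define a where "a = multiplicity p (card N)"
  obtain m where m: "card N = p ^ a * m" "\<not> p dvd m"
    unfolding a_def using p N0 by (metis multiplicity_decompose' not_prime_unit)
  have "a > 0" unfolding a_def using pN N0 p by (simp add: prime_multiplicity_gt_zero_iff)
  obtain P where P: "P \<lhd> G" "P \<subseteq> N" "card P = p ^ a"
    using sylow_normal_of_nonsupplemented[OF fin N supp p] a_def by blast
  note Ps = normal_imp_subgroup[OF P(1)]
  interpret PG: group "G\<lparr>carrier := P\<rparr>" using Ps by (rule subgroup_imp_group)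
  have cP: "card P \<noteq> 1" using P(3) \<open>a > 0\<close> p by (simp add: prime_nat_iff)
  obtain n where n: "lower_central (G\<lparr>carrier := N\<rparr>) n = {\<one>}"
    using lower_central_trivial_of_nonsupplemented[OF fin N supp] by blast
  have "lower_central (G\<lparr>carrier := P\<rparr>) n = {\<one>}"
    using lower_central_restrict_mono[OF Ps N.subgroup_axioms P(2), of n] n
      subgroup.one_closed[OF PG.lower_central_subgroup[of n]] by auto
  then have neP: "derived G P \<noteq> P"
    using derived_neq_of_lower_central[OF Ps] cP by (metis card.empty card_insert_disjoint empty_iff finite.emptyI One_nat_def)
  define Q where "Q = derived G P"
  have QP: "Q \<subseteq> P" unfolding Q_def using derived_incl[OF subset_refl Ps] .
  have Qn: "Q \<lhd> G" unfolding Q_def using P(1) by (rule derived_is_normal)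
  interpret Q: normal Q G by (rule Qn)
  interpret F: group "G Mod Q" by (rule Q.factorgroup_is_group)
  define A where "A = rcosets\<^bsub>G\<lparr>carrier := P\<rparr>\<^esub> Q"
  have A: "A \<lhd> G Mod Q" unfolding A_def using normality_factorization[OF Qn QP P(1)] .
  have "derived (G\<lparr>carrier := P\<rparr>) P = Q" unfolding Q_def using derived_consistent[OF _ Ps] by simp
  moreover have "(<#>\<^bsub>G\<lparr>carrier := P\<rparr>\<^esub>) = (<#>)" by (intro ext) simp
  ultimately have comm: "comm_group ((G Mod Q)\<lparr>carrier := A\<rparr>)"
    using PG.derived_quot_is_comm_group by (simp add: A_def FactGroup_def)
  have finF: "finite (carrier (G Mod Q))" using fin by (simp add: carrier_FactGroup)
  have cAQ: "card A * card Q = p ^ a"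
    unfolding A_def using card_rcosets_restrict[OF Q.subgroup_axioms Ps QP] P(3) by simp
  have "card (rcosets\<^bsub>G Mod Q\<^esub> A) * card A * card Q = card (rcosets Q) * card Q"
    using F.lagrange[OF normal_imp_subgroup[OF A]] by (simp add: order_def FactGroup_def)
  also have "\<dots> = card (rcosets N) * card N"
    using lagrange[OF Q.subgroup_axioms] lagrange[OF N.subgroup_axioms] by simp
  also have "\<dots> = card (rcosets N) * m * (card A * card Q)" using m cAQ by simp
  finally have "card (rcosets\<^bsub>G Mod Q\<^esub> A) * (card A * card Q) = card (rcosets N) * m * (card A * card Q)"
    by (simp add: mult.assoc)
  moreover have "card A * card Q \<noteq> 0" using cAQ p by (simp add: prime_gt_0_nat)
  ultimately have idx: "card (rcosets\<^bsub>G Mod Q\<^esub> A) = card (rcosets N) * m" by (metis mult_right_cancel)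
  then have "\<not> p dvd card (rcosets\<^bsub>G Mod Q\<^esub> A)" using ndvd m(2) p by (simp add: prime_dvd_mult_iff)
  then have "coprime (p ^ a) (card (rcosets\<^bsub>G Mod Q\<^esub> A))" using p by (simp add: prime_imp_coprime)
  then have "coprime (card A) (card (rcosets\<^bsub>G Mod Q\<^esub> A))" using cAQ by (metis coprime_mult_left_iff)
  from F.abelian_normal_complement[OF finF A comm this]
  obtain K where K: "subgroup K (G Mod Q)" "K <#>\<^bsub>G Mod Q\<^esub> A = carrier (G Mod Q)" "K \<inter> A = {\<one>\<^bsub>G Mod Q\<^esub>}"
    by blast
  have "A \<subseteq> rcosets\<^bsub>G\<lparr>carrier := N\<rparr>\<^esub> Q" unfolding A_def rcosets_restrict using P(2) by auto
  then have "carrier (G Mod Q) \<subseteq> K <#>\<^bsub>G Mod Q\<^esub> (rcosets\<^bsub>G\<lparr>carrier := N\<rparr>\<^esub> Q)"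
    using K(2) mono_set_mult[OF subset_refl] by blast
  moreover have "rcosets\<^bsub>G\<lparr>carrier := N\<rparr>\<^esub> Q \<subseteq> carrier (G Mod Q)"
    unfolding rcosets_restrict carrier_FactGroup using N.subset by auto
  ultimately have "K <#>\<^bsub>G Mod Q\<^esub> (rcosets\<^bsub>G\<lparr>carrier := N\<rparr>\<^esub> Q) = carrier (G Mod Q)"
    using F.set_mult_closed[OF subgroup.subset[OF K(1)]] by blast
  then have "K = carrier (G Mod Q)"
    using nonsupplemented_quotient[OF Qn N.subgroup_axioms _ _ K(1)] QP P(2) supp by blast
  then have "A = {\<one>\<^bsub>G Mod Q\<^esub>}" using K(3) subgroup.subset[OF normal_imp_subgroup[OF A]] by blast
  then have "card Q = card P" using cAQ P(3) by simp
  moreover have "finite P" using finN P(2) finite_subset by blast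
  ultimately have "Q = P" using QP by (simp add: card_subset_eq)
  then show False using neP Q_def by simp
qed

end

section \<open>Profinite groups by their open normal subgroups\<close>

text \<open>
  For the theory of subgroups a profinite group is a compact group whose topology has the cosets of
  its open normal subgroups as a base and in which these subgroups separate points. In contrast to
  a presentation as an inverse limit, this description is inherited by open subgroups without
  further choices.
\<close>

locale profinite = group G for G :: "('a, 'c) monoid_scheme" (structure) +
  fixes T :: "'a topology"
  assumes topspace_eq: "topspace T = carrier G"
    and compact: "compact_space T"
    and openin_iff: "openin T U \<longleftrightarrow>
      U \<subseteq> carrier G \<and> (\<forall>x\<in>U. \<exists>N. open_normal_subgroup N G T \<and> N #> x \<subseteq> U)"
    and separated: "x \<in> carrier G \<Longrightarrow> x \<noteq> \<one> \<Longrightarrow> \<exists>N. open_normal_subgroup N G T \<and> x \<notin> N"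

text \<open>
  A basic open set constrains finitely many coordinates. By directedness one index \<open>k\<close> lies above
  all of them, and on the inverse limit the coordinate at \<open>k\<close> determines theirs; hence single
  coordinates already give a base.
\<close>

lemma openin_inverse_limit_topology:
  assumes sys: "inverse_system I r A f"
  shows "openin (inverse_limit_topology I r A f) V \<longleftrightarrow>
    V \<subseteq> carrier (inverse_limit I r A f) \<and>
    (\<forall>y\<in>V. \<exists>i\<in>I. {z \<in> carrier (inverse_limit I r A f). z i = y i} \<subseteq> V)"
proof -
  let ?L = "carrier (inverse_limit I r A f)"
  let ?P = "product_topology (\<lambda>i. discrete_topology (carrier (A i))) I"
  have L: "?L = {x \<in> (\<Pi>\<^sub>E i\<in>I. carrier (A i)). \<forall>(i, j)\<in>r. f i j (x j) = x i}"
    by (simp add: inverse_limit_def)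
  have ne: "I \<noteq> {}" and dir: "\<And>i j. i \<in> I \<Longrightarrow> j \<in> I \<Longrightarrow> \<exists>k\<in>I. (i, k) \<in> r \<and> (j, k) \<in> r"
    and po: "partial_order_on I r"
    using sys by (auto simp: inverse_system_def)
  have tr: "(i, k) \<in> r" if "(i, j) \<in> r" "(j, k) \<in> r" for i j k
    using po that unfolding partial_order_on_def preorder_on_def by (blast dest: transD)
  have bound: "\<exists>k\<in>I. \<forall>i\<in>J. (i, k) \<in> r" if "finite J" "J \<subseteq> I" for J
    using that
  proof (induction J rule: finite_induct)
    case empty
    then show ?case using ne by auto
  next
    case (insert j J)
    then obtain k where k: "k \<in> I" "\<forall>i\<in>J. (i, k) \<in> r" by auto
    obtain l where "l \<in> I" "(j, l) \<in> r" "(k, l) \<in> r" using dir[of j k] k insert.prems by auto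
    then show ?case using k tr by blast
  qed
  have openin_slice: "openin (subtopology ?P ?L) {z \<in> ?L. z i = a}" if i: "i \<in> I" for i a
  proof -
    have "openin ?P {z \<in> topspace ?P. z i \<in> {a} \<inter> carrier (A i)}"
      using i by (intro openin_continuous_map_preimage[OF continuous_map_product_projection[OF i]]) simp
    then have "openin (subtopology ?P ?L) (?L \<inter> {z \<in> topspace ?P. z i \<in> {a} \<inter> carrier (A i)})"
      by (rule openin_subtopology_Int2)
    moreover have "?L \<inter> {z \<in> topspace ?P. z i \<in> {a} \<inter> carrier (A i)} = {z \<in> ?L. z i = a}"
      using i by (auto simp: L PiE_iff)
    ultimately show ?thesis by simp
  qed
  show ?thesis
    unfolding inverse_limit_topology_def
  proof (intro iffI conjI ballI)
    assume V: "openin (subtopology ?P ?L) V"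
    then show "V \<subseteq> ?L" by (auto simp: openin_subtopology)
    fix y assume y: "y \<in> V"
    obtain W where W: "openin ?P W" "V = W \<inter> ?L" using V by (auto simp: openin_subtopology)
    then obtain U where U: "finite {i \<in> I. U i \<noteq> carrier (A i)}" "y \<in> Pi\<^sub>E I U" "Pi\<^sub>E I U \<subseteq> W"
      using y by (auto simp: openin_product_topology_alt)
    obtain k where k: "k \<in> I" "\<And>i. i \<in> I \<Longrightarrow> U i \<noteq> carrier (A i) \<Longrightarrow> (i, k) \<in> r"
      using bound[OF U(1)] by auto
    have "{z \<in> ?L. z k = y k} \<subseteq> V"
    proof
      fix z assume "z \<in> {z \<in> ?L. z k = y k}"
      then have z: "z \<in> ?L" "z k = y k" by auto
      have yL: "y \<in> ?L" using y W by auto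
      have "z i \<in> U i" if i: "i \<in> I" for i
      proof (cases "U i = carrier (A i)")
        case True
        then show ?thesis using z i by (auto simp: L)
      next
        case False
        then have "(i, k) \<in> r" using k i by auto
        then have "z i = f i k (z k)" "y i = f i k (y k)" using z(1) yL unfolding L by force+
        then have "z i = y i" using z by simp
        then show ?thesis using U(2) i by auto
      qed
      then have "z \<in> Pi\<^sub>E I U" using z by (auto simp: L PiE_iff)
      then show "z \<in> V" using U W z by auto
    qed
    then show "\<exists>i\<in>I. {z \<in> ?L. z i = y i} \<subseteq> V" using k by auto
  next
    assume V: "V \<subseteq> ?L \<and> (\<forall>y\<in>V. \<exists>i\<in>I. {z \<in> ?L. z i = y i} \<subseteq> V)"
    show "openin (subtopology ?P ?L) V"
    proof (subst openin_subopen, intro ballI)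
      fix y assume y: "y \<in> V"
      then obtain i where i: "i \<in> I" "{z \<in> ?L. z i = y i} \<subseteq> V" using V by auto
      then show "\<exists>S. openin (subtopology ?P ?L) S \<and> y \<in> S \<and> S \<subseteq> V"
        using openin_slice[OF i(1), of "y i"] y V by (intro exI[of _ "{z \<in> ?L. z i = y i}"]) auto
    qed
  qed
qed

text \<open>
  The inverse limit is closed in a product of finite discrete spaces, as each compatibility
  condition equates two continuous maps into a discrete space.
\<close>

lemma compact_inverse_limit_topology:
  assumes sys: "inverse_system I r A f" and fin: "\<And>i. i \<in> I \<Longrightarrow> finite (carrier (A i))"
  shows "compact_space (inverse_limit_topology I r A f)"
proof -
  let ?L = "carrier (inverse_limit I r A f)"
  let ?P = "product_topology (\<lambda>i. discrete_topology (carrier (A i))) I"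
  have L: "?L = {x \<in> topspace ?P. \<forall>(i, j)\<in>r. f i j (x j) = x i}"
    by (simp add: inverse_limit_def)
  have rI: "i \<in> I" "j \<in> I" if "(i, j) \<in> r" for i j
    using sys that by (auto simp: inverse_system_def partial_order_on_def preorder_on_def)
  have ne: "r \<noteq> {}"
    using sys by (auto simp: inverse_system_def partial_order_on_def preorder_on_def refl_on_def)
  define C where "C = (\<lambda>(i, j). {x \<in> topspace ?P. f i j (x j) = x i})"
  have C: "closedin ?P (C e)" if e: "e \<in> r" for e
  proof -
    obtain i j where ij: "e = (i, j)" by (cases e)
    then have ijr: "(i, j) \<in> r" using e by simp
    have "f i j \<in> hom (A j) (A i)" using sys ijr by (auto simp: inverse_system_def)
    then have "continuous_map (discrete_topology (carrier (A j))) (discrete_topology (carrier (A i))) (f i j)"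
      by (auto simp: hom_def)
    then have "continuous_map ?P (discrete_topology (carrier (A i))) (f i j \<circ> (\<lambda>x. x j))"
      using continuous_map_product_projection[OF rI(2)[OF ijr], of "\<lambda>i. discrete_topology (carrier (A i))"]
      by (intro continuous_map_compose) auto
    from closedin_continuous_maps_eq[OF _ this continuous_map_product_projection[OF rI(1)[OF ijr]]]
    show ?thesis by (simp add: C_def ij)
  qed
  have "?L = \<Inter>(C ` r)" using ne by (auto simp: L C_def)
  moreover have "closedin ?P (\<Inter>(C ` r))" using ne C by (intro closedin_Inter) auto
  ultimately have cl: "closedin ?P ?L" by simp
  have "compact_space ?P"
    using fin by (simp add: compact_space_product_topology compact_space_discrete_topology)
  then show ?thesis
    unfolding inverse_limit_topology_def using cl closedin_compact_space compact_space_subtopology by blast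
qed

text \<open>
  What the rest needs of a presentation as an inverse limit: the coordinate homomorphisms \<open>q i\<close> on
  \<open>G\<close>, the cosets of whose kernels form a base of the topology.
\<close>

lemma inverse_limit_kernels:
  fixes G :: "('a, 'c) monoid_scheme" and T :: "'a topology"
  assumes "is_inverse_limit_of_finite P G T"
  obtains I :: "'a set set" and A :: "'a set \<Rightarrow> 'a set monoid" and q :: "'a set \<Rightarrow> 'a \<Rightarrow> 'a set"
  where "\<And>i. i \<in> I \<Longrightarrow> P (A i)" "\<And>i. i \<in> I \<Longrightarrow> group_hom G (A i) (q i)"
    "\<And>U. openin T U \<longleftrightarrow> U \<subseteq> carrier G \<and> (\<forall>x\<in>U. \<exists>i\<in>I. kernel G (A i) (q i) #>\<^bsub>G\<^esub> x \<subseteq> U)"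
    "compact_space T" "topspace T = carrier G"
    "\<And>x. x \<in> carrier G \<Longrightarrow> x \<noteq> \<one>\<^bsub>G\<^esub> \<Longrightarrow> \<exists>i\<in>I. x \<notin> kernel G (A i) (q i)"
proof -
  obtain I r A f \<phi> where G: "group G" and ts: "topspace T = carrier G"
    and sys: "inverse_system I r (A :: 'a set \<Rightarrow> 'a set monoid) f"
    and fin: "\<And>i. i \<in> I \<Longrightarrow> finite (carrier (A i))" and P: "\<And>i. i \<in> I \<Longrightarrow> P (A i)"
    and iso: "\<phi> \<in> iso G (inverse_limit I r A f)"
    and homeo: "homeomorphic_map T (inverse_limit_topology I r A f) \<phi>"
    using assms unfolding is_inverse_limit_of_finite_def by blast
  interpret G: group G by fact
  let ?L = "carrier (inverse_limit I r A f)"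
  define q where "q i g = \<phi> g i" for i g
  have bij: "bij_betw \<phi> (carrier G) ?L" using iso by (simp add: iso_def)
  have \<phi>L: "\<phi> g \<in> ?L" if "g \<in> carrier G" for g using bij that bij_betwE by blast
  have L: "?L \<subseteq> (\<Pi>\<^sub>E i\<in>I. carrier (A i))" by (auto simp: inverse_limit_def)
  have hom: "group_hom G (A i) (q i)" if i: "i \<in> I" for i
  proof -
    have "q i \<in> hom G (A i)"
    proof (rule homI)
      show "q i x \<in> carrier (A i)" if "x \<in> carrier G" for x
        unfolding q_def using \<phi>L[OF that] L i by auto
      show "q i (x \<otimes>\<^bsub>G\<^esub> y) = q i x \<otimes>\<^bsub>A i\<^esub> q i y" if "x \<in> carrier G" "y \<in> carrier G" for x y
        unfolding q_def using iso that i by (simp add: iso_def hom_def inverse_limit_def product_group_def)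
    qed
    moreover have "group (A i)" using sys i by (simp add: inverse_system_def)
    ultimately show ?thesis using G by (simp add: group_hom_def group_hom_axioms_def)
  qed
  have ker: "g \<in> kernel G (A i) (q i) #>\<^bsub>G\<^esub> x \<longleftrightarrow> g \<in> carrier G \<and> \<phi> g i = \<phi> x i"
    if i: "i \<in> I" and x: "x \<in> carrier G" for i g x
  proof -
    interpret h: group_hom G "A i" "q i" using hom[OF i] .
    have "g \<in> kernel G (A i) (q i) #>\<^bsub>G\<^esub> x \<longleftrightarrow> g \<in> carrier G \<and> q i (g \<otimes>\<^bsub>G\<^esub> inv\<^bsub>G\<^esub> x) = \<one>\<^bsub>A i\<^esub>"
    proof (cases "g \<in> carrier G")
      case True
      then show ?thesis
        using subgroup.rcos_module[OF h.subgroup_kernel G x True] x by (simp add: kernel_def)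
    next
      case False
      then show ?thesis using subgroup.elemrcos_carrier[OF h.subgroup_kernel G x, of g] by blast
    qed
    also have "\<dots> \<longleftrightarrow> g \<in> carrier G \<and> q i g = q i x"
      using x h.H.inv_solve_right'[of "\<one>\<^bsub>A i\<^esub>" "q i g" "q i x"] by auto
    finally show ?thesis by (simp add: q_def)
  qed
  have op: "openin T U \<longleftrightarrow> U \<subseteq> carrier G \<and> (\<forall>x\<in>U. \<exists>i\<in>I. kernel G (A i) (q i) #>\<^bsub>G\<^esub> x \<subseteq> U)" for U
  proof (cases "U \<subseteq> carrier G")
    case True
    have "openin T U \<longleftrightarrow> (\<forall>x\<in>U. \<exists>i\<in>I. {z \<in> ?L. z i = \<phi> x i} \<subseteq> \<phi> ` U)"
      using True \<phi>L homeomorphic_map_openness_eq[OF homeo, of U] ts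
      by (auto simp: openin_inverse_limit_topology[OF sys])
    also have "\<dots> \<longleftrightarrow> (\<forall>x\<in>U. \<exists>i\<in>I. kernel G (A i) (q i) #>\<^bsub>G\<^esub> x \<subseteq> U)"
    proof (intro ball_cong bex_cong refl)
      fix x i assume x: "x \<in> U" and i: "i \<in> I"
      have xc: "x \<in> carrier G" using x True by auto
      have "{z \<in> ?L. z i = \<phi> x i} = \<phi> ` (kernel G (A i) (q i) #>\<^bsub>G\<^esub> x)"
        using bij ker[OF i xc] by (fastforce simp: bij_betw_def)
      moreover have "kernel G (A i) (q i) #>\<^bsub>G\<^esub> x \<subseteq> carrier G" using ker[OF i xc] by auto
      ultimately show "({z \<in> ?L. z i = \<phi> x i} \<subseteq> \<phi> ` U) = (kernel G (A i) (q i) #>\<^bsub>G\<^esub> x \<subseteq> U)"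
        using bij True by (auto simp: bij_betw_def inj_on_image_subset_iff)
    qed
    finally show ?thesis using True by simp
  next
    case False
    then show ?thesis using ts openin_subset by blast
  qed
  have comp: "compact_space T"
    using homeomorphic_compact_space[OF homeomorphic_map_imp_homeomorphic_space[OF homeo]]
      compact_inverse_limit_topology[OF sys fin] by simp
  have sep: "\<exists>i\<in>I. x \<notin> kernel G (A i) (q i)" if x: "x \<in> carrier G" "x \<noteq> \<one>\<^bsub>G\<^esub>" for x
  proof (rule ccontr)
    assume "\<not> ?thesis"
    then have "q i x = q i \<one>\<^bsub>G\<^esub>" if "i \<in> I" for i
      using group_hom.hom_one[OF hom[OF that]] that by (auto simp: kernel_def)
    then have eq: "\<phi> x i = \<phi> \<one>\<^bsub>G\<^esub> i" if "i \<in> I" for i using that by (simp add: q_def)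
    have "\<phi> x = \<phi> \<one>\<^bsub>G\<^esub>"
      using subsetD[OF L \<phi>L[OF x(1)]] subsetD[OF L \<phi>L[OF G.one_closed]] eq by (rule PiE_ext)
    then show False using x bij G.one_closed by (metis bij_betw_imp_inj_on inj_onD)
  qed
  show thesis using that[OF P hom op comp ts sep] .
qed

lemma profinite_if_inverse_limit:
  fixes G :: "('a, 'c) monoid_scheme" and T :: "'a topology"
  assumes "is_inverse_limit_of_finite P G T"
  shows "profinite G T"
proof -
  have G: "group G" using assms by (simp add: is_inverse_limit_of_finite_def)
  show ?thesis
  proof (rule inverse_limit_kernels[OF assms])
    fix I :: "'a set set" and A :: "'a set \<Rightarrow> 'a set monoid" and q :: "'a set \<Rightarrow> 'a \<Rightarrow> 'a set"
    assume hom: "\<And>i. i \<in> I \<Longrightarrow> group_hom G (A i) (q i)"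
      and op: "\<And>U. openin T U \<longleftrightarrow> U \<subseteq> carrier G \<and> (\<forall>x\<in>U. \<exists>i\<in>I. kernel G (A i) (q i) #>\<^bsub>G\<^esub> x \<subseteq> U)"
      and comp: "compact_space T" and ts: "topspace T = carrier G"
      and sep: "\<And>x. x \<in> carrier G \<Longrightarrow> x \<noteq> \<one>\<^bsub>G\<^esub> \<Longrightarrow> \<exists>i\<in>I. x \<notin> kernel G (A i) (q i)"
    interpret G: group G by fact
    have sub: "subgroup (kernel G (A i) (q i)) G" if "i \<in> I" for i
      using group_hom.subgroup_kernel[OF hom[OF that]] .
    have ker: "open_normal_subgroup (kernel G (A i) (q i)) G T" if i: "i \<in> I" for i
    proof -
      have "kernel G (A i) (q i) #>\<^bsub>G\<^esub> x \<subseteq> kernel G (A i) (q i)" if "x \<in> kernel G (A i) (q i)" for x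
        using subgroup.rcos_const[OF sub[OF i] G that] by simp
      then have "openin T (kernel G (A i) (q i))"
        unfolding op using i subgroup.subset[OF sub[OF i]] by blast
      then show ?thesis
        using group_hom.normal_kernel[OF hom[OF i]] by (simp add: open_normal_subgroup_def)
    qed
    show "profinite G T"
    proof (unfold_locales)
      show "topspace T = carrier G" "compact_space T" by fact+
      show "\<exists>N. open_normal_subgroup N G T \<and> x \<notin> N" if "x \<in> carrier G" "x \<noteq> \<one>\<^bsub>G\<^esub>" for x
        using sep[OF that] ker by blast
      show "openin T U \<longleftrightarrow> U \<subseteq> carrier G \<and> (\<forall>x\<in>U. \<exists>N. open_normal_subgroup N G T \<and> N #>\<^bsub>G\<^esub> x \<subseteq> U)" for U
      proof
        assume "openin T U"
        then show "U \<subseteq> carrier G \<and> (\<forall>x\<in>U. \<exists>N. open_normal_subgroup N G T \<and> N #>\<^bsub>G\<^esub> x \<subseteq> U)"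
          using op ker by blast
      next
        assume U: "U \<subseteq> carrier G \<and> (\<forall>x\<in>U. \<exists>N. open_normal_subgroup N G T \<and> N #>\<^bsub>G\<^esub> x \<subseteq> U)"
        have "\<exists>i\<in>I. kernel G (A i) (q i) #>\<^bsub>G\<^esub> x \<subseteq> U" if x: "x \<in> U" for x
        proof -
          obtain N where N: "open_normal_subgroup N G T" "N #>\<^bsub>G\<^esub> x \<subseteq> U" using U x by blast
          then have Ns: "subgroup N G" "openin T N"
            using normal_imp_subgroup by (auto simp: open_normal_subgroup_def)
          then obtain i where i: "i \<in> I" "kernel G (A i) (q i) #>\<^bsub>G\<^esub> \<one>\<^bsub>G\<^esub> \<subseteq> N"
            using op subgroup.one_closed by metis
          then have "kernel G (A i) (q i) \<subseteq> N"
            using subgroup.subset[OF sub[OF i(1)]] by simp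
          then show ?thesis using i N(2) unfolding r_coset_def by blast
        qed
        then show "openin T U" unfolding op using U by blast
      qed
    qed
  qed
qed

text \<open>
  \<open>U\<close> contains the kernel of a homomorphism to a nilpotent group.
\<close>

lemma pronilpotent_lower_central:
  fixes G :: "('a, 'c) monoid_scheme" and T :: "'a topology"
  assumes "pronilpotent_group G T" and "openin T U" "\<one>\<^bsub>G\<^esub> \<in> U"
  shows "\<exists>n. lower_central G n \<subseteq> U"
proof -
  have inv: "is_inverse_limit_of_finite nilpotent_group G T"
    using assms by (simp add: pronilpotent_group_def)
  show ?thesis
  proof (rule inverse_limit_kernels[OF inv])
    fix I :: "'a set set" and A :: "'a set \<Rightarrow> 'a set monoid" and q :: "'a set \<Rightarrow> 'a \<Rightarrow> 'a set"
    assume nil: "\<And>i. i \<in> I \<Longrightarrow> nilpotent_group (A i)"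
      and hom: "\<And>i. i \<in> I \<Longrightarrow> group_hom G (A i) (q i)"
      and op: "\<And>U. openin T U \<longleftrightarrow> U \<subseteq> carrier G \<and> (\<forall>x\<in>U. \<exists>i\<in>I. kernel G (A i) (q i) #>\<^bsub>G\<^esub> x \<subseteq> U)"
    obtain i where i: "i \<in> I" "kernel G (A i) (q i) #>\<^bsub>G\<^esub> \<one>\<^bsub>G\<^esub> \<subseteq> U"
      using op assms by metis
    interpret h: group_hom G "A i" "q i" using hom[OF i(1)] .
    obtain n where "lower_central (A i) n = {\<one>\<^bsub>A i\<^esub>}" using nil[OF i(1)] by (auto simp: nilpotent_group_def)
    then have "lower_central G n \<subseteq> kernel G (A i) (q i)"
      using h.lower_central_image[of n] subgroup.subset[OF h.G.lower_central_subgroup[of n]]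
      by (auto simp: kernel_def)
    then have "lower_central G n \<subseteq> U"
      using i(2) subgroup.subset[OF h.subgroup_kernel] by simp
    then show "\<exists>n. lower_central G n \<subseteq> U" by blast
  qed
qed

context profinite
begin

lemma open_normal_subgroupD:
  assumes "open_normal_subgroup N G T"
  shows "N \<lhd> G" "subgroup N G" "openin T N" "N \<subseteq> carrier G" "open_subgroup N G T"
  using assms normal_imp_subgroup subgroup.subset[OF normal_imp_subgroup[of N G]]
  by (auto simp: open_normal_subgroup_def open_subgroup_def)

lemma open_normal_subgroup_carrier: "open_normal_subgroup (carrier G) G T"
  unfolding open_normal_subgroup_def using normal_self topspace_eq openin_topspace by metis

lemma open_normal_subgroup_Int:
  assumes "open_normal_subgroup M G T" "open_normal_subgroup N G T"
  shows "open_normal_subgroup (M \<inter> N) G T"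
  using assms normal_subgroup_intersect openin_Int by (auto simp: open_normal_subgroup_def)

lemma openin_r_coset:
  assumes "open_subgroup H G T" "x \<in> carrier G"
  shows "openin T (H #> x)"
proof -
  have H: "subgroup H G" "openin T H" using assms by (auto simp: open_subgroup_def)
  obtain N where N: "open_normal_subgroup N G T" "N #> \<one> \<subseteq> H"
    using H openin_iff subgroup.one_closed by metis
  have NH: "N \<subseteq> H" using N open_normal_subgroupD by simp
  have "N #> y \<subseteq> H #> x" if "y \<in> H #> x" for y
    using NH repr_independence[OF that assms(2) H(1)] by (auto simp: r_coset_def)
  then show ?thesis
    unfolding openin_iff using N r_coset_subset_G[OF subgroup.subset[OF H(1)] assms(2)] by blast
qed

lemma open_subgroup_contains_open_normal:
  assumes "open_subgroup H G T"
  obtains N where "open_normal_subgroup N G T" "N \<subseteq> H"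
proof -
  have H: "subgroup H G" "openin T H" using assms by (auto simp: open_subgroup_def)
  obtain N where N: "open_normal_subgroup N G T" "N #> \<one> \<subseteq> H"
    using H openin_iff subgroup.one_closed by metis
  then show thesis using that open_normal_subgroupD by simp
qed

lemma open_subgroup_if_contains_open_normal:
  assumes "subgroup K G" "open_normal_subgroup N G T" "N \<subseteq> K"
  shows "open_subgroup K G T"
proof -
  have "N #> y \<subseteq> K" if "y \<in> K" for y
    using that assms(3) subgroup.m_closed[OF assms(1)] by (auto simp: r_coset_def)
  then show ?thesis
    unfolding open_subgroup_def openin_iff using assms subgroup.subset by blast
qed

lemma open_subgroup_set_mult:
  assumes "subgroup K G" "open_normal_subgroup N G T"
  shows "open_subgroup (K <#> N) G T"
  using assms open_normal_subgroupD[OF assms(2)] subgroup_set_mult_normal set_mult_superset2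
  by (intro open_subgroup_if_contains_open_normal[of _ N]) auto

lemma closedin_r_coset:
  assumes "open_subgroup H G T" and x: "x \<in> carrier G"
  shows "closedin T (H #> x)"
proof -
  have H: "subgroup H G" using assms by (auto simp: open_subgroup_def)
  have "carrier G - (H #> x) = \<Union>((\<lambda>y. H #> y) ` (carrier G - (H #> x)))"
  proof
    show "carrier G - (H #> x) \<subseteq> \<Union>((\<lambda>y. H #> y) ` (carrier G - (H #> x)))"
      using rcos_self[OF _ H] by blast
    show "\<Union>((\<lambda>y. H #> y) ` (carrier G - (H #> x))) \<subseteq> carrier G - (H #> x)"
    proof clarify
      fix y z assume y: "y \<in> carrier G" "y \<notin> H #> x" and z: "z \<in> H #> y"
      have Hz: "H #> y = H #> z" using repr_independence[OF z y(1) H] .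
      have "z \<notin> H #> x"
      proof
        assume "z \<in> H #> x"
        then have "H #> x = H #> z" using repr_independence[OF _ x H] by blast
        then show False using Hz rcos_self[OF y(1) H] y(2) by simp
      qed
      moreover have "z \<in> carrier G" using z r_coset_subset_G[OF subgroup.subset[OF H] y(1)] by auto
      ultimately show "z \<in> carrier G - (H #> x)" by simp
    qed
  qed
  moreover have "openin T (\<Union>((\<lambda>y. H #> y) ` (carrier G - (H #> x))))"
    using openin_r_coset[OF assms(1)] by (intro openin_Union) auto
  ultimately show ?thesis
    using r_coset_subset_G[OF subgroup.subset[OF H] x] topspace_eq by (simp add: closedin_def)
qed

lemma open_subgroup_closedin:
  assumes "open_subgroup H G T"
  shows "closedin T H"
proof -
  have "H \<subseteq> carrier G" using assms subgroup.subset by (auto simp: open_subgroup_def)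
  then show ?thesis using closedin_r_coset[OF assms one_closed] by simp
qed

lemma open_imp_closed_subgroup: "open_subgroup H G T \<Longrightarrow> closed_subgroup H G T"
  using open_subgroup_closedin by (auto simp: open_subgroup_def closed_subgroup_def)

text \<open>
  The cosets of \<open>H\<close> form an open cover without a proper subcover.
\<close>

lemma finite_rcosets:
  assumes "open_subgroup H G T"
  shows "finite (rcosets H)"
proof -
  have H: "subgroup H G" using assms by (auto simp: open_subgroup_def)
  have "\<forall>U\<in>rcosets H. openin T U" using openin_r_coset[OF assms] by (auto simp: RCOSETS_def)
  then obtain \<F> where F: "finite \<F>" "\<F> \<subseteq> rcosets H" "carrier G \<subseteq> \<Union>\<F>"
    using compact rcosets_part_G[OF H] topspace_eq unfolding compact_space_def compactin_def
    by (metis subset_refl)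
  have "rcosets H \<subseteq> \<F>"
  proof
    fix X assume X: "X \<in> rcosets H"
    then obtain x where x: "x \<in> carrier G" "X = H #> x" by (auto simp: RCOSETS_def)
    then obtain Y where Y: "Y \<in> \<F>" "x \<in> Y" using F by blast
    then have "X \<inter> Y \<noteq> {}" using rcos_self[OF x(1) H] x by auto
    then have "X = Y" using rcos_disjoint[OF H] X Y F(2) unfolding pairwise_def disjnt_def by blast
    then show "X \<in> \<F>" using Y by simp
  qed
  then show ?thesis using F finite_subset by blast
qed

lemma card_rcosets_pos:
  assumes "open_subgroup H G T"
  shows "card (rcosets H) > 0"
  using finite_rcosets[OF assms] subgroup.subgroup_in_rcosets[OF _ is_group] assms
  by (auto simp: card_gt_0_iff open_subgroup_def)

lemma profinite_restrict:
  assumes H: "open_subgroup H G T"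
  shows "profinite (G\<lparr>carrier := H\<rparr>) (subtopology T H)"
proof -
  have Hs: "subgroup H G" and Ho: "openin T H" using H by (auto simp: open_subgroup_def)
  have Hc: "H \<subseteq> carrier G" using Hs by (rule subgroup.subset)
  interpret HG: group "G\<lparr>carrier := H\<rparr>" using Hs by (rule subgroup_imp_group)
  have op: "openin (subtopology T H) U \<longleftrightarrow> U \<subseteq> H \<and> openin T U" for U
    using Ho by (auto simp: openin_open_subtopology)
  have restr: "open_normal_subgroup (N \<inter> H) (G\<lparr>carrier := H\<rparr>) (subtopology T H)"
    if N: "open_normal_subgroup N G T" for N
    using normal_Int_subgroup[OF Hs open_normal_subgroupD(1)[OF N]] op open_normal_subgroupD(3)[OF N] Ho
    by (auto simp: open_normal_subgroup_def)
  show ?thesis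
  proof unfold_locales
    show "topspace (subtopology T H) = carrier (G\<lparr>carrier := H\<rparr>)" using Hc topspace_eq by auto
    show "compact_space (subtopology T H)"
      using open_subgroup_closedin[OF H] closedin_compact_space[OF compact] compact_space_subtopology by blast
    show "\<exists>N. open_normal_subgroup N (G\<lparr>carrier := H\<rparr>) (subtopology T H) \<and> x \<notin> N"
      if x: "x \<in> carrier (G\<lparr>carrier := H\<rparr>)" "x \<noteq> \<one>\<^bsub>G\<lparr>carrier := H\<rparr>\<^esub>" for x
    proof -
      have "x \<in> carrier G" "x \<noteq> \<one>" using x Hc by auto
      then obtain N where "open_normal_subgroup N G T" "x \<notin> N" using separated by blast
      then show ?thesis using restr[of N] by blast
    qed
    show "openin (subtopology T H) U \<longleftrightarrow> U \<subseteq> carrier (G\<lparr>carrier := H\<rparr>) \<and>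
      (\<forall>x\<in>U. \<exists>N. open_normal_subgroup N (G\<lparr>carrier := H\<rparr>) (subtopology T H) \<and> N #>\<^bsub>G\<lparr>carrier := H\<rparr>\<^esub> x \<subseteq> U)"
      (is "_ \<longleftrightarrow> ?R") for U
    proof
      assume U: "openin (subtopology T H) U"
      have "\<exists>N. open_normal_subgroup N (G\<lparr>carrier := H\<rparr>) (subtopology T H) \<and> N #> x \<subseteq> U" if x: "x \<in> U" for x
      proof -
        have "openin T U" using U op by simp
        then obtain N where "open_normal_subgroup N G T" "N #> x \<subseteq> U" using x openin_iff by blast
        then show ?thesis using restr[of N] unfolding r_coset_def by blast
      qed
      then show ?R using U op by simp
    next
      assume U: ?R
      have "\<exists>N. open_normal_subgroup N G T \<and> N #> x \<subseteq> U" if x: "x \<in> U" for x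
      proof -
        obtain N where N: "open_normal_subgroup N (G\<lparr>carrier := H\<rparr>) (subtopology T H)" "N #> x \<subseteq> U"
          using U x by auto
        then have "subgroup N (G\<lparr>carrier := H\<rparr>)" "openin T N"
          using op normal_imp_subgroup by (auto simp: open_normal_subgroup_def)
        then have "open_subgroup N G T" using incl_subgroup[OF Hs] by (simp add: open_subgroup_def)
        then obtain M where "open_normal_subgroup M G T" "M \<subseteq> N"
          by (rule open_subgroup_contains_open_normal)
        then show ?thesis using N(2) unfolding r_coset_def by blast
      qed
      moreover have "U \<subseteq> H" using U by simp
      ultimately have "openin T U" unfolding openin_iff using Hc by blast
      then show "openin (subtopology T H) U" using \<open>U \<subseteq> H\<close> op by simp
    qed
  qed
qed

text \<open>
  The canonical presentation: the quotients by the open normal subgroups, ordered by reverse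
  inclusion. A compatible family of cosets is a family of closed sets with the finite intersection
  property, so compactness gives it a common point; this is the surjectivity of the canonical map.
\<close>

lemma inverse_limit_of_quotients:
  assumes P: "\<And>N. open_normal_subgroup N G T \<Longrightarrow> P (G Mod N)"
  shows "is_inverse_limit_of_finite P G T"
proof -
  define I where "I = {N. open_normal_subgroup N G T}"
  define r where "r = {(N, M). N \<in> I \<and> M \<in> I \<and> M \<subseteq> N}"
  define A where "A N = G Mod N" for N
  define f where "f N M X = N <#> X" for N M X :: "'a set"
  define \<phi> where "\<phi> x = (\<lambda>N\<in>I. N #> x)" for x
  let ?L = "inverse_limit I r A f"
  have I: "N \<lhd> G" "subgroup N G" "N \<subseteq> carrier G" "open_normal_subgroup N G T" "open_subgroup N G T" if "N \<in> I" for N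
    using that open_normal_subgroupD[of N] by (auto simp: I_def)
  have I_Int: "M \<inter> N \<in> I" if "M \<in> I" "N \<in> I" for M N
    using that open_normal_subgroup_Int by (simp add: I_def)
  have carr: "carrier G \<in> I" using open_normal_subgroup_carrier by (simp add: I_def)
  have cA: "carrier (A N) = (\<lambda>x. N #> x) ` carrier G" for N by (simp add: A_def carrier_FactGroup)
  have f: "f N M (M #> x) = N #> x" if "(N, M) \<in> r" "x \<in> carrier G" for N M x
  proof -
    have NM: "N \<in> I" "M \<in> I" "M \<subseteq> N" using that by (auto simp: r_def)
    have "N <#> (M #> x) = (N <#> M) #> x"
      using NM I that by (intro setmult_rcos_assoc) auto
    then show ?thesis using NM I set_mult_subgroup_absorb[of N M] by (simp add: f_def)
  qed
  have sys: "inverse_system I r A f"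
    unfolding inverse_system_def
  proof (intro conjI)
    show "I \<noteq> {}" using carr by auto
    show "partial_order_on I r"
      by (auto simp: partial_order_on_def preorder_on_def r_def refl_on_def trans_def antisym_def)
    show "\<forall>i\<in>I. \<forall>j\<in>I. \<exists>k\<in>I. (i, k) \<in> r \<and> (j, k) \<in> r"
    proof (intro ballI)
      fix i j assume "i \<in> I" "j \<in> I"
      then show "\<exists>k\<in>I. (i, k) \<in> r \<and> (j, k) \<in> r"
        using I_Int[of i j] by (intro bexI[of _ "i \<inter> j"]) (auto simp: r_def)
    qed
    show "\<forall>i\<in>I. group (A i)" using normal.factorgroup_is_group[OF I(1)] by (simp add: A_def)
    show "\<forall>(i, j)\<in>r. f i j \<in> hom (A j) (A i)"
    proof clarify
      fix N M assume r: "(N, M) \<in> r"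
      have NM: "N \<in> I" "M \<in> I" using r by (auto simp: r_def)
      show "f N M \<in> hom (A M) (A N)"
      proof (rule homI)
        show "f N M X \<in> carrier (A N)" if "X \<in> carrier (A M)" for X
          using that f[OF r] by (auto simp: cA)
        fix X Y assume "X \<in> carrier (A M)" "Y \<in> carrier (A M)"
        then obtain x y where x: "x \<in> carrier G" "y \<in> carrier G" "X = M #> x" "Y = M #> y" by (auto simp: cA)
        have "f N M (X \<otimes>\<^bsub>A M\<^esub> Y) = f N M (M #> (x \<otimes> y))"
          using x normal.rcos_sum[OF I(1)[OF NM(2)]] by (simp add: A_def)
        also have "\<dots> = N #> (x \<otimes> y)" using f[OF r] x by simp
        also have "\<dots> = (N #> x) <#> (N #> y)" using x normal.rcos_sum[OF I(1)[OF NM(1)]] by simp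
        also have "\<dots> = f N M X \<otimes>\<^bsub>A N\<^esub> f N M Y" using x f[OF r] by (simp add: A_def)
        finally show "f N M (X \<otimes>\<^bsub>A M\<^esub> Y) = f N M X \<otimes>\<^bsub>A N\<^esub> f N M Y" .
      qed
    qed
    show "\<forall>i\<in>I. \<forall>x\<in>carrier (A i). f i i x = x"
      using f by (auto simp: cA r_def)
    show "\<forall>(i, j)\<in>r. \<forall>(j', k)\<in>r. j = j' \<longrightarrow> (\<forall>x\<in>carrier (A k). f i j (f j k x) = f i k x)"
    proof clarify
      fix i j k X assume r: "(i, j) \<in> r" "(j, k) \<in> r" and "X \<in> carrier (A k)"
      then obtain x where x: "x \<in> carrier G" "X = k #> x" by (auto simp: cA)
      have "(i, k) \<in> r" using r by (auto simp: r_def)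
      then show "f i j (f j k X) = f i k X" using x f r by simp
    qed
  qed
  have L: "carrier ?L = {X \<in> (\<Pi>\<^sub>E N\<in>I. carrier (A N)). \<forall>(N, M)\<in>r. f N M (X M) = X N}"
    by (simp add: inverse_limit_def)
  have \<phi>L: "\<phi> x \<in> carrier ?L" if x: "x \<in> carrier G" for x
  proof -
    have "N \<in> I \<and> M \<in> I" if "(N, M) \<in> r" for N M using that by (simp add: r_def)
    then show ?thesis using x f by (auto simp: L \<phi>_def cA)
  qed
  have surj: "\<exists>x\<in>carrier G. X = \<phi> x" if X: "X \<in> carrier ?L" for X
  proof -
    have XN: "\<exists>x\<in>carrier G. X N = N #> x" if "N \<in> I" for N
    proof -
      have "X N \<in> carrier (A N)" using X that by (auto simp: L)
      then show ?thesis by (auto simp: cA)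
    qed
    have clX: "closedin T (X N)" if N: "N \<in> I" for N
      using XN[OF N] closedin_r_coset[OF I(5)[OF N]] by auto
    have mono: "X M \<subseteq> X N" if "(N, M) \<in> r" for N M
    proof -
      have NM: "N \<in> I" "M \<in> I" "M \<subseteq> N" using that by (auto simp: r_def)
      obtain x where x: "x \<in> carrier G" "X M = M #> x" using XN NM by blast
      have "X N = f N M (X M)" using X that by (auto simp: L)
      then have "X N = N #> x" using f[OF that] x by simp
      then show ?thesis using x NM unfolding r_coset_def by blast
    qed
    have fip: "\<exists>M\<in>I. \<forall>N\<in>J. X M \<subseteq> X N" if "finite J" "J \<subseteq> I" for J
      using that
    proof (induction J rule: finite_induct)
      case empty
      then show ?case using carr by auto
    next
      case (insert N J)
      then obtain M where M: "M \<in> I" "\<forall>N\<in>J. X M \<subseteq> X N" by auto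
      have "N \<inter> M \<in> I" using insert.prems M I_Int by auto
      moreover have "(N, N \<inter> M) \<in> r" "(M, N \<inter> M) \<in> r"
        using calculation insert.prems M by (auto simp: r_def)
      ultimately show ?case using mono M by blast
    qed
    have "\<Inter>(X ` I) \<noteq> {}"
    proof -
      have "\<Inter>\<F> \<noteq> {}" if F: "finite \<F>" "\<F> \<subseteq> X ` I" for \<F>
      proof -
        obtain J where J: "J \<subseteq> I" "finite J" "\<F> = X ` J"
          using F by (meson finite_subset_image)
        obtain M where M: "M \<in> I" "\<forall>N\<in>J. X M \<subseteq> X N" using fip J by blast
        obtain x where x: "x \<in> carrier G" "X M = M #> x" using XN M by blast
        have "x \<in> X M" using rcos_self[OF x(1) I(2)[OF M(1)]] x by simp
        then have "x \<in> \<Inter>\<F>" using M(2) J(3) by auto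
        then show ?thesis by blast
      qed
      moreover have "\<forall>C\<in>X ` I. closedin T C" using clX by auto
      ultimately show ?thesis
        using compact[unfolded compact_space_fip, rule_format, of "X ` I"] by auto
    qed
    then obtain x where x: "\<And>N. N \<in> I \<Longrightarrow> x \<in> X N" by blast
    have xc: "x \<in> carrier G" using clX[OF carr] x[OF carr] topspace_eq closedin_subset by blast
    have "X = \<phi> x"
    proof (rule PiE_ext[of _ I "\<lambda>N. carrier (A N)"])
      show "X \<in> (\<Pi>\<^sub>E N\<in>I. carrier (A N))" using X by (simp add: L)
      show "\<phi> x \<in> (\<Pi>\<^sub>E N\<in>I. carrier (A N))" using \<phi>L[OF xc] by (simp add: L)
      fix N assume N: "N \<in> I"
      obtain y where y: "y \<in> carrier G" "X N = N #> y" using XN N by blast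
      show "X N = \<phi> x N"
        using repr_independence[OF _ y(1) I(2)[OF N], of x] x[OF N] y N by (simp add: \<phi>_def)
    qed
    then show ?thesis using xc by blast
  qed
  have inj: "inj_on \<phi> (carrier G)"
  proof (rule inj_onI, rule ccontr)
    fix x y assume xy: "x \<in> carrier G" "y \<in> carrier G" "\<phi> x = \<phi> y" "x \<noteq> y"
    then have "x \<otimes> inv y \<noteq> \<one>" using inv_equality[of x "inv y"] by auto
    then obtain N where N: "open_normal_subgroup N G T" "x \<otimes> inv y \<notin> N" using separated xy by blast
    then have "N \<in> I" by (simp add: I_def)
    then have "N #> x = N #> y" using xy(3) by (metis \<phi>_def restrict_apply')
    then show False using r_coset_eq_iff[OF I(2)[OF \<open>N \<in> I\<close>] xy(1,2)] N by simp
  qed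
  have img: "\<phi> ` carrier G = carrier ?L" using \<phi>L surj by auto
  have "\<phi> \<in> iso G ?L"
  proof (rule isoI)
    show "\<phi> \<in> hom G ?L"
    proof (rule homI)
      show "\<phi> x \<in> carrier ?L" if "x \<in> carrier G" for x using \<phi>L that .
      show "\<phi> (x \<otimes> y) = \<phi> x \<otimes>\<^bsub>?L\<^esub> \<phi> y" if "x \<in> carrier G" "y \<in> carrier G" for x y
        using that normal.rcos_sum[OF I(1)]
        by (simp add: \<phi>_def inverse_limit_def product_group_def A_def cong: restrict_cong)
    qed
    show "bij_betw \<phi> (carrier G) (carrier ?L)" using inj img by (simp add: bij_betw_def)
  qed
  moreover have "homeomorphic_map T (inverse_limit_topology I r A f) \<phi>"
  proof (rule continuous_imp_homeomorphic_map)
    let ?P = "product_topology (\<lambda>i. discrete_topology (carrier (A i))) I"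
    have tsL: "topspace (inverse_limit_topology I r A f) = carrier ?L"
      unfolding inverse_limit_topology_def by (auto simp: L)
    show "compact_space T" by (rule compact)
    show "Hausdorff_space (inverse_limit_topology I r A f)"
      unfolding inverse_limit_topology_def
      by (intro Hausdorff_space_subtopology) (simp add: Hausdorff_space_product_topology)
    show "\<phi> ` topspace T = topspace (inverse_limit_topology I r A f)" using img tsL topspace_eq by simp
    show "inj_on \<phi> (topspace T)" using inj topspace_eq by simp
    show "continuous_map T (inverse_limit_topology I r A f) \<phi>"
      unfolding continuous_map_def
    proof (intro conjI allI impI)
      show "\<phi> \<in> topspace T \<rightarrow> topspace (inverse_limit_topology I r A f)"
        using \<phi>L tsL topspace_eq by auto
      fix V assume V: "openin (inverse_limit_topology I r A f) V"
      show "openin T {x \<in> topspace T. \<phi> x \<in> V}"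
        unfolding openin_iff
      proof (intro conjI ballI)
        show "{x \<in> topspace T. \<phi> x \<in> V} \<subseteq> carrier G" using topspace_eq by auto
        fix x assume x: "x \<in> {x \<in> topspace T. \<phi> x \<in> V}"
        then obtain N where N: "N \<in> I" "{z \<in> carrier ?L. z N = \<phi> x N} \<subseteq> V"
          using V openin_inverse_limit_topology[OF sys] by blast
        have xc: "x \<in> carrier G" using x topspace_eq by auto
        have "N #> x \<subseteq> {x \<in> topspace T. \<phi> x \<in> V}"
        proof
          fix y assume y: "y \<in> N #> x"
          then have yc: "y \<in> carrier G" using r_coset_subset_G[OF I(3)[OF N(1)] xc] by auto
          have "\<phi> y N = \<phi> x N" using repr_independence[OF y xc I(2)[OF N(1)]] N by (simp add: \<phi>_def)
          then show "y \<in> {x \<in> topspace T. \<phi> x \<in> V}" using N(2) \<phi>L[OF yc] yc topspace_eq by auto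
        qed
        then show "\<exists>N. open_normal_subgroup N G T \<and> N #> x \<subseteq> {x \<in> topspace T. \<phi> x \<in> V}"
          using I(4)[OF N(1)] by blast
      qed
    qed
  qed
  moreover have "finite (carrier (A i)) \<and> P (A i)" if "i \<in> I" for i
    using finite_rcosets[OF I(5)[OF that]] P[OF I(4)[OF that]] by (simp add: A_def FactGroup_def)
  ultimately show ?thesis
    unfolding is_inverse_limit_of_finite_def using sys is_group topspace_eq by blast
qed

lemma pronilpotent_if_lower_central:
  assumes "\<And>N. open_normal_subgroup N G T \<Longrightarrow> \<exists>n. lower_central G n \<subseteq> N"
  shows "pronilpotent_group G T"
  unfolding pronilpotent_group_def
proof (rule inverse_limit_of_quotients)
  fix N assume N: "open_normal_subgroup N G T"
  interpret N: normal N G using open_normal_subgroupD(1)[OF N] .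
  interpret M: group "G Mod N" by (rule N.factorgroup_is_group)
  interpret \<pi>: group_hom G "G Mod N" "\<lambda>x. N #> x"
    using N.r_coset_hom_Mod by (auto simp: group_hom_def group_hom_axioms_def is_group M.is_group)
  obtain n where n: "lower_central G n \<subseteq> N" using assms[OF N] by blast
  have "lower_central (G Mod N) n \<subseteq> (\<lambda>x. N #> x) ` lower_central G n"
    by (rule \<pi>.lower_central_image_surj) (simp add: carrier_FactGroup)
  also have "\<dots> \<subseteq> {N}" using n N.rcos_const[OF is_group] by auto
  finally have "lower_central (G Mod N) n = {\<one>\<^bsub>G Mod N\<^esub>}"
    using subgroup.one_closed[OF M.lower_central_subgroup[of n]] by auto
  then show "nilpotent_group (G Mod N)" using M.is_group by (auto simp: nilpotent_group_def)
qed

section \<open>Isolated points of the space of closed subgroups\<close>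

lemma subgroup_nbhd_Int_subset:
  assumes "open_normal_subgroup M G T" "open_normal_subgroup N G T" "closed_subgroup K G T"
  shows "subgroup_nbhd G T K (M \<inter> N) \<subseteq> subgroup_nbhd G T K M"
proof
  note D = open_normal_subgroupD
  fix K' assume "K' \<in> subgroup_nbhd G T K (M \<inter> N)"
  then have K': "closed_subgroup K' G T" "K' <#> (M \<inter> N) = K <#> (M \<inter> N)" by (auto simp: subgroup_nbhd_def)
  have abs: "(M \<inter> N) <#> M = M"
  proof
    show "(M \<inter> N) <#> M \<subseteq> M" using D[OF assms(1)] by (intro set_mult_subgroup_subset) auto
    show "M \<subseteq> (M \<inter> N) <#> M"
      using D[OF open_normal_subgroup_Int[OF assms(1,2)]] D[OF assms(1)] by (intro set_mult_superset2) auto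
  qed
  have "X <#> (M \<inter> N) <#> M = X <#> M" if "X \<subseteq> carrier G" for X
    using that set_mult_assoc[of X "M \<inter> N" M] D(4)[OF assms(1)] abs by auto
  moreover have "K \<subseteq> carrier G" "K' \<subseteq> carrier G"
    using assms(3) K' subgroup.subset by (auto simp: closed_subgroup_def)
  ultimately have "K' <#> M = K <#> M" using K'(2) by metis
  then show "K' \<in> subgroup_nbhd G T K M" using K' by (simp add: subgroup_nbhd_def)
qed

lemma openin_subgroup_space_nbhd:
  assumes "openin (subgroup_space G T) V" "K \<in> V" and K: "closed_subgroup K G T"
  shows "\<exists>N. open_normal_subgroup N G T \<and> subgroup_nbhd G T K N \<subseteq> V"
proof -
  let ?B = "{subgroup_nbhd G T H N | H N. closed_subgroup H G T \<and> open_normal_subgroup N G T}"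
  have "generate_topology_on ?B V"
    using assms(1) by (simp add: subgroup_space_def openin_topology_generated_by_iff)
  then show ?thesis using assms(2)
  proof (induction rule: generate_topology_on.induct)
    case Empty
    then show ?case by simp
  next
    case (Int a b)
    then obtain M N where MN: "open_normal_subgroup M G T" "subgroup_nbhd G T K M \<subseteq> a"
        "open_normal_subgroup N G T" "subgroup_nbhd G T K N \<subseteq> b"
      by blast
    show ?case
      using subgroup_nbhd_Int_subset[OF MN(1,3) K] subgroup_nbhd_Int_subset[OF MN(3,1) K] MN
        open_normal_subgroup_Int[OF MN(1,3)] by (metis Int_commute Int_greatest order_trans)
  next
    case (UN k)
    then show ?case by blast
  next
    case (Basis s)
    then obtain H N where "s = subgroup_nbhd G T H N" "open_normal_subgroup N G T" by auto
    then show ?case using \<open>K \<in> s\<close> by (intro exI[of _ N]) (auto simp: subgroup_nbhd_def)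
  qed
qed

text \<open>
  The sets \<open>subgroup_nbhd G T H N\<close> with \<open>N\<close> open normal form a neighbourhood base at \<open>H\<close>.
\<close>

lemma isolated_subgroup_iff:
  "isolated_subgroup H G T \<longleftrightarrow> closed_subgroup H G T \<and>
    (\<exists>N. open_normal_subgroup N G T \<and> (\<forall>K. closed_subgroup K G T \<and> K <#> N = H <#> N \<longrightarrow> K = H))"
proof (cases "closed_subgroup H G T")
  case H: True
  show ?thesis
  proof
    assume "isolated_subgroup H G T"
    then have "openin (subgroup_space G T) {H}" by (simp add: isolated_subgroup_def isolated_point_def)
    then obtain N where "open_normal_subgroup N G T" "subgroup_nbhd G T H N \<subseteq> {H}"
      using openin_subgroup_space_nbhd[OF _ _ H] by blast
    then show "closed_subgroup H G T \<and>
      (\<exists>N. open_normal_subgroup N G T \<and> (\<forall>K. closed_subgroup K G T \<and> K <#> N = H <#> N \<longrightarrow> K = H))"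
      using H by (auto simp: subgroup_nbhd_def)
  next
    assume "closed_subgroup H G T \<and>
      (\<exists>N. open_normal_subgroup N G T \<and> (\<forall>K. closed_subgroup K G T \<and> K <#> N = H <#> N \<longrightarrow> K = H))"
    then obtain N where N: "open_normal_subgroup N G T"
        "\<And>K. closed_subgroup K G T \<Longrightarrow> K <#> N = H <#> N \<Longrightarrow> K = H"
      by blast
    then have "{H} = subgroup_nbhd G T H N" using H by (auto simp: subgroup_nbhd_def)
    moreover have "openin (subgroup_space G T) (subgroup_nbhd G T H N)"
      unfolding subgroup_space_def using H N by (intro topology_generated_by_Basis) blast
    ultimately have op: "openin (subgroup_space G T) {H}" by simp
    then have "H \<in> topspace (subgroup_space G T)" using openin_subset by blast
    then show "isolated_subgroup H G T"
      using op H by (simp add: isolated_subgroup_def isolated_point_def)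
  qed
qed (simp add: isolated_subgroup_def)

lemma topspace_subgroup_space: "H \<in> topspace (subgroup_space G T) \<Longrightarrow> closed_subgroup H G T"
  by (auto simp: subgroup_space_def topology_generated_by_topspace subgroup_nbhd_def)

text \<open>
  \<open>H N\<close> is a closed subgroup in the neighbourhood of \<open>H\<close> given by \<open>N\<close>, so it equals \<open>H\<close>.
\<close>

lemma isolated_imp_open:
  assumes "isolated_subgroup H G T"
  shows "open_subgroup H G T"
proof -
  obtain N where N: "open_normal_subgroup N G T"
      "\<And>K. closed_subgroup K G T \<Longrightarrow> K <#> N = H <#> N \<Longrightarrow> K = H" and H: "subgroup H G"
    using assms by (auto simp: isolated_subgroup_iff closed_subgroup_def)
  note D = open_normal_subgroupD[OF N(1)]
  have op: "open_subgroup (H <#> N) G T" using open_subgroup_set_mult[OF H N(1)] .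
  have "(H <#> N) <#> N = H <#> N"
    using set_mult_assoc[OF subgroup.subset[OF H] D(4,4)] subgroup_mult_id[OF D(2)] by simp
  then have "H <#> N = H" using N(2) open_imp_closed_subgroup[OF op] by blast
  then show ?thesis using op by simp
qed

lemma perfect_iff_no_isolated_open:
  "\<not> perfect_space (subgroup_space G T) \<longleftrightarrow> (\<exists>H. open_subgroup H G T \<and> isolated_subgroup H G T)"
  unfolding perfect_space_def using isolated_imp_open topspace_subgroup_space
  by (metis isolated_point_def isolated_subgroup_def)

section \<open>The Frattini subgroup\<close>

lemma open_subgroup_restrict_iff:
  assumes "open_subgroup U G T"
  shows "open_subgroup K (G\<lparr>carrier := U\<rparr>) (subtopology T U) \<longleftrightarrow> open_subgroup K G T \<and> K \<subseteq> U"
  using assms subgroup_restrict_iff[of U K]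
  by (auto simp: open_subgroup_def openin_open_subtopology)

lemma maximal_open_subgroup_restrict_iff:
  assumes "open_subgroup U G T"
  shows "maximal_open_subgroup M (G\<lparr>carrier := U\<rparr>) (subtopology T U) \<longleftrightarrow>
    open_subgroup M G T \<and> M \<subseteq> U \<and> M \<noteq> U \<and>
    (\<forall>K. open_subgroup K G T \<and> K \<subseteq> U \<and> M \<subseteq> K \<longrightarrow> K = M \<or> K = U)"
  unfolding maximal_open_subgroup_def open_subgroup_restrict_iff[OF assms] by auto

text \<open>
  A point outside \<open>K\<close> stays outside \<open>K N\<close> for a small open normal \<open>N\<close>. The open subgroup \<open>K N\<close> has
  finite index, so only finitely many subgroups contain it, and a maximal proper one exists.
\<close>

lemma maximal_open_subgroup_exists:
  assumes K: "closed_subgroup K G T" and ne: "K \<noteq> carrier G"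
  obtains M where "maximal_open_subgroup M G T" "K \<subseteq> M"
proof -
  have Ks: "subgroup K G" "closedin T K" "K \<subseteq> carrier G"
    using K subgroup.subset by (auto simp: closed_subgroup_def)
  obtain x where x: "x \<in> carrier G" "x \<notin> K" using ne Ks by blast
  have "openin T (carrier G - K)" using Ks(2) topspace_eq by (metis closedin_def)
  then obtain N where N: "open_normal_subgroup N G T" "N #> x \<subseteq> carrier G - K"
    using x openin_iff by blast
  interpret N: normal N G using open_normal_subgroupD(1)[OF N(1)] .
  define U where "U = K <#> N"
  have U: "open_subgroup U G T" unfolding U_def using open_subgroup_set_mult[OF Ks(1) N(1)] .
  then have Us: "subgroup U G" by (simp add: open_subgroup_def)
  have "x \<notin> U"
  proof
    assume "x \<in> U"
    then obtain k n where kn: "k \<in> K" "n \<in> N" "x = k \<otimes> n" by (auto simp: U_def mem_set_mult)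
    have c: "k \<in> carrier G" "n \<in> carrier G" using kn Ks N.subset by auto
    have "k = (x \<otimes> inv n \<otimes> inv x) \<otimes> x" using kn(3) c by (simp add: m_assoc)
    moreover have "x \<otimes> inv n \<otimes> inv x \<in> N" using x kn by (intro N.inv_op_closed2 N.m_inv_closed)
    ultimately have "k \<in> N #> x" unfolding mem_r_coset by blast
    then show False using N(2) kn by blast
  qed
  let ?S = "{W. open_subgroup W G T \<and> U \<subseteq> W \<and> W \<noteq> carrier G}"
  have "finite ?S"
  proof (rule finite_subset)
    show "finite (Union ` Pow (rcosets U))" using finite_rcosets[OF U] by simp
    show "?S \<subseteq> Union ` Pow (rcosets U)"
    proof
      fix W assume W: "W \<in> ?S"
      then have Ws: "subgroup W G" by (simp add: open_subgroup_def)
      have "W = \<Union>((\<lambda>w. U #> w) ` W)"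
      proof
        show "W \<subseteq> \<Union>((\<lambda>w. U #> w) ` W)"
          using rcos_self[OF _ Us] subgroup.subset[OF Ws] by blast
        show "\<Union>((\<lambda>w. U #> w) ` W) \<subseteq> W"
          using W subgroup.m_closed[OF Ws] by (auto simp: r_coset_def)
      qed
      moreover have "(\<lambda>w. U #> w) ` W \<subseteq> rcosets U"
        using subgroup.subset[OF Ws] by (auto simp: RCOSETS_def)
      ultimately show "W \<in> Union ` Pow (rcosets U)" by blast
    qed
  qed
  moreover have "U \<in> ?S" using U \<open>x \<notin> U\<close> x by auto
  ultimately have "\<exists>M\<in>?S. U \<subseteq> M \<and> (\<forall>W\<in>?S. M \<subseteq> W \<longrightarrow> M = W)"
    by (rule finite_has_maximal2)
  then obtain M where M: "M \<in> ?S" "U \<subseteq> M" and Mmax: "\<forall>W\<in>?S. M \<subseteq> W \<longrightarrow> M = W"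
    by (elim bexE conjE) (rule that)
  have "maximal_open_subgroup M G T"
    unfolding maximal_open_subgroup_def
  proof (intro conjI allI impI)
    show "open_subgroup M G T" "M \<noteq> carrier G" using M by auto
    fix W assume W: "open_subgroup W G T \<and> M \<subseteq> W"
    show "W = M \<or> W = carrier G"
    proof (rule ccontr)
      assume "\<not> ?thesis"
      then show False using W M(2) Mmax by auto
    qed
  qed
  moreover have "K \<subseteq> M" using M(2) set_mult_superset1[OF Ks(3) N.subgroup_axioms] by (auto simp: U_def)
  ultimately show thesis using that by blast
qed

lemma frattini_nonsupplemented:
  assumes K: "closed_subgroup K G T" and KF: "K <#> frattini G T = carrier G"
  shows "K = carrier G"
proof (rule ccontr)
  assume "K \<noteq> carrier G"
  then obtain M where M: "maximal_open_subgroup M G T" "K \<subseteq> M" by (rule maximal_open_subgroup_exists[OF K])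
  then have Ms: "subgroup M G" "M \<noteq> carrier G" by (auto simp: maximal_open_subgroup_def open_subgroup_def)
  have "frattini G T \<subseteq> M" using M by (auto simp: frattini_def)
  then have "K <#> frattini G T \<subseteq> M" using set_mult_subgroup_subset[OF Ms(1) M(2)] by simp
  then show False using KF Ms subgroup.subset by blast
qed

lemma nonsupplemented_subset_frattini:
  assumes N: "open_normal_subgroup N G T"
    and supp: "\<And>K. open_subgroup K G T \<Longrightarrow> K <#> N = carrier G \<Longrightarrow> K = carrier G"
  shows "N \<subseteq> frattini G T"
proof -
  have "N \<subseteq> M" if M: "maximal_open_subgroup M G T" for M
  proof -
    have Mo: "open_subgroup M G T" "subgroup M G" "M \<noteq> carrier G"
      using M by (auto simp: maximal_open_subgroup_def open_subgroup_def)
    have "open_subgroup (M <#> N) G T" using open_subgroup_set_mult Mo N by blast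
    moreover have "M \<subseteq> M <#> N"
      using set_mult_superset1[OF subgroup.subset[OF Mo(2)] open_normal_subgroupD(2)[OF N]] .
    ultimately have "M <#> N = M \<or> M <#> N = carrier G"
      using M by (auto simp: maximal_open_subgroup_def)
    then have "M <#> N = M" using supp Mo by blast
    then show ?thesis using set_mult_superset2[OF Mo(2) open_normal_subgroupD(4)[OF N]] by simp
  qed
  then show ?thesis using open_normal_subgroupD(4)[OF N] by (auto simp: frattini_def)
qed

text \<open>
  Conjugation by elements of \<open>G\<close> permutes the maximal open subgroups of \<open>U\<close>.
\<close>

lemma frattini_restrict_normal:
  assumes U: "open_normal_subgroup U G T"
  shows "frattini (G\<lparr>carrier := U\<rparr>) (subtopology T U) \<lhd> G"
proof -
  interpret U: normal U G using open_normal_subgroupD(1)[OF U] .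
  have Uo: "open_subgroup U G T" using open_normal_subgroupD(5)[OF U] .
  define \<M> where "\<M> = {M. maximal_open_subgroup M (G\<lparr>carrier := U\<rparr>) (subtopology T U)}"
  define c where "c g M = (\<lambda>y. g \<otimes> y \<otimes> inv g) ` M" for g M
  have Fr: "frattini (G\<lparr>carrier := U\<rparr>) (subtopology T U) = U \<inter> \<Inter>\<M>"
    by (simp add: frattini_def \<M>_def)
  have \<M>: "M \<in> \<M> \<longleftrightarrow> open_subgroup M G T \<and> M \<subseteq> U \<and> M \<noteq> U \<and>
    (\<forall>K. open_subgroup K G T \<and> K \<subseteq> U \<and> M \<subseteq> K \<longrightarrow> K = M \<or> K = U)" for M
    unfolding \<M>_def using maximal_open_subgroup_restrict_iff[OF Uo] by simp
  have sub: "subgroup M G" if "M \<in> \<M>" for M using that \<M> by (auto simp: open_subgroup_def)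
  have c_open: "open_subgroup (c g M) G T" if g: "g \<in> carrier G" and M: "open_subgroup M G T" for g M
  proof -
    obtain N where N: "open_normal_subgroup N G T" "N \<subseteq> M" by (rule open_subgroup_contains_open_normal[OF M])
    have "subgroup M G" using M by (simp add: open_subgroup_def)
    then have "subgroup (c g M) G"
      unfolding c_def by (rule group_hom.subgroup_img_is_subgroup[OF conjugation_group_hom[OF g]])
    moreover have "N \<subseteq> c g M"
    proof
      fix n assume n: "n \<in> N"
      then have "inv g \<otimes> n \<otimes> g \<in> M"
        using N normal.inv_op_closed1[OF open_normal_subgroupD(1)[OF N(1)] g n] by blast
      moreover have "n = g \<otimes> (inv g \<otimes> n \<otimes> g) \<otimes> inv g"
        using n g open_normal_subgroupD(4)[OF N(1)] by (simp add: m_assoc subset_iff)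
      ultimately show "n \<in> c g M" unfolding c_def by (rule rev_image_eqI)
    qed
    ultimately show ?thesis by (rule open_subgroup_if_contains_open_normal[OF _ N(1)])
  qed
  have c_inv: "c (inv g) (c g M) = M" if "g \<in> carrier G" "M \<subseteq> carrier G" for g M
  proof -
    have "inv g \<otimes> (g \<otimes> y \<otimes> inv g) \<otimes> inv (inv g) = y" if "y \<in> M" for y
      using that \<open>g \<in> carrier G\<close> \<open>M \<subseteq> carrier G\<close> by (auto simp: m_assoc)
    then show ?thesis by (auto simp: c_def image_image)
  qed
  have c_U: "c g M \<subseteq> U" if "g \<in> carrier G" "M \<subseteq> U" for g M
    using that U.inv_op_closed2 by (auto simp: c_def)
  have c_mono: "c g M \<subseteq> c g K" if "M \<subseteq> K" for g M K using that by (auto simp: c_def)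
  have c_max: "c g M \<in> \<M>" if g: "g \<in> carrier G" and M: "M \<in> \<M>" for g M
  proof -
    have Mc: "M \<subseteq> U" "open_subgroup M G T" "M \<noteq> U"
      and Mmax: "\<And>K. open_subgroup K G T \<Longrightarrow> K \<subseteq> U \<Longrightarrow> M \<subseteq> K \<Longrightarrow> K = M \<or> K = U"
      using M \<M> by auto
    have MG: "M \<subseteq> carrier G" using Mc U.subset by blast
    have ig: "inv g \<in> carrier G" using g by simp
    have c_full: "c h U = U" if "h \<in> carrier G" for h
      using c_U[OF that subset_refl] c_mono[OF c_U[OF inv_closed[OF that] subset_refl], of h]
        c_inv[of "inv h" U] that U.subset by auto
    have max: "K = c g M \<or> K = U" if K: "open_subgroup K G T" "K \<subseteq> U" "c g M \<subseteq> K" for K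
    proof -
      have "c (inv g) K = M \<or> c (inv g) K = U"
        using c_mono[OF K(3), of "inv g"] c_inv[OF g MG] Mmax[OF c_open[OF ig K(1)] c_U[OF ig K(2)]] by simp
      moreover have "K = c g (c (inv g) K)" using c_inv[OF ig, of K] g K(2) U.subset by auto
      ultimately show ?thesis using c_full[OF g] by auto
    qed
    have "c g M \<noteq> U"
    proof
      assume "c g M = U"
      then have "M = c (inv g) U" using c_inv[OF g MG] by simp
      then show False using c_full[OF ig] Mc by simp
    qed
    then show ?thesis unfolding \<M> using c_open[OF g Mc(2)] c_U[OF g Mc(1)] max by blast
  qed
  have "subgroup (\<Inter>(insert U \<M>)) G"
    using sub U.subgroup_axioms by (intro subgroups_Inter) auto
  then have "subgroup (U \<inter> \<Inter>\<M>) G" by simp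
  moreover have "g \<otimes> y \<otimes> inv g \<in> U \<inter> \<Inter>\<M>" if g: "g \<in> carrier G" and y: "y \<in> U \<inter> \<Inter>\<M>" for g y
  proof -
    have yc: "y \<in> carrier G" using y U.subset by auto
    have "g \<otimes> y \<otimes> inv g \<in> M" if M: "M \<in> \<M>" for M
    proof -
      have "y \<in> c (inv g) M" using y c_max[OF inv_closed[OF g] M] by auto
      then obtain z where z: "z \<in> M" "y = inv g \<otimes> z \<otimes> inv (inv g)" by (auto simp: c_def)
      have "z \<in> carrier G" using z subgroup.subset[OF sub[OF M]] by auto
      then have "g \<otimes> y \<otimes> inv g = z" using z g by (simp add: m_assoc)
      then show ?thesis using z by simp
    qed
    then show ?thesis using y g U.inv_op_closed2 by auto
  qed
  ultimately show ?thesis unfolding Fr using normal_invI by blast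
qed

lemma frattini_normal: "frattini G T \<lhd> G"
proof -
  have "subtopology T (carrier G) = T" using topspace_eq by (metis subtopology_topspace)
  then show ?thesis using frattini_restrict_normal[OF open_normal_subgroup_carrier] by simp
qed

lemma isolated_carrier_iff_frattini_open:
  "isolated_subgroup (carrier G) G T \<longleftrightarrow> open_normal_subgroup (frattini G T) G T"
proof
  assume "isolated_subgroup (carrier G) G T"
  then obtain N where N: "open_normal_subgroup N G T"
      "\<And>K. closed_subgroup K G T \<Longrightarrow> K <#> N = carrier G <#> N \<Longrightarrow> K = carrier G"
    by (auto simp: isolated_subgroup_iff)
  then have "N \<subseteq> frattini G T"
    using set_mult_carrier_idem[OF open_normal_subgroupD(2)[OF N(1)]] open_imp_closed_subgroup
    by (intro nonsupplemented_subset_frattini) auto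
  then have "open_subgroup (frattini G T) G T"
    using open_subgroup_if_contains_open_normal[OF normal_imp_subgroup[OF frattini_normal] N(1)] by simp
  then show "open_normal_subgroup (frattini G T) G T"
    using frattini_normal by (simp add: open_normal_subgroup_def open_subgroup_def)
next
  assume F: "open_normal_subgroup (frattini G T) G T"
  moreover have "closed_subgroup (carrier G) G T"
    using open_imp_closed_subgroup open_normal_subgroupD(5)[OF open_normal_subgroup_carrier] by blast
  moreover have "K = carrier G"
    if "closed_subgroup K G T \<and> K <#> frattini G T = carrier G <#> frattini G T" for K
    using that frattini_nonsupplemented[of K] set_mult_carrier_idem[OF open_normal_subgroupD(2)[OF F]] by simp
  ultimately show "isolated_subgroup (carrier G) G T"
    unfolding isolated_subgroup_iff by (intro conjI exI[of _ "frattini G T"] allI impI)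
qed

section \<open>Finitely many open subgroups and prime divisors of the order\<close>

text \<open>
  Number the cosets of each open subgroup \<open>H\<close> of index \<open>n\<close> so that \<open>H\<close> itself gets the number \<open>0\<close>.
  Each \<open>H\<close> then yields an action of the finitely many generators and their inverses on
  \<open>{..<n}\<close>. This action determines the number of the coset \<open>H g\<close> for every \<open>g\<close> in the dense subgroup
  that they generate, hence determines which \<open>g\<close> of it lie in \<open>H\<close>, and \<open>H\<close> is determined by these since it is
  open and closed. There are only finitely many such actions.
\<close>

lemma finite_open_subgroups_of_index:
  assumes fg: "topologically_finitely_generated G T"
  shows "finite {H. open_subgroup H G T \<and> card (rcosets H) = n}"
proof -
  obtain S where S: "finite S" "S \<subseteq> carrier G" "T closure_of (generate G S) = carrier G"
    using fg by (auto simp: topologically_finitely_generated_def)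
  \<comment> \<open>with inverses added, \<open>F H\<close> below also governs the steps of the induction over \<open>generate\<close> that
    invert a generator\<close>
  define S' where "S' = S \<union> (\<lambda>s. inv s) ` S"
  let ?\<H> = "{H. open_subgroup H G T \<and> card (rcosets H) = n}"
  have "\<exists>b. bij_betw b (rcosets H) {..<n} \<and> b H = 0" if H: "H \<in> ?\<H>" for H
  proof -
    have HR: "H \<in> rcosets H"
      using H subgroup.subgroup_in_rcosets[OF _ is_group] by (auto simp: open_subgroup_def)
    obtain b where b: "bij_betw b (rcosets H) {..<n}"
      using H finite_rcosets[of H] ex_bij_betw_finite_nat[of "rcosets H"] by (auto simp: atLeast0LessThan)
    have n: "b H < n" "0 < n" using b HR bij_betwE by fastforce+
    have "bij_betw (Transposition.transpose (b H) 0) {..<n} {..<n}"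
      using n by (intro bij_betw_byWitness[where f' = "Transposition.transpose (b H) 0"])
        (auto simp: Transposition.transpose_def)
    then have "bij_betw (Transposition.transpose (b H) 0 \<circ> b) (rcosets H) {..<n}"
      using b bij_betw_trans by blast
    then show ?thesis by (intro exI[of _ "Transposition.transpose (b H) 0 \<circ> b"]) simp
  qed
  note ex = this
  define b where "b H = (SOME f. bij_betw f (rcosets H) {..<n} \<and> f H = 0)" for H
  have b: "bij_betw (b H) (rcosets H) {..<n}" "b H H = 0" if "H \<in> ?\<H>" for H
    using someI_ex[OF ex[OF that]] unfolding b_def by (rule conjunct1, rule conjunct2)
  define F where "F H = (\<lambda>s\<in>S'. \<lambda>i\<in>{..<n}. b H (inv_into (rcosets H) (b H) i #> s))" for H
  define e where "e H g = b H (H #> g)" for H g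
  have S'c: "S' \<subseteq> carrier G" using S by (auto simp: S'_def)
  have e: "e H g < n" if "H \<in> ?\<H>" "g \<in> carrier G" for H g
    using that b(1)[OF that(1)] bij_betwE by (fastforce simp: e_def RCOSETS_def)
  have step: "e H (g \<otimes> s) = F H s (e H g)" if H: "H \<in> ?\<H>" and g: "g \<in> carrier G" and s: "s \<in> S'" for H g s
  proof -
    have Hc: "H \<subseteq> carrier G" using H subgroup.subset by (auto simp: open_subgroup_def)
    have "H #> g \<in> rcosets H" using g by (auto simp: RCOSETS_def)
    then have "inv_into (rcosets H) (b H) (e H g) = H #> g"
      unfolding e_def using b(1)[OF H] by (simp add: bij_betw_def)
    then show ?thesis
      using e[OF H g] s g S'c Hc by (auto simp: F_def e_def[of H "g \<otimes> s"] coset_mult_assoc subset_iff)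
  qed
  have "inj_on F ?\<H>"
  proof (rule inj_onI)
    fix H H' assume H: "H \<in> ?\<H>" "H' \<in> ?\<H>" and eq: "F H = F H'"
    have sub: "subgroup H G" "subgroup H' G" and op: "openin T H" "openin T H'"
      using H by (auto simp: open_subgroup_def)
    have gen: "h \<in> carrier G \<and> (\<forall>g\<in>carrier G. e H g = e H' g \<longrightarrow> e H (g \<otimes> h) = e H' (g \<otimes> h))"
      if "h \<in> generate G S" for h
      using that
    proof (induction rule: generate.induct)
      case one
      then show ?case by simp
    next
      case (incl h)
      then have "h \<in> S'" by (simp add: S'_def)
      then show ?case using step H eq S'c by auto
    next
      case (inv h)
      then have "inv h \<in> S'" by (simp add: S'_def)
      then show ?case using step H eq S'c by auto
    next
      case (eng h1 h2)
      then show ?case by (simp add: m_assoc[symmetric])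
    qed
    have e0: "e K g = 0 \<longleftrightarrow> g \<in> K" if K: "K \<in> ?\<H>" and g: "g \<in> carrier G" for K g
    proof -
      have Ks: "subgroup K G" using K by (auto simp: open_subgroup_def)
      have "K \<in> rcosets K" using subgroup.subgroup_in_rcosets[OF Ks is_group] .
      moreover have "K #> g \<in> rcosets K" using g by (auto simp: RCOSETS_def)
      ultimately have "e K g = 0 \<longleftrightarrow> K #> g = K"
        unfolding e_def using b(1)[OF K] b(2)[OF K] by (metis bij_betw_imp_inj_on inj_on_eq_iff)
      then show ?thesis using coset_join1[OF _ g Ks] coset_join2[OF g Ks] by blast
    qed
    have agree: "h \<in> H \<longleftrightarrow> h \<in> H'" if h: "h \<in> generate G S" for h
    proof -
      have "e H \<one> = e H' \<one>"
        using e0[OF H(1), of \<one>] e0[OF H(2), of \<one>] sub subgroup.one_closed by auto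
      then have "e H h = e H' h" using gen[OF h] by force
      then show ?thesis using e0[OF H(1)] e0[OF H(2)] gen[OF h] by metis
    qed
    \<comment> \<open>the difference of an open and a closed set is open, so if nonempty it meets the dense subgroup\<close>
    have half: "A \<subseteq> B" if A: "openin T A" "subgroup A G" and B: "open_subgroup B G T"
      and AB: "\<And>h. h \<in> generate G S \<Longrightarrow> h \<in> A \<Longrightarrow> h \<in> B" for A B
    proof
      fix x assume x: "x \<in> A"
      show "x \<in> B"
      proof (rule ccontr)
        assume "x \<notin> B"
        have "openin T (A - B)" using A(1) open_subgroup_closedin[OF B] by (rule openin_diff)
        moreover have "x \<in> T closure_of (generate G S)" using x S(3) subgroup.subset[OF A(2)] by auto
        ultimately obtain h where "h \<in> generate G S" "h \<in> A - B"
          using x \<open>x \<notin> B\<close> unfolding in_closure_of by blast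
        then show False using AB by blast
      qed
    qed
    have "open_subgroup H G T" "open_subgroup H' G T" using H by auto
    then show "H = H'"
      using half[OF op(1) sub(1), of H'] half[OF op(2) sub(2), of H] agree by simp
  qed
  moreover have "F ` ?\<H> \<subseteq> S' \<rightarrow>\<^sub>E {..<n} \<rightarrow>\<^sub>E {..<n}"
  proof -
    have less: "b H (inv_into (rcosets H) (b H) i #> s) < n" if H: "H \<in> ?\<H>" and s: "s \<in> S'" and i: "i < n" for H s i
    proof -
      have "inv_into (rcosets H) (b H) i \<in> rcosets H"
        using b(1)[OF H] i by (metis bij_betw_imp_surj_on inv_into_into lessThan_iff)
      then obtain g where g: "g \<in> carrier G" "inv_into (rcosets H) (b H) i = H #> g" by (auto simp: RCOSETS_def)
      have "H \<subseteq> carrier G" using H subgroup.subset by (auto simp: open_subgroup_def)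
      then show ?thesis using e[OF H, of "g \<otimes> s"] g s S'c by (auto simp: e_def coset_mult_assoc subset_iff)
    qed
    show ?thesis
    proof (rule image_subsetI)
      fix H assume H: "H \<in> ?\<H>"
      show "F H \<in> S' \<rightarrow>\<^sub>E {..<n} \<rightarrow>\<^sub>E {..<n}"
        unfolding F_def restrict_PiE_iff using less[OF H] by blast
    qed
  qed
  moreover have "finite (S' \<rightarrow>\<^sub>E {..<n} \<rightarrow>\<^sub>E {..<n})"
    using S(1) by (intro finite_PiE) (auto simp: S'_def intro: finite_PiE)
  ultimately show ?thesis using finite_imageD finite_subset by blast
qed

lemma prime_divides_order_iff:
  assumes p: "Factorial_Ring.prime p"
  shows "prime_divides_order p G T \<longleftrightarrow> (\<exists>N. open_normal_subgroup N G T \<and> p dvd card (rcosets N))"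
proof -
  have "multiplicity p (card (rcosets N)) > 0 \<longleftrightarrow> p dvd card (rcosets N)" if "open_normal_subgroup N G T" for N
    using card_rcosets_pos[OF open_normal_subgroupD(5)[OF that]] p by (simp add: prime_multiplicity_gt_zero_iff)
  then show ?thesis
    using p unfolding prime_divides_order_def profinite_order_def
    by (auto simp: less_SUP_iff zero_enat_def)
qed

section \<open>The two main implications\<close>

text \<open>
  The normalizer condition: let \<open>n\<close> be least such that the \<open>n\<close>-th term of the lower central series
  lies in \<open>M\<close>. An element \<open>x\<close> of the preceding term outside \<open>M\<close> normalizes \<open>M\<close>, so the normalizer
  of \<open>M\<close> is larger than \<open>M\<close> and must be \<open>G\<close>.
\<close>

lemma maximal_open_normal_if_lower_central:
  assumes lc: "\<And>N. open_normal_subgroup N G T \<Longrightarrow> \<exists>n. lower_central G n \<subseteq> N"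
    and M: "maximal_open_subgroup M G T"
  shows "M \<lhd> G"
proof -
  have Mo: "open_subgroup M G T" and ne: "M \<noteq> carrier G"
    using M by (auto simp: maximal_open_subgroup_def)
  then have Ms: "subgroup M G" by (simp add: open_subgroup_def)
  have Mc: "M \<subseteq> carrier G" using Ms by (rule subgroup.subset)
  obtain N where N: "open_normal_subgroup N G T" "N \<subseteq> M" by (rule open_subgroup_contains_open_normal[OF Mo])
  then have "\<exists>n. lower_central G n \<subseteq> M" using lc by blast
  define n where "n = (LEAST n. lower_central G n \<subseteq> M)"
  have n: "lower_central G n \<subseteq> M" unfolding n_def using \<open>\<exists>n. _\<close> by (rule LeastI_ex)
  have "n \<noteq> 0"
  proof
    assume "n = 0"
    then show False using n Mc ne by simp
  qed
  then obtain k where k: "n = Suc k" using not0_implies_Suc by blast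
  have "\<not> lower_central G k \<subseteq> M" using k not_less_Least[of k "\<lambda>n. lower_central G n \<subseteq> M"] by (simp add: n_def)
  then obtain x where x: "x \<in> lower_central G k" "x \<notin> M" by blast
  have lk: "subgroup (lower_central G k) G" by (rule lower_central_subgroup)
  have xc: "x \<in> carrier G" using x subgroup.subset[OF lk] by blast
  define W where "W = {g \<in> carrier G. \<forall>m\<in>M. g \<otimes> m \<otimes> inv g \<in> M \<and> inv g \<otimes> m \<otimes> g \<in> M}"
  have conj: "y \<otimes> m \<otimes> inv y \<in> M" if y: "y \<in> lower_central G k" and m: "m \<in> M" for y m
  proof -
    have yc: "y \<in> carrier G" using y subgroup.subset[OF lk] by blast
    have mc: "m \<in> carrier G" using m Mc by auto
    have "y \<otimes> m \<otimes> inv y \<otimes> inv m \<in> M"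
      using lower_central_commutator[OF y mc] n k by blast
    then have "(y \<otimes> m \<otimes> inv y \<otimes> inv m) \<otimes> m \<in> M" using m by (rule subgroup.m_closed[OF Ms])
    then show ?thesis using yc mc by (simp add: m_assoc)
  qed
  have "subgroup W G"
  proof (rule subgroupI)
    show "W \<subseteq> carrier G" by (auto simp: W_def)
    have "\<one> \<in> W" using Mc by (auto simp: W_def)
    then show "W \<noteq> {}" by blast
    show "inv g \<in> W" if "g \<in> W" for g using that by (simp add: W_def)
    show "g \<otimes> h \<in> W" if g: "g \<in> W" and h: "h \<in> W" for g h
    proof -
      have c: "g \<in> carrier G" "h \<in> carrier G" using g h by (auto simp: W_def)
      have "(g \<otimes> h) \<otimes> m \<otimes> inv (g \<otimes> h) \<in> M \<and> inv (g \<otimes> h) \<otimes> m \<otimes> (g \<otimes> h) \<in> M" if m: "m \<in> M" for m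
      proof -
        have "m \<in> carrier G" using m Mc by auto
        moreover have "g \<otimes> (h \<otimes> m \<otimes> inv h) \<otimes> inv g \<in> M" "inv h \<otimes> (inv g \<otimes> m \<otimes> g) \<otimes> h \<in> M"
          using g h m by (auto simp: W_def)
        ultimately show ?thesis using c by (simp add: m_assoc inv_mult_group)
      qed
      then show ?thesis using c by (simp add: W_def)
    qed
  qed
  moreover have MW: "M \<subseteq> W"
  proof
    fix g assume g: "g \<in> M"
    then have "g \<in> carrier G" "inv g \<in> M" using Mc subgroup.m_inv_closed[OF Ms] by auto
    then show "g \<in> W" using g by (auto simp: W_def intro!: subgroup.m_closed[OF Ms])
  qed
  ultimately have "open_subgroup W G T"
    using N(2) by (intro open_subgroup_if_contains_open_normal[OF _ N(1)]) auto
  moreover have "x \<in> W"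
    using conj[OF x(1)] conj[OF subgroup.m_inv_closed[OF lk x(1)]] xc by (simp add: W_def)
  ultimately have "W = carrier G" using M MW x(2) by (auto simp: maximal_open_subgroup_def)
  then show ?thesis by (intro normal_invI Ms) (auto simp: W_def)
qed

text \<open>
  \<open>G/M\<close> has no subgroups besides the two trivial ones, so a subgroup of prime order is all of it.
\<close>

lemma normal_maximal_open_prime_index:
  assumes M: "maximal_open_subgroup M G T" and n: "M \<lhd> G"
  shows "Factorial_Ring.prime (card (rcosets M))"
proof -
  interpret M: normal M G by fact
  interpret Q: group "G Mod M" by (rule M.factorgroup_is_group)
  have Mo: "open_subgroup M G T" and ne: "M \<noteq> carrier G"
    using M by (auto simp: maximal_open_subgroup_def)
  have ord: "order (G Mod M) = card (rcosets M)" by (simp add: order_def FactGroup_def)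
  have fin: "finite (carrier (G Mod M))" using finite_rcosets[OF Mo] by (simp add: FactGroup_def)
  have MR: "M \<in> rcosets M" using M.subgroup_in_rcosets[OF is_group] .
  have "card (rcosets M) \<noteq> 1"
  proof
    assume "card (rcosets M) = 1"
    then have "rcosets M = {M}" using MR by (metis card_1_singletonE singletonD)
    then show False using rcosets_part_G[OF M.subgroup_axioms] ne by simp
  qed
  then obtain p where p: "Factorial_Ring.prime p" "p dvd card (rcosets M)"
    using prime_factor_nat by blast
  then obtain m where "order (G Mod M) = p ^ 1 * m" using ord by (auto simp: dvd_def)
  from sylow_thm[OF p(1) Q.is_group this fin]
  obtain X where X: "subgroup X (G Mod M)" "card X = p" by auto
  have U: "subgroup (\<Union>X) G" using M.factgroup_subgroup_union_subgroup[OF X(1)] .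
  have "M \<in> X" using subgroup.one_closed[OF X(1)] by simp
  then have MU: "M \<subseteq> \<Union>X" by blast
  obtain N where N: "open_normal_subgroup N G T" "N \<subseteq> M" by (rule open_subgroup_contains_open_normal[OF Mo])
  have "open_subgroup (\<Union>X) G T"
    using open_subgroup_if_contains_open_normal[OF U N(1)] N(2) MU by blast
  then have "\<Union>X = M \<or> \<Union>X = carrier G" using M MU by (auto simp: maximal_open_subgroup_def)
  moreover have XU: "X = (\<lambda>x. M #> x) ` (\<Union>X)"
    using M.factgroup_subgroup_union_factor[OF X(1)] by (simp add: rcosets_restrict)
  moreover have "\<Union>X \<noteq> M"
  proof
    assume "\<Union>X = M"
    then have "X = (\<lambda>x. M #> x) ` M" using XU by simp
    then have "X \<subseteq> {M}" using M.rcos_const[OF is_group] by auto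
    then have "X = {M}" using \<open>M \<in> X\<close> by blast
    then show False using X(2) p(1) by (simp add: prime_nat_iff)
  qed
  ultimately have "X = (\<lambda>x. M #> x) ` carrier G" by metis
  also have "\<dots> = rcosets M" by (auto simp: RCOSETS_def)
  finally show ?thesis using X(2) p(1) by simp
qed

text \<open>
  The isolating open normal subgroup is \<open>\<Phi>(U)\<close> for an open normal pronilpotent \<open>U \<le> H\<close>. Its openness
  is where all three hypotheses enter. Bounding the indices in \<open>G\<close> rather than in \<open>U\<close> avoids
  having to prove that \<open>U\<close> is finitely generated.
\<close>

lemma open_subgroup_isolated_if_virtually_pronilpotent:
  assumes fg: "topologically_finitely_generated G T" and vp: "virtually_pronilpotent G T"
    and fp: "finite {p. prime_divides_order p G T}" and H: "open_subgroup H G T"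
  shows "isolated_subgroup H G T"
proof -
  obtain U0 where U0: "open_subgroup U0 G T" "pronilpotent_group (G\<lparr>carrier := U0\<rparr>) (subtopology T U0)"
    using vp by (auto simp: virtually_pronilpotent_def)
  obtain M1 M2 where M12: "open_normal_subgroup M1 G T" "M1 \<subseteq> U0" "open_normal_subgroup M2 G T" "M2 \<subseteq> H"
    using open_subgroup_contains_open_normal[OF U0(1)] open_subgroup_contains_open_normal[OF H] by metis
  define U where "U = M1 \<inter> M2"
  have U: "open_normal_subgroup U G T" "U \<subseteq> U0" "U \<subseteq> H"
    using M12 open_normal_subgroup_Int by (auto simp: U_def)
  note UD = open_normal_subgroupD[OF U(1)]
  have Hs: "subgroup H G" and U0s: "subgroup U0 G" using H U0(1) by (auto simp: open_subgroup_def)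
  interpret U: profinite "G\<lparr>carrier := U\<rparr>" "subtopology T U" using UD(5) by (rule profinite_restrict)
  have lc: "\<exists>n. lower_central (G\<lparr>carrier := U\<rparr>) n \<subseteq> N"
    if N: "open_normal_subgroup N (G\<lparr>carrier := U\<rparr>) (subtopology T U)" for N
  proof -
    have "open_subgroup N G T" "N \<subseteq> U"
      using U.open_normal_subgroupD(5)[OF N] open_subgroup_restrict_iff[OF UD(5)] by auto
    then have "openin (subtopology T U0) N" "\<one> \<in> N"
      using U0(1) U(2) subgroup.one_closed[of N G] by (auto simp: openin_open_subtopology open_subgroup_def)
    then obtain n where "lower_central (G\<lparr>carrier := U0\<rparr>) n \<subseteq> N"
      using pronilpotent_lower_central[OF U0(2)] by auto
    then show ?thesis using lower_central_restrict_mono[OF UD(2) U0s U(2)] by blast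
  qed
  define \<M> where "\<M> = {M. maximal_open_subgroup M (G\<lparr>carrier := U\<rparr>) (subtopology T U)}"
  have \<M>_open: "open_subgroup M G T \<and> M \<subseteq> U" if "M \<in> \<M>" for M
    using that maximal_open_subgroup_restrict_iff[OF UD(5)] by (simp add: \<M>_def)
  have "\<M> \<subseteq> (\<Union>p\<in>{p. prime_divides_order p G T}. {M. open_subgroup M G T \<and> card (rcosets M) = p * card (rcosets U)})"
  proof
    fix M assume M: "M \<in> \<M>"
    then have Mm: "maximal_open_subgroup M (G\<lparr>carrier := U\<rparr>) (subtopology T U)" by (simp add: \<M>_def)
    have Mo: "open_subgroup M G T" "M \<subseteq> U" using \<M>_open M by auto
    then have Ms: "subgroup M G" by (simp add: open_subgroup_def)
    define p where "p = card (rcosets\<^bsub>G\<lparr>carrier := U\<rparr>\<^esub> M)"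
    have p: "Factorial_Ring.prime p" unfolding p_def
      using U.normal_maximal_open_prime_index[OF Mm U.maximal_open_normal_if_lower_central[OF lc Mm]] .
    have idx: "card (rcosets M) = p * card (rcosets U)"
      unfolding p_def using card_rcosets_tower[OF Ms UD(2) Mo(2)] .
    obtain N where N: "open_normal_subgroup N G T" "N \<subseteq> M" by (rule open_subgroup_contains_open_normal[OF Mo(1)])
    have "card (rcosets N) = card (rcosets\<^bsub>G\<lparr>carrier := M\<rparr>\<^esub> N) * (p * card (rcosets U))"
      using card_rcosets_tower[OF open_normal_subgroupD(2)[OF N(1)] Ms N(2)] idx by simp
    then have "p dvd card (rcosets N)" by simp
    then have "prime_divides_order p G T" using prime_divides_order_iff[OF p] N(1) by blast
    then show "M \<in> (\<Union>p\<in>{p. prime_divides_order p G T}. {M. open_subgroup M G T \<and> card (rcosets M) = p * card (rcosets U)})"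
      using idx Mo(1) by blast
  qed
  then have fin: "finite \<M>"
    using fp finite_open_subgroups_of_index[OF fg] by (meson finite_UN_I finite_subset)
  define N where "N = frattini (G\<lparr>carrier := U\<rparr>) (subtopology T U)"
  have Neq: "N = \<Inter>(insert U \<M>)" by (simp add: N_def frattini_def \<M>_def)
  have "openin T N"
    unfolding Neq using fin UD(3) \<M>_open by (intro openin_Inter) (auto simp: open_subgroup_def)
  then have N: "open_normal_subgroup N G T"
    using frattini_restrict_normal[OF U(1)] by (simp add: open_normal_subgroup_def N_def)
  have NU: "N \<subseteq> U" unfolding Neq by auto
  have HN: "H <#> N = H"
    using set_mult_subgroup_absorb[OF Hs open_normal_subgroupD(2)[OF N]] NU U(3) by blast
  have "K = H" if K: "closed_subgroup K G T \<and> K <#> N = H <#> N" for K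
  proof -
    have Ks: "subgroup K G" "closedin T K" and KN: "K <#> N = H" using K HN by (auto simp: closed_subgroup_def)
    have Kc: "K \<subseteq> carrier G" using Ks(1) by (rule subgroup.subset)
    have "(K \<inter> U) <#> N = U"
      using set_mult_Int_modular[OF UD(2) Kc NU] KN U(3) by auto
    moreover have "closed_subgroup (K \<inter> U) (G\<lparr>carrier := U\<rparr>) (subtopology T U)"
      using subgroups_Inter_pair[OF Ks(1) UD(2)] Ks(2) subgroup_restrict_iff[OF UD(2)]
      by (auto simp: closed_subgroup_def closedin_subtopology)
    ultimately have "K \<inter> U = U"
      using U.frattini_nonsupplemented[of "K \<inter> U"] by (simp add: N_def)
    then have "N \<subseteq> K" using NU by blast
    then show "K = H"
      using set_mult_subgroup_absorb[OF Ks(1) open_normal_subgroupD(2)[OF N]] KN by simp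
  qed
  then show ?thesis
    unfolding isolated_subgroup_iff using open_imp_closed_subgroup[OF H] N
    by (intro conjI exI[of _ N]) blast+
qed

text \<open>
  The finite group theory is applied to the quotient \<open>E = H/L\<close> and the image of \<open>N\<close> in it, and pulled
  back.
\<close>

lemma nonsupplemented_finite_quotient:
  assumes H: "open_subgroup H G T" and N: "open_normal_subgroup N G T" and NH: "N \<subseteq> H"
    and supp: "\<And>K. open_subgroup K G T \<Longrightarrow> K <#> N = H \<Longrightarrow> K = H"
    and L: "open_normal_subgroup L G T" and LN: "L \<subseteq> N"
  shows "\<exists>n. lower_central (G\<lparr>carrier := N\<rparr>) n \<subseteq> L"
    and "Factorial_Ring.prime p \<Longrightarrow> p dvd card (rcosets\<^bsub>G\<lparr>carrier := N\<rparr>\<^esub> L) \<Longrightarrow> p dvd card (rcosets N)"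
proof -
  note ND = open_normal_subgroupD[OF N] and LD = open_normal_subgroupD[OF L]
  have Hs: "subgroup H G" using H by (simp add: open_subgroup_def)
  interpret H: group "G\<lparr>carrier := H\<rparr>" using Hs by (rule subgroup_imp_group)
  have LH: "L \<subseteq> H" using LN NH by blast
  have LnH: "L \<lhd> G\<lparr>carrier := H\<rparr>" using normal_restrict_supergroup[OF Hs LD(1) LH] .
  have NnH: "N \<lhd> G\<lparr>carrier := H\<rparr>" using normal_restrict_supergroup[OF Hs ND(1) NH] .
  interpret L: normal L "G\<lparr>carrier := H\<rparr>" by (rule LnH)
  define E where "E = G\<lparr>carrier := H\<rparr> Mod L"
  define NE where "NE = rcosets\<^bsub>G\<lparr>carrier := N\<rparr>\<^esub> L"
  interpret E: group E unfolding E_def by (rule L.factorgroup_is_group)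
  have cE: "carrier E = (\<lambda>x. L #> x) ` H" by (auto simp: E_def carrier_FactGroup)
  have "carrier E \<subseteq> rcosets L"
    using subgroup.subset[OF Hs] by (auto simp: cE RCOSETS_def)
  then have finE: "finite (carrier E)" using finite_rcosets[OF LD(5)] finite_subset by blast
  have NE: "NE \<lhd> E"
    using H.normality_factorization[OF LnH LN NnH] by (simp add: NE_def E_def)
  have suppE: "K = carrier E" if K: "subgroup K E" "K <#>\<^bsub>E\<^esub> NE = carrier E" for K
    unfolding E_def
  proof (rule H.nonsupplemented_quotient[OF LnH normal_imp_subgroup[OF NnH] LN])
    show "subgroup K (G\<lparr>carrier := H\<rparr> Mod L)" using K by (simp add: E_def)
    show "K <#>\<^bsub>G\<lparr>carrier := H\<rparr> Mod L\<^esub> (rcosets\<^bsub>G\<lparr>carrier := H, carrier := N\<rparr>\<^esub> L) = carrier (G\<lparr>carrier := H\<rparr> Mod L)"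
      using K(2) by (simp add: E_def NE_def)
    fix K' assume K': "subgroup K' (G\<lparr>carrier := H\<rparr>)" "L \<subseteq> K'"
      "K' <#>\<^bsub>G\<lparr>carrier := H\<rparr>\<^esub> N = carrier (G\<lparr>carrier := H\<rparr>)"
    then have "subgroup K' G" using incl_subgroup[OF Hs] by blast
    then have "open_subgroup K' G T" using K'(2) by (rule open_subgroup_if_contains_open_normal[OF _ L])
    then show "K' = carrier (G\<lparr>carrier := H\<rparr>)" using supp K'(3) by simp
  qed
  interpret NE: group "E\<lparr>carrier := NE\<rparr>" using normal_imp_subgroup[OF NE] by (rule E.subgroup_imp_group)
  interpret N: group "G\<lparr>carrier := N\<rparr>" using ND(2) by (rule subgroup_imp_group)
  have NEeq: "NE = (\<lambda>x. L #> x) ` N" by (simp add: NE_def rcosets_restrict)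
  interpret \<pi>: group_hom "G\<lparr>carrier := N\<rparr>" "E\<lparr>carrier := NE\<rparr>" "\<lambda>x. L #> x"
  proof (unfold_locales, rule homI)
    show "L #> x \<in> carrier (E\<lparr>carrier := NE\<rparr>)" if "x \<in> carrier (G\<lparr>carrier := N\<rparr>)" for x
      using that by (simp add: NEeq)
    show "L #> (x \<otimes>\<^bsub>G\<lparr>carrier := N\<rparr>\<^esub> y) = (L #> x) \<otimes>\<^bsub>E\<lparr>carrier := NE\<rparr>\<^esub> (L #> y)"
      if "x \<in> carrier (G\<lparr>carrier := N\<rparr>)" "y \<in> carrier (G\<lparr>carrier := N\<rparr>)" for x y
      using that NH L.rcos_sum[of x y] by (auto simp: E_def)
  qed
  obtain n where "lower_central (E\<lparr>carrier := NE\<rparr>) n = {\<one>\<^bsub>E\<^esub>}"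
    using E.lower_central_trivial_of_nonsupplemented[OF finE NE suppE] by blast
  then have one: "L #> x = L" if "x \<in> lower_central (G\<lparr>carrier := N\<rparr>) n" for x
    using \<pi>.lower_central_image[of n] that by (auto simp: E_def)
  have "lower_central (G\<lparr>carrier := N\<rparr>) n \<subseteq> L"
  proof
    fix x assume x: "x \<in> lower_central (G\<lparr>carrier := N\<rparr>) n"
    have "x \<in> carrier G" using x subgroup.subset[OF N.lower_central_subgroup[of n]] ND(4) by auto
    then show "x \<in> L" using one[OF x] coset_join1[OF _ _ LD(2)] by blast
  qed
  then show "\<exists>n. lower_central (G\<lparr>carrier := N\<rparr>) n \<subseteq> L" by blast
  assume p: "Factorial_Ring.prime p" "p dvd card (rcosets\<^bsub>G\<lparr>carrier := N\<rparr>\<^esub> L)"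
  have "p dvd card (rcosets\<^bsub>E\<^esub> NE)"
    using E.prime_dvd_index_of_nonsupplemented[OF finE NE suppE p(1)] p(2) by (simp add: NE_def)
  moreover have "card (rcosets\<^bsub>E\<^esub> NE) = card (rcosets\<^bsub>G\<lparr>carrier := H\<rparr>\<^esub> N)"
  proof -
    have "card (rcosets\<^bsub>E\<^esub> NE) * card NE = card (rcosets\<^bsub>G\<lparr>carrier := H\<rparr>\<^esub> L)"
      using E.lagrange[OF normal_imp_subgroup[OF NE]] by (simp add: order_def E_def FactGroup_def)
    also have "\<dots> = card NE * card (rcosets\<^bsub>G\<lparr>carrier := H\<rparr>\<^esub> N)"
      using H.card_rcosets_tower[OF normal_imp_subgroup[OF LnH] normal_imp_subgroup[OF NnH] LN]
      by (simp add: NE_def)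
    also have "\<dots> = card (rcosets\<^bsub>G\<lparr>carrier := H\<rparr>\<^esub> N) * card NE" by (rule mult.commute)
    finally have eq: "card (rcosets\<^bsub>E\<^esub> NE) * card NE = card (rcosets\<^bsub>G\<lparr>carrier := H\<rparr>\<^esub> N) * card NE" .
    have "finite NE"
      using finE subgroup.subset[OF normal_imp_subgroup[OF NE]] finite_subset by blast
    then have "card NE \<noteq> 0" using subgroup.one_closed[OF normal_imp_subgroup[OF NE]] by auto
    with eq show ?thesis by simp
  qed
  moreover have "card (rcosets N) = card (rcosets\<^bsub>G\<lparr>carrier := H\<rparr>\<^esub> N) * card (rcosets H)"
    using card_rcosets_tower[OF ND(2) Hs NH] .
  ultimately show "p dvd card (rcosets N)" by simp
qed

text \<open>
  Let \<open>N \<le> H\<close> be an open normal subgroup without proper supplement in \<open>H\<close>. The subgroup \<open>D\<close> generated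
  by representatives of the cosets of \<open>N\<close> is dense: for open normal \<open>L\<close>, the open subgroup \<open>K = D L\<close>
  satisfies \<open>K N = G\<close>, so \<open>(K \<inter> H) N = H\<close> by the modular law, whence \<open>N \<le> K\<close> and \<open>K = G\<close>. The other
  two conditions hold with \<open>N\<close> as the pronilpotent subgroup and with the prime divisors of \<open>|G : N|\<close>.
\<close>

lemma virtually_pronilpotent_if_isolated_open:
  assumes H: "open_subgroup H G T" and iso: "isolated_subgroup H G T"
  shows "topologically_finitely_generated G T \<and> virtually_pronilpotent G T \<and>
    finite {p. prime_divides_order p G T}"
proof -
  have Hs: "subgroup H G" using H by (simp add: open_subgroup_def)
  have Hc: "closed_subgroup H G T" using open_imp_closed_subgroup[OF H] .
  obtain N1 where N1: "open_normal_subgroup N1 G T"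
      "\<And>K. closed_subgroup K G T \<Longrightarrow> K <#> N1 = H <#> N1 \<Longrightarrow> K = H"
    using iso by (auto simp: isolated_subgroup_iff)
  obtain N2 where N2: "open_normal_subgroup N2 G T" "N2 \<subseteq> H" by (rule open_subgroup_contains_open_normal[OF H])
  define N where "N = N1 \<inter> N2"
  have N: "open_normal_subgroup N G T" and NH: "N \<subseteq> H"
    using N1 N2 open_normal_subgroup_Int by (auto simp: N_def)
  note ND = open_normal_subgroupD[OF N]
  have HN: "H <#> N = H" using set_mult_subgroup_absorb[OF Hs ND(2) NH] .
  have supp: "K = H" if K: "open_subgroup K G T" "K <#> N = H" for K
  proof -
    have "K \<in> subgroup_nbhd G T H (N1 \<inter> N2)"
      using open_imp_closed_subgroup[OF K(1)] K(2) HN by (simp add: subgroup_nbhd_def N_def)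
    then have "K \<in> subgroup_nbhd G T H N1"
      using subgroup_nbhd_Int_subset[OF N1(1) N2(1) Hc] by blast
    then show ?thesis using N1(2) by (simp add: subgroup_nbhd_def)
  qed
  have "topologically_finitely_generated G T"
  proof -
    define t where "t X = (SOME x. x \<in> X)" for X :: "'a set"
    define S where "S = t ` (rcosets N)"
    have t: "t X \<in> carrier G \<and> N #> t X = X" if "X \<in> rcosets N" for X
      unfolding t_def using some_rcoset_representative[OF ND(2) that] by simp
    have Sc: "S \<subseteq> carrier G" using t by (auto simp: S_def)
    define D where "D = generate G S"
    have D: "subgroup D G" unfolding D_def using Sc by (rule generate_is_subgroup)
    have "carrier G \<subseteq> T closure_of D"
    proof
      fix x assume x: "x \<in> carrier G"
      show "x \<in> T closure_of D"
        unfolding in_closure_of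
      proof (intro conjI allI impI)
        show "x \<in> topspace T" using x topspace_eq by simp
        fix V assume V: "x \<in> V \<and> openin T V"
        then obtain L where L: "open_normal_subgroup L G T" "L #> x \<subseteq> V" using openin_iff by blast
        note LD = open_normal_subgroupD[OF L(1)]
        define K where "K = D <#> L"
        have K: "open_subgroup K G T" unfolding K_def using open_subgroup_set_mult[OF D L(1)] .
        then have Ks: "subgroup K G" by (simp add: open_subgroup_def)
        have DK: "D \<subseteq> K" unfolding K_def using set_mult_superset1[OF subgroup.subset[OF D] LD(2)] .
        have KN: "K <#> N = carrier G"
        proof
          show "K <#> N \<subseteq> carrier G" using set_mult_closed[OF subgroup.subset[OF Ks] ND(4)] .
          show "carrier G \<subseteq> K <#> N"
          proof
            fix y assume y: "y \<in> carrier G"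
            then have Y: "N #> y \<in> rcosets N" by (auto simp: RCOSETS_def)
            have "t (N #> y) \<in> D" unfolding D_def using Y by (intro generate.incl) (simp add: S_def)
            then have "t (N #> y) \<in> K" using DK by blast
            moreover have "y \<in> N #> t (N #> y)" using t[OF Y] rcos_self[OF y ND(2)] by simp
            ultimately have "y \<in> N <#> K" by (auto simp: mem_r_coset mem_set_mult)
            then show "y \<in> K <#> N" using commut_normal[OF Ks ND(1)] by simp
          qed
        qed
        have "(K \<inter> H) <#> N = H"
          using set_mult_Int_modular[OF Hs subgroup.subset[OF Ks] NH] KN subgroup.subset[OF Hs] by auto
        moreover have "open_subgroup (K \<inter> H) G T"
          using K H subgroups_Inter_pair openin_Int by (auto simp: open_subgroup_def)
        ultimately have "K \<inter> H = H" using supp by blast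
        then have "N \<subseteq> K" using NH by blast
        then have "K = carrier G" using set_mult_subgroup_absorb[OF Ks ND(2)] KN by simp
        then have "x \<in> L <#> D" using x commut_normal[OF D LD(1)] by (simp add: K_def)
        then obtain l d where ld: "l \<in> L" "d \<in> D" "x = l \<otimes> d" by (auto simp: mem_set_mult)
        have c: "l \<in> carrier G" "d \<in> carrier G" using ld LD(4) subgroup.subset[OF D] by auto
        have "d = inv l \<otimes> x" using ld(3) c by simp
        then have "d \<in> L #> x" using subgroup.m_inv_closed[OF LD(2) ld(1)] by (auto simp: mem_r_coset)
        then show "\<exists>y. y \<in> D \<and> y \<in> V" using L(2) ld(2) by blast
      qed
    qed
    then have "T closure_of D = carrier G" using closure_of_subset_topspace[of T D] topspace_eq by auto
    moreover have "finite S" unfolding S_def using finite_rcosets[OF ND(5)] by simp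
    ultimately show ?thesis unfolding topologically_finitely_generated_def using Sc D_def by blast
  qed
  moreover have "virtually_pronilpotent G T"
  proof -
    interpret N: profinite "G\<lparr>carrier := N\<rparr>" "subtopology T N" using ND(5) by (rule profinite_restrict)
    have "pronilpotent_group (G\<lparr>carrier := N\<rparr>) (subtopology T N)"
    proof (rule N.pronilpotent_if_lower_central)
      fix L' assume "open_normal_subgroup L' (G\<lparr>carrier := N\<rparr>) (subtopology T N)"
      then have L': "open_subgroup L' G T" "L' \<subseteq> N"
        using N.open_normal_subgroupD(5) open_subgroup_restrict_iff[OF ND(5)] by auto
      obtain L where L: "open_normal_subgroup L G T" "L \<subseteq> L'" by (rule open_subgroup_contains_open_normal[OF L'(1)])
      then have "\<exists>n. lower_central (G\<lparr>carrier := N\<rparr>) n \<subseteq> L"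
        using nonsupplemented_finite_quotient(1)[OF H N NH supp L(1)] L'(2) by blast
      then show "\<exists>n. lower_central (G\<lparr>carrier := N\<rparr>) n \<subseteq> L'" using L(2) by blast
    qed
    then show ?thesis unfolding virtually_pronilpotent_def using ND(5) by blast
  qed
  moreover have "finite {p. prime_divides_order p G T}"
  proof (rule finite_subset)
    show "finite {p. p dvd card (rcosets N)}"
      using card_rcosets_pos[OF ND(5)] by (intro finite_divisors_nat) simp
    show "{p. prime_divides_order p G T} \<subseteq> {p. p dvd card (rcosets N)}"
    proof clarify
      fix p assume pd: "prime_divides_order p G T"
      then have p: "Factorial_Ring.prime p" by (simp add: prime_divides_order_def)
      obtain M where M: "open_normal_subgroup M G T" "p dvd card (rcosets M)"
        using pd prime_divides_order_iff[OF p] by blast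
      have MN: "open_normal_subgroup (M \<inter> N) G T" using open_normal_subgroup_Int[OF M(1) N] .
      note MND = open_normal_subgroupD[OF MN]
      have "p dvd card (rcosets (M \<inter> N))"
        using card_rcosets_tower[OF MND(2) open_normal_subgroupD(2)[OF M(1)]] M(2) by simp
      then have "p dvd card (rcosets\<^bsub>G\<lparr>carrier := N\<rparr>\<^esub> (M \<inter> N)) * card (rcosets N)"
        using card_rcosets_tower[OF MND(2) ND(2)] by simp
      then consider "p dvd card (rcosets\<^bsub>G\<lparr>carrier := N\<rparr>\<^esub> (M \<inter> N))" | "p dvd card (rcosets N)"
        using p prime_dvd_mult_iff by blast
      then show "p dvd card (rcosets N)"
        using nonsupplemented_finite_quotient(2)[OF H N NH supp MN _ p] by cases auto
    qed
  qed
  ultimately show ?thesis by blast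
qed

end

theorem theorem5p6:
  fixes G :: "('a, 'c) monoid_scheme" and T :: "'a topology"
  assumes "profinite_group G T"
  shows "(\<not> perfect_space (subgroup_space G T)
            \<longleftrightarrow> (\<exists>H. open_subgroup H G T \<and> isolated_subgroup H G T))
       \<and> ((\<exists>H. open_subgroup H G T \<and> isolated_subgroup H G T)
            \<longleftrightarrow> (\<forall>H. open_subgroup H G T \<longrightarrow> isolated_subgroup H G T))
       \<and> ((\<forall>H. open_subgroup H G T \<longrightarrow> isolated_subgroup H G T)
            \<longleftrightarrow> open_normal_subgroup (frattini G T) G T)
       \<and> (open_normal_subgroup (frattini G T) G T
            \<longleftrightarrow> topologically_finitely_generated G T \<and> virtually_pronilpotent G T \<and>
                finite {p. prime_divides_order p G T})"
proof -
  interpret profinite G T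
    using assms profinite_if_inverse_limit by (auto simp: profinite_group_def)
  define i ii iii iv v where "i \<longleftrightarrow> \<not> perfect_space (subgroup_space G T)"
    and "ii \<longleftrightarrow> (\<exists>H. open_subgroup H G T \<and> isolated_subgroup H G T)"
    and "iii \<longleftrightarrow> (\<forall>H. open_subgroup H G T \<longrightarrow> isolated_subgroup H G T)"
    and "iv \<longleftrightarrow> open_normal_subgroup (frattini G T) G T"
    and "v \<longleftrightarrow> topologically_finitely_generated G T \<and> virtually_pronilpotent G T \<and>
                finite {p. prime_divides_order p G T}"
  note G_open = open_normal_subgroupD(5)[OF open_normal_subgroup_carrier]
  have "i \<longleftrightarrow> ii" unfolding i_def ii_def by (rule perfect_iff_no_isolated_open)
  moreover have "ii \<Longrightarrow> v" unfolding ii_def v_def using virtually_pronilpotent_if_isolated_open by blast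
  moreover have "v \<Longrightarrow> iii" unfolding v_def iii_def
    using open_subgroup_isolated_if_virtually_pronilpotent by blast
  moreover have "iii \<Longrightarrow> iv" unfolding iii_def iv_def
    using G_open isolated_carrier_iff_frattini_open by blast
  moreover have "iv \<Longrightarrow> ii" unfolding iv_def ii_def
    using G_open isolated_carrier_iff_frattini_open by blast
  ultimately have "(i \<longleftrightarrow> ii) \<and> (ii \<longleftrightarrow> iii) \<and> (iii \<longleftrightarrow> iv) \<and> (iv \<longleftrightarrow> v)" by blast
  then show ?thesis unfolding i_def ii_def iii_def iv_def v_def .
qed

end
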